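(* Let $n,m\ge1$, $\eta>0$, and for $i=1,\dots,n$, $j=1,\dots,m$ let $f_i:\mathbb{R}^d\to\mathbb{R}$ be $\alpha_{f_i}$-strongly convex and $g_j:\mathbb{R}^d\to\mathbb{R}$ be $\alpha_{g_j}$-strongly convex (all constants positive). Let $\sigma_{ij}\in[0,1]$ with $\sum_{i=1}^n\sigma_{ij}>0$ for all $j$ and $\sum_{j=1}^m\sigma_{ij}>0$ for all $i$. Let $\mathbf{X}=(X_1,\dots,X_n)$, $\mathbf{Y}=(Y_1,\dots,Y_m)$ with $X_i,Y_j\in\mathbb{R}^d$, and $$\pi^{\mathbf{XY}}\propto\exp\Big[-\sum_{i=1}^nf_i(x_i)-\sum_{j=1}^mg_j(y_j)-\sum_{i=1}^n\sum_{j=1}^m\frac{\sigma_{ij}}{2\eta}\|x_i-y_j\|_2^2\Big].$$ Consider the blocked Gibbs sampler: draw $\mathbf{X}^0\sim\mu_0^{\mathbf X}$; for $k=0,1,2,\dots$, given $\mathbf X^k$ draw independently for each $j$, $\mathbf{Y}^k_j\sim\propto\exp[-g_j(y_j)-\sum_{i=1}^n\frac{\sigma_{ij}}{2\eta}\|\mathbf X^k_i-y_j\|_2^2]$, and then given $\mathbf Y^k$ draw independently for each $i$, $\mathbf X^{k+1}_i\sim\propto\exp[-f_i(x_i)-\sum_{j=1}^m\frac{\sigma_{ij}}{2\eta}\|x_i-\mathbf Y^k_j\|_2^2]$. Let $\mu_k^{\mathbf{XY}}$ be the law of $(\mathbf X^k,\mathbf Y^k)$. Then for all $k\ge0$, $$D_{\mathrm{KL}}(\mu_k^{\mathbf{XY}}\|\pi^{\mathbf{XY}})\le\exp(-kC)\,D_{\mathrm{KL}}(\mu_0^{\mathbf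 X}\|\pi^{\mathbf X}),$$ where $$C=\frac{\eta}{n}\int_0^1\Big[\frac{\eta t(1-t)}{\min_j\sum_{i=1}^n\sigma_{ij}}+\frac{mn(1-t)^2}{\min_i\alpha_{f_i}}+\frac{t^2}{\min_j\alpha_{g_j}}\Big]^{-1}\mathrm{d}t+\frac{\eta}{m}\int_0^1\Big[\frac{\eta t(1-t)}{\min_i\sum_{j=1}^m\sigma_{ij}}+\frac{mn(1-t)^2}{\min_j\alpha_{g_j}}+\frac{t^2}{\min_i\alpha_{f_i}}\Big]^{-1}\mathrm{d}t.$$
   Context: $\pi^{\mathbf X}$ denotes the $\mathbf X$-marginal of $\pi^{\mathbf{XY}}$. $D_{\mathrm{KL}}(\mu\|\nu)=\int\mu\log\frac{\mu}{\nu}$. A function $f$ is $\alpha$-strongly convex if $f(x)-f(y)\ge\nabla f(y)^T(x-y)+\frac\alpha2\|x-y\|_2^2$ for all $x,y$. *)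

theory Defs
  imports "HOL-Probability.Probability"
begin

text \<open>Strong convexity, in the gradient form of the paper: the derivative D of f at y
  plays the role of the linear map v \<mapsto> grad f(y)^T v.\<close>
definition strongly_convex :: "real \<Rightarrow> ('a::euclidean_space \<Rightarrow> real) \<Rightarrow> bool" where
  "strongly_convex \<alpha> f \<longleftrightarrow>
     (\<forall>y. \<exists>D. (f has_derivative D) (at y) \<and>
        (\<forall>x. f x - f y \<ge> D (x - y) + \<alpha> / 2 * (norm (x - y))\<^sup>2))"

definition gibbs :: "'b measure \<Rightarrow> ('b \<Rightarrow> real) \<Rightarrow> 'b measure" where
  "gibbs M U = density M (\<lambda>z. ennreal (exp (- U z)) / (\<integral>\<^sup>+ w. ennreal (exp (- U w)) \<partial>M))"

text \<open>KL divergence D(mu || nu) = int mu log (mu/nu), with value infinity if mu is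
  not absolutely continuous w.r.t. nu. The integrand rho log rho (rho = dmu/dnu) is
  split into positive and negative parts (the negative part is bounded by 1/e).\<close>
definition KL :: "'b measure \<Rightarrow> 'b measure \<Rightarrow> ereal" where
  "KL \<mu> \<nu> =
     (if sets \<mu> = sets \<nu> \<and> absolutely_continuous \<nu> \<mu> then
        (let \<rho> = (\<lambda>x. enn2real (RN_deriv \<nu> \<mu> x)) in
          enn2ereal (\<integral>\<^sup>+ x. ennreal (max 0 (\<rho> x * ln (\<rho> x))) \<partial>\<nu>)
          - enn2ereal (\<integral>\<^sup>+ x. ennreal (max 0 (- (\<rho> x * ln (\<rho> x)))) \<partial>\<nu>))
      else \<infinity>)"

text \<open>State spaces: X = (X_0..X_{n-1}), Y = (Y_0..Y_{m-1}), each component in 'a = R^d.\<close>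
definition blockM :: "nat \<Rightarrow> (nat \<Rightarrow> 'a::euclidean_space) measure" where
  "blockM n = PiM {..<n} (\<lambda>_. lborel)"

definition target ::
  "nat \<Rightarrow> nat \<Rightarrow> real \<Rightarrow> (nat \<Rightarrow> nat \<Rightarrow> real) \<Rightarrow> (nat \<Rightarrow> 'a \<Rightarrow> real) \<Rightarrow> (nat \<Rightarrow> 'a \<Rightarrow> real)
    \<Rightarrow> ((nat \<Rightarrow> 'a::euclidean_space) \<times> (nat \<Rightarrow> 'a)) measure" where
  "target n m \<eta> \<sigma> f g = gibbs (blockM n \<Otimes>\<^sub>M blockM m)
     (\<lambda>(x, y). (\<Sum>i<n. f i (x i)) + (\<Sum>j<m. g j (y j))
        + (\<Sum>i<n. \<Sum>j<m. \<sigma> i j / (2 * \<eta>) * (norm (x i - y j))\<^sup>2))"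

definition kernelY ::
  "nat \<Rightarrow> nat \<Rightarrow> real \<Rightarrow> (nat \<Rightarrow> nat \<Rightarrow> real) \<Rightarrow> (nat \<Rightarrow> 'a \<Rightarrow> real)
    \<Rightarrow> (nat \<Rightarrow> 'a::euclidean_space) \<Rightarrow> (nat \<Rightarrow> 'a) measure" where
  "kernelY n m \<eta> \<sigma> g x = PiM {..<m} (\<lambda>j. gibbs lborel
     (\<lambda>yj. g j yj + (\<Sum>i<n. \<sigma> i j / (2 * \<eta>) * (norm (x i - yj))\<^sup>2)))"

definition kernelX ::
  "nat \<Rightarrow> nat \<Rightarrow> real \<Rightarrow> (nat \<Rightarrow> nat \<Rightarrow> real) \<Rightarrow> (nat \<Rightarrow> 'a \<Rightarrow> real)
    \<Rightarrow> (nat \<Rightarrow> 'a::euclidean_space) \<Rightarrow> (nat \<Rightarrow> 'a) measure" where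
  "kernelX n m \<eta> \<sigma> f y = PiM {..<n} (\<lambda>i. gibbs lborel
     (\<lambda>xi. f i xi + (\<Sum>j<m. \<sigma> i j / (2 * \<eta>) * (norm (xi - y j))\<^sup>2)))"

fun lawX and lawXY where
  "lawX n m \<eta> \<sigma> f g \<mu>0 0 = \<mu>0"
| "lawX n m \<eta> \<sigma> f g \<mu>0 (Suc k) =
     bind (lawXY n m \<eta> \<sigma> f g \<mu>0 k) (\<lambda>p. kernelX n m \<eta> \<sigma> f (snd p))"
| "lawXY n m \<eta> \<sigma> f g \<mu>0 k =
     bind (lawX n m \<eta> \<sigma> f g \<mu>0 k)
       (\<lambda>x. distr (kernelY n m \<eta> \<sigma> g x) (blockM n \<Otimes>\<^sub>M blockM m) (\<lambda>y. (x, y)))"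

definition rateC ::
  "nat \<Rightarrow> nat \<Rightarrow> real \<Rightarrow> (nat \<Rightarrow> nat \<Rightarrow> real) \<Rightarrow> (nat \<Rightarrow> real) \<Rightarrow> (nat \<Rightarrow> real) \<Rightarrow> real" where
  "rateC n m \<eta> \<sigma> af ag =
     (let sY = Min ((\<lambda>j. \<Sum>i<n. \<sigma> i j) ` {..<m});
          sX = Min ((\<lambda>i. \<Sum>j<m. \<sigma> i j) ` {..<n});
          aF = Min (af ` {..<n});
          aG = Min (ag ` {..<m})
      in \<eta> / real n * integral {0..1} (\<lambda>t. inverse
             (\<eta> * t * (1 - t) / sY + real m * real n * (1 - t)\<^sup>2 / aF + t\<^sup>2 / aG))
       + \<eta> / real m * integral {0..1} (\<lambda>t. inverse
             (\<eta> * t * (1 - t) / sX + real m * real n * (1 - t)\<^sup>2 / aG + t\<^sup>2 / aF)))"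

end

theory Submission
  imports Defs
begin

text \<open>
  Let \<open>\<rho>\<close> be the density of the law of \<open>X\<close> with respect to \<open>\<pi>\<^sup>X\<close>. A half step replaces it by
  \<open>h y = E[\<rho>(X) | y]\<close>, and the chain rule splits the divergence of \<open>\<rho>\<close> into the divergence of \<open>h\<close> plus
  the averaged conditional divergences \<open>K(y) = KL(law(X | y) | \<pi>(X | y))\<close>. The half step contracts by
  \<open>1 / (kF kG)\<close> because the second term is at least \<open>kF kG - 1\<close> times the first:

  \<^item> changing \<open>y\<close> to \<open>z\<close> tilts \<open>\<pi>(X | y)\<close> by an exponential of a linear function, and \<open>\<pi>(X | y)\<close> is
    strongly log-concave, hence sub-Gaussian; so \<open>ln (h y) - ln (h z)\<close> is bounded by a multiple of \<open>K(y)\<close>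
    plus a quadratic form in \<open>y - z\<close>;
  \<^item> the joint density of \<open>(X, Y)\<close> is strongly log-concave, so the Prekopa-Leindler inequality with weight
    \<open>1 - s\<close> absorbs this quadratic form and bounds the exponential moment of \<open>(ln h - K / l) / (1 - s)\<close>;
    Jensen's inequality and \<open>s \<rightarrow> 0\<close> turn this into the comparison of the two entropies.

  The sub-Gaussian bound itself is another instance of Prekopa-Leindler. Two half steps give the factor
  \<open>(kF kG)\<^sup>-\<^sup>2\<close> per sweep, and an elementary estimate of the integrals shows \<open>rateC \<le> 2 ln (kF kG)\<close>.
\<close>

subsection \<open>The Prekopa-Leindler inequality\<close>

text \<open>The \<open>Y\<close> step draws from the exact conditional law, so the density of
  \<open>(X, Y)\<close> relative to the target depends on \<open>x\<close> alone. The joint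
  divergence therefore equals that of the \<open>X\<close>-marginal, and only the latter has to be
  contracted. The constants come from comparing curvatures. As \<sigma> is at most 1, the curvature
  of the potential in each \<open>x i\<close> is at least \<open>kF\<close> times the part due to
  the coupling. Splitting the cross terms of the coupling accordingly leaves, in \<open>y\<close>, a
  convexity of \<open>kF * kG - 1\<close> times the very quadratic form that bounds the tilt. The
  density \<rho> is merely measurable, so no gradient of \<open>ln h\<close> is available. Two
  parameters tied by \<open>(1 + l) * s = (1 - s) * (kF * kG - 1)\<close> replace differentiation:
  moving by the fraction \<open>s\<close> from \<open>y\<close> towards another point costs
  \<open>(1 + l) / 2\<close> times the square of \<open>s\<close>, while convexity pays back an
  amount of order \<open>s\<close>. So \<open>l\<close> may grow like \<open>1 / s\<close>, and the
  loss in the constant disappears in the limit.\<close>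

definition epow :: "ennreal \<Rightarrow> real \<Rightarrow> ennreal" where
  "epow x t = (if x = \<top> then \<top> else ennreal (enn2real x powr t))"

lemma epow_ennreal: "0 \<le> r \<Longrightarrow> epow (ennreal r) t = ennreal (r powr t)"
  by (simp add: epow_def)

text \<open>With \<top> and 0 both fixed, a product of powers makes sense for all functions into
  \<open>ennreal\<close>, and a vanishing factor makes it 0 even against \<top>.\<close>

lemma epow_top [simp]: "epow \<top> t = \<top>"
  by (simp add: epow_def)

lemma epow_0 [simp]: "epow 0 t = 0"
  by (simp add: epow_def)

lemma epow_1 [simp]: "epow 1 t = 1"
  by (simp add: epow_def)

lemma epow_mono: "x \<le> y \<Longrightarrow> 0 \<le> t \<Longrightarrow> epow x t \<le> epow y t"
  by (cases x; cases y) (auto simp: epow_ennreal top_unique intro!: ennreal_leI powr_mono2)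

lemma epow_epow: "0 < t \<Longrightarrow> epow (epow x t) (1 / t) = x"
  by (cases x) (auto simp: epow_ennreal powr_powr)

lemma epow_mult:
  assumes "0 < c" shows "epow (ennreal c * x) t = ennreal (c powr t) * epow x t"
proof (cases x)
  case (real r)
  then show ?thesis using assms
    by (simp add: epow_ennreal powr_mult flip: ennreal_mult)
qed (use assms in \<open>simp add: ennreal_mult_top\<close>)

text \<open>For positive exponent the power is an order isomorphism with inverse
  \<open>epow _ (1 / t)\<close>, so it commutes with suprema by monotonicity alone.\<close>

lemma epow_SUP:
  fixes X :: "nat \<Rightarrow> ennreal"
  assumes "0 < t"
  shows "epow (SUP i. X i) t = (SUP i. epow (X i) t)"
proof (rule antisym)
  show "(SUP i. epow (X i) t) \<le> epow (SUP i. X i) t"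
    using assms by (intro SUP_least epow_mono SUP_upper) auto
  have "(SUP i. X i) \<le> epow (SUP i. epow (X i) t) (1 / t)"
  proof (rule SUP_least)
    fix i
    have "X i = epow (epow (X i) t) (1 / t)"
      using assms by (simp add: epow_epow)
    also have "\<dots> \<le> epow (SUP i. epow (X i) t) (1 / t)"
      using assms by (intro epow_mono SUP_upper) auto
    finally show "X i \<le> epow (SUP i. epow (X i) t) (1 / t)" .
  qed
  then have "epow (SUP i. X i) t \<le> epow (epow (SUP i. epow (X i) t) (1 / t)) t"
    using assms by (intro epow_mono) auto
  also have "\<dots> = (SUP i. epow (X i) t)"
    using epow_epow[of "1 / t"] assms by simp
  finally show "epow (SUP i. X i) t \<le> (SUP i. epow (X i) t)" .
qed

text \<open>An infinite argument makes the right side infinite because both weights are positive.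
  The inequality converts the additive bound for functions with equal suprema into the
  multiplicative one.\<close>

lemma epow_arith_geom_mean:
  assumes "0 < t" "t < 1"
  shows "epow a t * epow b (1 - t) \<le> ennreal t * a + ennreal (1 - t) * b"
proof (cases "a = \<top> \<or> b = \<top>")
  case True
  then show ?thesis using assms by (auto simp: ennreal_mult_top)
next
  case False
  then obtain r q where ab: "a = ennreal r" "0 \<le> r" "b = ennreal q" "0 \<le> q"
    by (metis ennreal_cases)
  have "r powr t * q powr (1 - t) \<le> t * r + (1 - t) * q"
    using Youngs_inequality_0[of t "1 - t" r q] assms ab
    by (cases "r = 0 \<or> q = 0") auto
  then show ?thesis
    using ab assms by (simp add: epow_ennreal flip: ennreal_mult ennreal_plus)
qed

text \<open>The cut points must lie in the set, since they serve below as translation vectors. A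
  maximum gives a constant sequence; otherwise an increasing sequence towards the supremum, taken in
  \<open>ereal\<close> as the set may be unbounded, exhausts the set.\<close>

lemma emeasure_initial_segments_tendsto:
  fixes A :: "real set"
  assumes A: "A \<in> sets borel" "A \<noteq> {}"
  obtains a :: "nat \<Rightarrow> real" where "range a \<subseteq> A"
    "(\<lambda>k. emeasure lborel (A \<inter> {..a k})) \<longlonglongrightarrow> emeasure lborel A"
proof (cases "\<exists>m\<in>A. \<forall>x\<in>A. x \<le> m")
  case True
  then obtain m where m: "m \<in> A" "\<forall>x\<in>A. x \<le> m" by auto
  then have "A \<inter> {..m} = A" by auto
  with m that[of "\<lambda>_. m"] show ?thesis by auto
next
  case False
  obtain f where f: "incseq f" "range f \<subseteq> ereal ` A" "Sup (ereal ` A) = (SUP i. f i)"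
    using Sup_countable_SUP[of "ereal ` A"] A by auto
  define a where "a k = real_of_ereal (f k)" for k
  have "f k \<in> ereal ` A" for k using f(2) by blast
  then have fa: "f k = ereal (a k)" "a k \<in> A" for k
    unfolding a_def by (metis imageE real_of_ereal.simps(1))+
  have inc: "incseq (\<lambda>k. A \<inter> {..a k})"
    using f(1) unfolding incseq_def fa by auto (meson order_trans)
  have "x \<in> (\<Union>k. A \<inter> {..a k})" if x: "x \<in> A" for x
  proof -
    obtain y where y: "y \<in> A" "x < y" using False x by force
    have "ereal x < (SUP i. f i)"
      using y by (metis f(3) SUP_upper ereal_less_eq(3) image_eqI less_ereal.simps(1) order_less_le_trans)
    then obtain k where "ereal x < f k" by (auto simp: less_SUP_iff)
    then show ?thesis using x by (auto simp: fa intro!: exI[of _ k])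
  qed
  then have "(\<Union>k. A \<inter> {..a k}) = A" by auto
  moreover have "(\<lambda>k. emeasure lborel (A \<inter> {..a k})) \<longlonglongrightarrow> emeasure lborel (\<Union>k. A \<inter> {..a k})"
    by (rule Lim_emeasure_incseq) (use A inc in auto)
  ultimately show ?thesis using that[of a] fa by auto
qed

lemma emeasure_lborel_real_affine:
  fixes t c :: real
  assumes [measurable]: "C \<in> sets borel" and t: "0 < t"
  shows "emeasure lborel C = ennreal t * emeasure lborel {x. c + t * x \<in> C}"
proof -
  have [measurable]: "{x. c + t * x \<in> C} \<in> sets borel"
    by measurable
  have "emeasure lborel C = (\<integral>\<^sup>+x. indicator C x \<partial>lborel)"
    by simp
  also have "\<dots> = ennreal \<bar>t\<bar> * (\<integral>\<^sup>+x. indicator C (c + t * x) \<partial>lborel)"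
    by (rule nn_integral_real_affine) (use t in auto)
  also have "(\<integral>\<^sup>+x. indicator C (c + t * x) \<partial>lborel) = (\<integral>\<^sup>+x. indicator {x. c + t * x \<in> C} x \<partial>lborel)"
    by (intro nn_integral_cong) (auto simp: indicator_def)
  also have "\<dots> = emeasure lborel {x. c + t * x \<in> C}"
    by (rule nn_integral_indicator) simp
  finally show ?thesis using t by simp
qed

text \<open>For \<open>a \<in> A\<close> and \<open>b \<in> B\<close> the sets \<open>t (A \<inter> {..a}) + s b\<close> and \<open>t a + s (B \<inter> {b..})\<close>
  both lie in \<open>C\<close> and meet in a single point.\<close>

lemma brunn_minkowski_real:
  fixes A B C :: "real set"
  assumes [measurable]: "A \<in> sets borel" "B \<in> sets borel" "C \<in> sets borel"
    and ne: "A \<noteq> {}" "B \<noteq> {}" and t: "0 < t" and s: "0 < s"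
    and C: "\<And>a b. a \<in> A \<Longrightarrow> b \<in> B \<Longrightarrow> t * a + s * b \<in> C"
  shows "ennreal t * emeasure lborel A + ennreal s * emeasure lborel B \<le> emeasure lborel C"
proof -
  have *: "ennreal t * emeasure lborel (A \<inter> {..a}) + ennreal s * emeasure lborel (B \<inter> {b..})
      \<le> emeasure lborel C" if ab: "a \<in> A" "b \<in> B" for a b
  proof -
    let ?c = "t * a + s * b"
    have 1: "ennreal t * emeasure lborel (A \<inter> {..a}) \<le> emeasure lborel (C \<inter> {..?c})"
      unfolding emeasure_lborel_real_affine[of "C \<inter> {..?c}" t "s * b", OF _ t, simplified]
      using C ab t by (intro mult_left_mono emeasure_mono) (auto simp: add.commute)
    \<comment> \<open>The point \<open>b\<close> is removed at no cost in measure, so that the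
      second piece of \<open>C\<close> lies strictly beyond \<open>?c\<close> and is disjoint from
      the first.\<close>
    have "emeasure lborel (B \<inter> {b..}) \<le> emeasure lborel ({b} \<union> (B \<inter> {b<..}))"
      by (intro emeasure_mono) auto
    also have "\<dots> \<le> emeasure lborel {b} + emeasure lborel (B \<inter> {b<..})"
      by (intro emeasure_subadditive) auto
    finally have "ennreal s * emeasure lborel (B \<inter> {b..}) \<le> ennreal s * emeasure lborel (B \<inter> {b<..})"
      by (intro mult_left_mono) auto
    also have "\<dots> \<le> emeasure lborel (C \<inter> {?c<..})"
      unfolding emeasure_lborel_real_affine[of "C \<inter> {?c<..}" s "t * a", OF _ s, simplified]
      using C ab s by (intro mult_left_mono emeasure_mono) auto
    finally have "ennreal t * emeasure lborel (A \<inter> {..a}) + ennreal s * emeasure lborel (B \<inter> {b..})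
        \<le> emeasure lborel (C \<inter> {..?c}) + emeasure lborel (C \<inter> {?c<..})"
      using 1 by (intro add_mono)
    also have "\<dots> = emeasure lborel ((C \<inter> {..?c}) \<union> (C \<inter> {?c<..}))"
      by (intro plus_emeasure) auto
    also have "\<dots> \<le> emeasure lborel C"
      by (intro emeasure_mono) auto
    finally show ?thesis .
  qed
  obtain a where a: "range a \<subseteq> A"
      "(\<lambda>k. emeasure lborel (A \<inter> {..a k})) \<longlonglongrightarrow> emeasure lborel A"
    using emeasure_initial_segments_tendsto[of A] ne by auto
  \<comment> \<open>Final segments of \<open>B\<close> are initial segments of its reflection, which
    has the same measure.\<close>
  have refl: "emeasure lborel {x. - x \<in> X} = emeasure lborel X" if [measurable]: "X \<in> sets borel" for X :: "real set"
  proof -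
    have "emeasure lborel X = emeasure (distr lborel borel uminus) X"
      by (simp add: lborel_distr_uminus)
    then show ?thesis by (simp add: emeasure_distr vimage_def)
  qed
  have [measurable]: "{x. - x \<in> B} \<in> sets borel" by measurable
  have "{x. - x \<in> B} \<noteq> {}" using ne by (auto intro: exI[of _ "- _"])
  then obtain b where b: "range b \<subseteq> {x. - x \<in> B}"
      "(\<lambda>k. emeasure lborel ({x. - x \<in> B} \<inter> {..b k})) \<longlonglongrightarrow> emeasure lborel {x. - x \<in> B}"
    using emeasure_initial_segments_tendsto[of "{x. - x \<in> B}"] by auto
  have "{x. - x \<in> B} \<inter> {..b k} = {x. - x \<in> B \<inter> {- b k..}}" for k by auto
  then have b': "(\<lambda>k. emeasure lborel (B \<inter> {- b k..})) \<longlonglongrightarrow> emeasure lborel B"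
    using b(2) refl[of B] refl[of "B \<inter> {- b _..}"] by simp
  have "(\<lambda>k. ennreal t * emeasure lborel (A \<inter> {..a k}) + ennreal s * emeasure lborel (B \<inter> {- b k..}))
      \<longlonglongrightarrow> ennreal t * emeasure lborel A + ennreal s * emeasure lborel B"
    by (intro tendsto_add ennreal_tendsto_cmult a b') auto
  then show ?thesis
    by (rule LIMSEQ_le_const2) (use a(1) b(1) in \<open>auto intro!: exI[of _ 0] *\<close>)
qed

text \<open>Both suprema equal 1, so at every level in \<open>(0, 1)\<close> both superlevel sets
  are nonempty and \<open>brunn_minkowski_real\<close> compares them with the superlevel set of
  \<open>w\<close>; integrating over the levels gives the integrals. With unequal suprema one of the
  two sets could be empty while the other is not.\<close>

lemma prekopa_leindler_normalized:
  fixes u v :: "real \<Rightarrow> real" and w :: "real \<Rightarrow> ennreal"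
  assumes [measurable]: "u \<in> borel_measurable borel" "v \<in> borel_measurable borel" "w \<in> borel_measurable borel"
    and u: "\<And>x. u x \<le> 1" "\<And>l. l < 1 \<Longrightarrow> \<exists>x. l < u x"
    and v: "\<And>x. v x \<le> 1" "\<And>l. l < 1 \<Longrightarrow> \<exists>x. l < v x"
    and t: "0 < t" "t < 1"
    and w: "\<And>x y l. 0 < l \<Longrightarrow> l < u x \<Longrightarrow> l < v y \<Longrightarrow> ennreal l \<le> w (t * x + (1 - t) * y)"
  shows "ennreal t * (\<integral>\<^sup>+x. ennreal (u x) \<partial>lborel) + ennreal (1 - t) * (\<integral>\<^sup>+x. ennreal (v x) \<partial>lborel)
      \<le> (\<integral>\<^sup>+x. w x \<partial>lborel)"
proof -
  have layer: "(\<integral>\<^sup>+x. ennreal (g x) \<partial>lborel)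
      = (\<integral>\<^sup>+l. indicator {0<..<1} l * emeasure lborel {x. l < g x} \<partial>lborel)"
    if [measurable]: "g \<in> borel_measurable borel" and g: "\<And>x. g x \<le> 1" for g :: "real \<Rightarrow> real"
  proof -
    have "(\<integral>\<^sup>+x. ennreal (g x) \<partial>lborel)
        = (\<integral>\<^sup>+x. (\<integral>\<^sup>+l. (if 0 < l \<and> l < 1 \<and> l < g x then 1 else 0) \<partial>lborel) \<partial>lborel)"
    proof (rule nn_integral_cong)
      fix x
      have "(\<integral>\<^sup>+l. (if 0 < l \<and> l < 1 \<and> l < g x then 1 else 0) \<partial>lborel)
          = (\<integral>\<^sup>+l. indicator {0<..<g x} l \<partial>lborel)"
        using g[of x] by (intro nn_integral_cong) auto
      also have "\<dots> = ennreal (g x)"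
        by (cases "0 \<le> g x") (auto simp: ennreal_neg)
      finally show "ennreal (g x) = (\<integral>\<^sup>+l. (if 0 < l \<and> l < 1 \<and> l < g x then 1 else 0) \<partial>lborel)" ..
    qed
    also have "\<dots> = (\<integral>\<^sup>+l. (\<integral>\<^sup>+x. (if 0 < l \<and> l < 1 \<and> l < g x then 1 else 0) \<partial>lborel) \<partial>lborel)"
      by (rule lborel_pair.Fubini') measurable
    also have "\<dots> = (\<integral>\<^sup>+l. indicator {0<..<1} l * emeasure lborel {x. l < g x} \<partial>lborel)"
    proof (rule nn_integral_cong)
      fix l
      have "(\<integral>\<^sup>+x. (if 0 < l \<and> l < 1 \<and> l < g x then 1 else 0) \<partial>lborel)
          = (\<integral>\<^sup>+x. indicator {0<..<1} l * indicator {x. l < g x} x \<partial>lborel)"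
        by (intro nn_integral_cong) auto
      also have "\<dots> = indicator {0<..<1} l * emeasure lborel {x. l < g x}"
        by (subst nn_integral_cmult_indicator) auto
      finally show "(\<integral>\<^sup>+x. (if 0 < l \<and> l < 1 \<and> l < g x then 1 else 0) \<partial>lborel)
          = indicator {0<..<1} l * emeasure lborel {x. l < g x}" .
    qed
    finally show ?thesis .
  qed
  have meas [measurable]: "(\<lambda>l. emeasure lborel {x. l < g x}) \<in> borel_measurable borel"
    if [measurable]: "g \<in> borel_measurable borel" for g :: "real \<Rightarrow> real"
  proof -
    have "emeasure lborel {x. l < g x} = (\<integral>\<^sup>+x. (if l < g x then 1 else 0) \<partial>lborel)" for l
    proof -
      have "(\<integral>\<^sup>+x. (if l < g x then 1 else 0) \<partial>lborel) = (\<integral>\<^sup>+x. indicator {x. l < g x} x \<partial>lborel)"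
        by (intro nn_integral_cong) auto
      then show ?thesis by simp
    qed
    then show ?thesis by simp
  qed
  have "ennreal t * (\<integral>\<^sup>+x. ennreal (u x) \<partial>lborel) + ennreal (1 - t) * (\<integral>\<^sup>+x. ennreal (v x) \<partial>lborel)
      = (\<integral>\<^sup>+l. indicator {0<..<1} l * (ennreal t * emeasure lborel {x. l < u x}
            + ennreal (1 - t) * emeasure lborel {x. l < v x}) \<partial>lborel)"
    using u v by (simp add: layer nn_integral_add nn_integral_cmult distrib_left mult.left_commute)
  also have "\<dots> \<le> (\<integral>\<^sup>+l. indicator {0<..<1} l * emeasure lborel {x. ennreal l \<le> w x} \<partial>lborel)"
  proof (rule nn_integral_mono)
    fix l
    have "ennreal t * emeasure lborel {x. l < u x} + ennreal (1 - t) * emeasure lborel {x. l < v x}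
        \<le> emeasure lborel {x. ennreal l \<le> w x}" if "0 < l" "l < 1"
      using that u v t w by (intro brunn_minkowski_real) auto
    then show "indicator {0<..<1} l * (ennreal t * emeasure lborel {x. l < u x}
            + ennreal (1 - t) * emeasure lborel {x. l < v x})
        \<le> indicator {0<..<1} l * emeasure lborel {x. ennreal l \<le> w x}"
      by (auto split: split_indicator)
  qed
  also have "\<dots> = (\<integral>\<^sup>+l. (\<integral>\<^sup>+x. (if 0 < l \<and> l < 1 \<and> ennreal l \<le> w x then 1 else 0) \<partial>lborel) \<partial>lborel)"
  proof (rule nn_integral_cong)
    fix l
    have "(\<integral>\<^sup>+x. (if 0 < l \<and> l < 1 \<and> ennreal l \<le> w x then 1 else 0) \<partial>lborel)
        = (\<integral>\<^sup>+x. indicator {0<..<1} l * indicator {x. ennreal l \<le> w x} x \<partial>lborel)"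
      by (intro nn_integral_cong) auto
    also have "\<dots> = indicator {0<..<1} l * emeasure lborel {x. ennreal l \<le> w x}"
      by (subst nn_integral_cmult_indicator) auto
    finally show "indicator {0<..<1} l * emeasure lborel {x. ennreal l \<le> w x} =
        (\<integral>\<^sup>+x. (if 0 < l \<and> l < 1 \<and> ennreal l \<le> w x then 1 else 0) \<partial>lborel)" ..
  qed
  also have "\<dots> = (\<integral>\<^sup>+x. (\<integral>\<^sup>+l. (if 0 < l \<and> l < 1 \<and> ennreal l \<le> w x then 1 else 0) \<partial>lborel) \<partial>lborel)"
    by (rule lborel_pair.Fubini') measurable
  also have "\<dots> \<le> (\<integral>\<^sup>+x. w x \<partial>lborel)"
  proof (rule nn_integral_mono)
    fix x
    show "(\<integral>\<^sup>+l. (if 0 < l \<and> l < 1 \<and> ennreal l \<le> w x then 1 else 0) \<partial>lborel) \<le> w x"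
    proof (cases "w x")
      case (real r)
      have "(\<integral>\<^sup>+l. (if 0 < l \<and> l < 1 \<and> ennreal l \<le> w x then 1 else 0) \<partial>lborel)
          \<le> (\<integral>\<^sup>+l. indicator {0..r} l \<partial>lborel)"
        using real by (intro nn_integral_mono) (auto simp: ennreal_le_iff)
      then show ?thesis using real by simp
    qed simp
  qed
  finally show ?thesis .
qed

text \<open>The way of combining points is a parameter, so that one notion covers the line,
  products, Euclidean space and blocks. Values in \<open>ennreal\<close> keep it stable under
  passing to section integrals, which may be infinite.\<close>

definition prekopa_leindler :: "real \<Rightarrow> 'b measure \<Rightarrow> ('b \<Rightarrow> 'b \<Rightarrow> 'b) \<Rightarrow> bool" where
  "prekopa_leindler t M c \<longleftrightarrow>
     (\<forall>u\<in>borel_measurable M. \<forall>v\<in>borel_measurable M. \<forall>w\<in>borel_measurable M.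
        (\<forall>x\<in>space M. \<forall>y\<in>space M. epow (u x) t * epow (v y) (1 - t) \<le> w (c x y)) \<longrightarrow>
        epow (\<integral>\<^sup>+x. u x \<partial>M) t * epow (\<integral>\<^sup>+x. v x \<partial>M) (1 - t) \<le> (\<integral>\<^sup>+x. w x \<partial>M))"

lemma prekopa_leindlerD:
  assumes "prekopa_leindler t M c"
    and "u \<in> borel_measurable M" "v \<in> borel_measurable M" "w \<in> borel_measurable M"
    and "\<And>x y. x \<in> space M \<Longrightarrow> y \<in> space M \<Longrightarrow> epow (u x) t * epow (v y) (1 - t) \<le> w (c x y)"
  shows "epow (\<integral>\<^sup>+x. u x \<partial>M) t * epow (\<integral>\<^sup>+x. v x \<partial>M) (1 - t) \<le> (\<integral>\<^sup>+x. w x \<partial>M)"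
  using assms unfolding prekopa_leindler_def by blast

text \<open>The claim is homogeneous in \<open>u\<close> and in \<open>v\<close>, so each can be
  divided by its supremum, finite thanks to \<open>N\<close>. A supremum 0 makes the left side
  vanish.\<close>

lemma prekopa_leindler_bounded:
  fixes u v w :: "real \<Rightarrow> ennreal"
  assumes [measurable]: "u \<in> borel_measurable borel" "v \<in> borel_measurable borel" "w \<in> borel_measurable borel"
    and bdd: "\<And>x. u x \<le> ennreal N" "\<And>x. v x \<le> ennreal N"
    and t: "0 < t" "t < 1"
    and w: "\<And>x y. epow (u x) t * epow (v y) (1 - t) \<le> w (t * x + (1 - t) * y)"
  shows "epow (\<integral>\<^sup>+x. u x \<partial>lborel) t * epow (\<integral>\<^sup>+x. v x \<partial>lborel) (1 - t) \<le> (\<integral>\<^sup>+x. w x \<partial>lborel)"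
proof (cases "(SUP x. u x) = 0 \<or> (SUP x. v x) = 0")
  case True
  then have "(\<forall>x. u x = 0) \<or> (\<forall>x. v x = 0)"
    by (metis SUP_upper UNIV_I le_zero_eq)
  then show ?thesis by auto
next
  case False
  have fin: "(SUP x. u x) \<le> ennreal N" "(SUP x. v x) \<le> ennreal N"
    using bdd by (auto intro: SUP_least)
  obtain \<alpha> where \<alpha>: "(SUP x. u x) = ennreal \<alpha>" "0 < \<alpha>"
    using fin(1) False by (cases "SUP x. u x") (auto simp: top_unique less_le)
  obtain \<beta> where \<beta>: "(SUP x. v x) = ennreal \<beta>" "0 < \<beta>"
    using fin(2) False by (cases "SUP x. v x") (auto simp: top_unique less_le)
  define U where "U x = enn2real (u x) / \<alpha>" for x
  define V where "V x = enn2real (v x) / \<beta>" for x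
  have [measurable]: "U \<in> borel_measurable borel" "V \<in> borel_measurable borel"
    unfolding U_def V_def by measurable
  have ule: "u x \<le> ennreal \<alpha>" and vle: "v x \<le> ennreal \<beta>" for x
    using SUP_upper[of x UNIV u] SUP_upper[of x UNIV v] \<alpha> \<beta> by auto
  have u: "u x = ennreal (\<alpha> * U x)" "0 \<le> U x" "U x \<le> 1" for x
    using ule[of x] \<alpha> by (cases "u x"; auto simp: U_def top_unique)+
  have v: "v x = ennreal (\<beta> * V x)" "0 \<le> V x" "V x \<le> 1" for x
    using vle[of x] \<beta> by (cases "v x"; auto simp: V_def top_unique)+
  have Usup: "\<exists>x. l < U x" if "l < 1" for l
  proof (cases "0 \<le> l")
    case True
    have "ennreal (\<alpha> * l) < (SUP x. u x)"
      using that True \<alpha> by (simp add: ennreal_lessI)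
    then obtain x where "ennreal (\<alpha> * l) < u x" by (auto simp: less_SUP_iff)
    then show ?thesis using \<alpha> True u[of x] by (auto simp: ennreal_less_iff)
  qed (use u(2) in \<open>meson less_le_trans not_le\<close>)
  have Vsup: "\<exists>x. l < V x" if "l < 1" for l
  proof (cases "0 \<le> l")
    case True
    have "ennreal (\<beta> * l) < (SUP x. v x)"
      using that True \<beta> by (simp add: ennreal_lessI)
    then obtain x where "ennreal (\<beta> * l) < v x" by (auto simp: less_SUP_iff)
    then show ?thesis using \<beta> True v[of x] by (auto simp: ennreal_less_iff)
  qed (use v(2) in \<open>meson less_le_trans not_le\<close>)
  define \<gamma> where "\<gamma> = \<alpha> powr t * \<beta> powr (1 - t)"
  have \<gamma>: "0 < \<gamma>" using \<alpha> \<beta> by (simp add: \<gamma>_def)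
  have le: "ennreal l \<le> ennreal (1 / \<gamma>) * w (t * x + (1 - t) * y)"
    if l: "0 < l" "l < U x" "l < V y" for x y l
  proof -
    have "l = l powr t * l powr (1 - t)"
      using l by (simp flip: powr_add)
    also have "\<dots> \<le> U x powr t * V y powr (1 - t)"
      using l t by (intro mult_mono powr_mono2) auto
    finally have "l * \<gamma> \<le> (\<alpha> * U x) powr t * (\<beta> * V y) powr (1 - t)"
      using \<gamma> \<alpha> \<beta> u(2) v(2) by (simp add: powr_mult \<gamma>_def mult_ac mult_left_mono)
    then have "ennreal (l * \<gamma>) \<le> epow (u x) t * epow (v y) (1 - t)"
      using \<alpha> \<beta> u(2)[of x] v(2)[of y]
      by (simp add: u(1)[of x] v(1)[of y] epow_ennreal ennreal_leI flip: ennreal_mult)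
    also have "\<dots> \<le> w (t * x + (1 - t) * y)" by (rule w)
    finally have "ennreal (1 / \<gamma>) * ennreal (l * \<gamma>) \<le> ennreal (1 / \<gamma>) * w (t * x + (1 - t) * y)"
      by (intro mult_left_mono) auto
    then show ?thesis using \<gamma> l by (simp flip: ennreal_mult)
  qed
  have "epow (\<integral>\<^sup>+x. U x \<partial>lborel) t * epow (\<integral>\<^sup>+x. V x \<partial>lborel) (1 - t)
      \<le> ennreal t * (\<integral>\<^sup>+x. U x \<partial>lborel) + ennreal (1 - t) * (\<integral>\<^sup>+x. V x \<partial>lborel)"
    using t by (rule epow_arith_geom_mean)
  also have "\<dots> \<le> (\<integral>\<^sup>+x. ennreal (1 / \<gamma>) * w x \<partial>lborel)"
    using u v Usup Vsup t le by (intro prekopa_leindler_normalized) auto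
  also have "\<dots> = ennreal (1 / \<gamma>) * (\<integral>\<^sup>+x. w x \<partial>lborel)"
    by (simp add: nn_integral_cmult)
  finally have "ennreal \<gamma> * (epow (\<integral>\<^sup>+x. U x \<partial>lborel) t * epow (\<integral>\<^sup>+x. V x \<partial>lborel) (1 - t))
      \<le> ennreal \<gamma> * (ennreal (1 / \<gamma>) * (\<integral>\<^sup>+x. w x \<partial>lborel))"
    by (intro mult_left_mono) auto
  also have "\<dots> = (\<integral>\<^sup>+x. w x \<partial>lborel)"
    using \<gamma> by (simp add: mult.assoc[symmetric] flip: ennreal_mult)
  finally have "ennreal \<gamma> * (epow (\<integral>\<^sup>+x. U x \<partial>lborel) t * epow (\<integral>\<^sup>+x. V x \<partial>lborel) (1 - t))
      \<le> (\<integral>\<^sup>+x. w x \<partial>lborel)" .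
  moreover have "(\<integral>\<^sup>+x. u x \<partial>lborel) = ennreal \<alpha> * (\<integral>\<^sup>+x. U x \<partial>lborel)"
    "(\<integral>\<^sup>+x. v x \<partial>lborel) = ennreal \<beta> * (\<integral>\<^sup>+x. V x \<partial>lborel)"
    using \<alpha> \<beta> u(2) v(2) by (simp_all add: u(1) v(1) ennreal_mult nn_integral_cmult)
  ultimately show ?thesis
    using \<alpha> \<beta> by (simp add: epow_mult \<gamma>_def ennreal_mult mult_ac)
qed

text \<open>Truncating \<open>u\<close> and \<open>v\<close> preserves the pointwise hypothesis, and
  monotone convergence removes the truncation. The levels \<open>N\<close> and \<open>K\<close> are
  independent, so that the two suprema can be taken one after the other.\<close>

lemma prekopa_leindler_real:
  fixes t :: real
  assumes t: "0 < t" "t < 1"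
  shows "prekopa_leindler t (lborel :: real measure) (\<lambda>x y. t * x + (1 - t) * y)"
  unfolding prekopa_leindler_def
proof (intro ballI impI)
  fix u v w :: "real \<Rightarrow> ennreal"
  assume "u \<in> borel_measurable lborel" "v \<in> borel_measurable lborel" "w \<in> borel_measurable lborel"
  then have [measurable]: "u \<in> borel_measurable borel" "v \<in> borel_measurable borel" "w \<in> borel_measurable borel"
    by auto
  assume w: "\<forall>x\<in>space lborel. \<forall>y\<in>space lborel. epow (u x) t * epow (v y) (1 - t) \<le> w (t * x + (1 - t) * y)"
  have trunc: "(\<integral>\<^sup>+x. g x \<partial>lborel) = (SUP N. \<integral>\<^sup>+x. min (g x) (ennreal (real N)) \<partial>lborel)"
    if [measurable]: "g \<in> borel_measurable borel" for g :: "real \<Rightarrow> ennreal"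
  proof -
    have "(SUP N. min (g x) (ennreal (real N))) = g x" for x
    proof -
      have "(SUP N. min (g x) (ennreal (real N))) = inf (g x) (SUP N. ennreal (real N))"
        by (simp add: inf_SUP flip: inf_min)
      then show ?thesis by (simp add: ennreal_SUP_of_nat_eq_top flip: ennreal_of_nat_eq_real_of_nat)
    qed
    then have "(\<integral>\<^sup>+x. g x \<partial>lborel) = (\<integral>\<^sup>+x. (SUP N. min (g x) (ennreal (real N))) \<partial>lborel)"
      by simp
    also have "\<dots> = (SUP N. \<integral>\<^sup>+x. min (g x) (ennreal (real N)) \<partial>lborel)"
      by (rule nn_integral_monotone_convergence_SUP)
        (auto simp: incseq_def le_fun_def intro: min.coboundedI1 min.coboundedI2 ennreal_leI)
    finally show ?thesis .
  qed
  have "epow (\<integral>\<^sup>+x. min (u x) (ennreal (real N)) \<partial>lborel) t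
      * epow (\<integral>\<^sup>+x. min (v x) (ennreal (real K)) \<partial>lborel) (1 - t) \<le> (\<integral>\<^sup>+x. w x \<partial>lborel)" for N K
  proof (rule prekopa_leindler_bounded[where N = "real (max N K)"])
    fix x y
    have "epow (min (u x) (ennreal (real N))) t * epow (min (v y) (ennreal (real K))) (1 - t)
        \<le> epow (u x) t * epow (v y) (1 - t)"
      using t by (intro mult_mono epow_mono) auto
    then show "epow (min (u x) (ennreal (real N))) t * epow (min (v y) (ennreal (real K))) (1 - t)
        \<le> w (t * x + (1 - t) * y)"
      using w by (auto intro: order_trans)
  qed (use t in \<open>auto intro!: min.coboundedI2 ennreal_leI\<close>)
  then show "epow (\<integral>\<^sup>+x. u x \<partial>lborel) t * epow (\<integral>\<^sup>+x. v x \<partial>lborel) (1 - t) \<le> (\<integral>\<^sup>+x. w x \<partial>lborel)"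
    using t unfolding trunc[of u, simplified] trunc[of v, simplified]
    by (simp add: epow_SUP SUP_mult_left_ennreal SUP_mult_right_ennreal SUP_least)
qed

text \<open>At fixed first coordinates the sections satisfy the hypothesis on \<open>N\<close>; the
  conclusion there is the hypothesis on \<open>M\<close> for the section integrals.\<close>

lemma prekopa_leindler_pair:
  assumes M: "prekopa_leindler t M c" and N: "prekopa_leindler t N d"
    and "sigma_finite_measure N"
    and c: "\<And>x y. x \<in> space M \<Longrightarrow> y \<in> space M \<Longrightarrow> c x y \<in> space M"
  shows "prekopa_leindler t (M \<Otimes>\<^sub>M N) (\<lambda>p q. (c (fst p) (fst q), d (snd p) (snd q)))"
  unfolding prekopa_leindler_def
proof (intro ballI impI)
  interpret N: sigma_finite_measure N by fact
  fix u v w :: "_ \<Rightarrow> ennreal"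
  assume [measurable]: "u \<in> borel_measurable (M \<Otimes>\<^sub>M N)" "v \<in> borel_measurable (M \<Otimes>\<^sub>M N)"
    "w \<in> borel_measurable (M \<Otimes>\<^sub>M N)"
  assume w: "\<forall>x\<in>space (M \<Otimes>\<^sub>M N). \<forall>y\<in>space (M \<Otimes>\<^sub>M N). epow (u x) t * epow (v y) (1 - t)
      \<le> w (c (fst x) (fst y), d (snd x) (snd y))"
  have "epow (\<integral>\<^sup>+x. (\<integral>\<^sup>+y. u (x, y) \<partial>N) \<partial>M) t * epow (\<integral>\<^sup>+x. (\<integral>\<^sup>+y. v (x, y) \<partial>N) \<partial>M) (1 - t)
      \<le> (\<integral>\<^sup>+x. (\<integral>\<^sup>+y. w (x, y) \<partial>N) \<partial>M)"
  proof (rule prekopa_leindlerD[OF M])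
    fix x x' assume xs: "x \<in> space M" "x' \<in> space M"
    note [measurable] = xs c[OF xs]
    show "epow (\<integral>\<^sup>+y. u (x, y) \<partial>N) t * epow (\<integral>\<^sup>+y. v (x', y) \<partial>N) (1 - t) \<le> (\<integral>\<^sup>+y. w (c x x', y) \<partial>N)"
    proof (rule prekopa_leindlerD[OF N])
      fix y y' assume "y \<in> space N" "y' \<in> space N"
      then show "epow (u (x, y)) t * epow (v (x', y')) (1 - t) \<le> w (c x x', d y y')"
        using w[rule_format, of "(x, y)" "(x', y')"] xs by (simp add: space_pair_measure)
    qed measurable
  qed measurable
  then show "epow (\<integral>\<^sup>+x. u x \<partial>(M \<Otimes>\<^sub>M N)) t * epow (\<integral>\<^sup>+x. v x \<partial>(M \<Otimes>\<^sub>M N)) (1 - t)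
      \<le> (\<integral>\<^sup>+x. w x \<partial>(M \<Otimes>\<^sub>M N))"
    by (simp add: N.nn_integral_fst)
qed

text \<open>Induction with the two-factor argument; over the empty set the space is a single point.
  The combination is restricted to \<open>I\<close> because points of the product are
  extensional.\<close>

lemma prekopa_leindler_PiM:
  assumes "finite I" and M: "\<And>i. i \<in> I \<Longrightarrow> prekopa_leindler t (M i) (c i)"
    and sf: "\<And>i. sigma_finite_measure (M i)"
    and c: "\<And>i x y. x \<in> space (M i) \<Longrightarrow> y \<in> space (M i) \<Longrightarrow> c i x y \<in> space (M i)"
  shows "prekopa_leindler t (PiM I M) (\<lambda>x y. \<lambda>i\<in>I. c i (x i) (y i))"
  using assms(1,2)
proof (induction I rule: finite_induct)
  case empty
  interpret product_sigma_finite M by (simp add: product_sigma_finite_def sf)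
  show ?case
    by (auto simp: prekopa_leindler_def PiM_empty nn_integral_count_space_finite)
next
  case (insert i I)
  interpret product_sigma_finite M by (simp add: product_sigma_finite_def sf)
  note [simp] = \<open>finite I\<close> \<open>i \<notin> I\<close>
  note IH = insert.IH[OF insert.prems[OF insertI2]]
  note Mi = insert.prems[OF insertI1]
  let ?I = "insert i I"
  show ?case unfolding prekopa_leindler_def
  proof (intro ballI impI)
    fix u v w :: "_ \<Rightarrow> ennreal"
    assume [measurable]: "u \<in> borel_measurable (PiM ?I M)" "v \<in> borel_measurable (PiM ?I M)"
      "w \<in> borel_measurable (PiM ?I M)"
    assume w: "\<forall>x\<in>space (PiM ?I M). \<forall>y\<in>space (PiM ?I M). epow (u x) t * epow (v y) (1 - t)
        \<le> w (\<lambda>j\<in>?I. c j (x j) (y j))"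
    interpret Mi: sigma_finite_measure "M i" by (rule sf)
    have upd: "(\<lambda>y. g (z(i := y))) \<in> borel_measurable (M i)"
      if "g \<in> borel_measurable (PiM ?I M)" "z \<in> space (PiM I M)" for g :: "_ \<Rightarrow> ennreal" and z
      using measurable_compose[OF measurable_component_update[OF that(2)] that(1)] by simp
    have "epow (\<integral>\<^sup>+x. (\<integral>\<^sup>+y. u (x(i := y)) \<partial>M i) \<partial>PiM I M) t * epow (\<integral>\<^sup>+x. (\<integral>\<^sup>+y. v (x(i := y)) \<partial>M i) \<partial>PiM I M) (1 - t)
        \<le> (\<integral>\<^sup>+x. (\<integral>\<^sup>+y. w (x(i := y)) \<partial>M i) \<partial>PiM I M)"
    proof (rule prekopa_leindlerD[OF IH])
      fix x x' assume xs: "x \<in> space (PiM I M)" "x' \<in> space (PiM I M)"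
      then have xs': "(\<lambda>j\<in>I. c j (x j) (x' j)) \<in> space (PiM I M)"
        by (auto simp: space_PiM intro!: c)
      note [measurable] = xs xs'
      show "epow (\<integral>\<^sup>+y. u (x(i := y)) \<partial>M i) t * epow (\<integral>\<^sup>+y. v (x'(i := y)) \<partial>M i) (1 - t)
          \<le> (\<integral>\<^sup>+y. w ((\<lambda>j\<in>I. c j (x j) (x' j))(i := y)) \<partial>M i)"
      proof (rule prekopa_leindlerD[OF Mi])
        fix y y' assume ys: "y \<in> space (M i)" "y' \<in> space (M i)"
        have "(\<lambda>j\<in>?I. c j ((x(i := y)) j) ((x'(i := y')) j)) = (\<lambda>j\<in>I. c j (x j) (x' j))(i := c i y y')"
          by (auto simp: fun_eq_iff)
        moreover have "x(i := y) \<in> space (PiM ?I M)" "x'(i := y') \<in> space (PiM ?I M)"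
          using xs ys by (auto simp: space_PiM PiE_def Pi_def extensional_def)
        ultimately show "epow (u (x(i := y))) t * epow (v (x'(i := y'))) (1 - t)
            \<le> w ((\<lambda>j\<in>I. c j (x j) (x' j))(i := c i y y'))"
          using w by metis
      qed (rule upd[OF _ xs(1)] upd[OF _ xs(2)] upd[OF _ xs'], measurable)+
    qed measurable
    then show "epow (\<integral>\<^sup>+x. u x \<partial>PiM ?I M) t * epow (\<integral>\<^sup>+x. v x \<partial>PiM ?I M) (1 - t) \<le> (\<integral>\<^sup>+x. w x \<partial>PiM ?I M)"
      by (simp add: product_nn_integral_insert)
  qed
qed

text \<open>\<open>lborel\<close> is the image of a product of one-dimensional measures under the
  coordinate map \<open>T\<close>, whose linearity carries coordinatewise combinations to vector
  combinations.\<close>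

lemma prekopa_leindler_lborel:
  fixes t :: real
  assumes t: "0 < t" "t < 1"
  shows "prekopa_leindler t (lborel :: 'a::euclidean_space measure) (\<lambda>x y. t *\<^sub>R x + (1 - t) *\<^sub>R y)"
  unfolding prekopa_leindler_def
proof (intro ballI impI)
  fix u v w :: "'a \<Rightarrow> ennreal"
  assume "u \<in> borel_measurable lborel" "v \<in> borel_measurable lborel" "w \<in> borel_measurable lborel"
  then have [measurable]: "u \<in> borel_measurable borel" "v \<in> borel_measurable borel" "w \<in> borel_measurable borel"
    by auto
  assume w: "\<forall>x\<in>space lborel. \<forall>y\<in>space lborel. epow (u x) t * epow (v y) (1 - t)
      \<le> w (t *\<^sub>R x + (1 - t) *\<^sub>R y)"
  let ?P = "PiM Basis (\<lambda>_. lborel) :: ('a \<Rightarrow> real) measure"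
  define T where "T f = (\<Sum>b\<in>Basis. f b *\<^sub>R b)" for f :: "'a \<Rightarrow> real"
  have [measurable]: "T \<in> borel_measurable ?P" unfolding T_def by measurable
  have eq: "(\<integral>\<^sup>+x. g x \<partial>lborel) = (\<integral>\<^sup>+f. g (T f) \<partial>?P)"
    if [measurable]: "g \<in> borel_measurable borel" for g :: "'a \<Rightarrow> ennreal"
    by (subst lborel_eq, subst nn_integral_distr) (auto simp: T_def)
  have "epow (\<integral>\<^sup>+f. u (T f) \<partial>?P) t * epow (\<integral>\<^sup>+f. v (T f) \<partial>?P) (1 - t) \<le> (\<integral>\<^sup>+f. w (T f) \<partial>?P)"
  proof (rule prekopa_leindlerD)
    show "prekopa_leindler t ?P (\<lambda>x y. \<lambda>i\<in>Basis. t * x i + (1 - t) * y i)"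
      using prekopa_leindler_real[OF t]
      by (intro prekopa_leindler_PiM) (auto intro: sigma_finite_lborel)
    fix x y :: "'a \<Rightarrow> real"
    have "T (\<lambda>i\<in>Basis. t * x i + (1 - t) * y i) = t *\<^sub>R T x + (1 - t) *\<^sub>R T y"
      by (simp add: T_def scaleR_sum_right sum.distrib[symmetric] algebra_simps cong: sum.cong)
    then show "epow (u (T x)) t * epow (v (T y)) (1 - t) \<le> w (T (\<lambda>i\<in>Basis. t * x i + (1 - t) * y i))"
      using w by simp
  qed measurable
  then show "epow (\<integral>\<^sup>+x. u x \<partial>lborel) t * epow (\<integral>\<^sup>+x. v x \<partial>lborel) (1 - t) \<le> (\<integral>\<^sup>+x. w x \<partial>lborel)"
    by (simp add: eq)
qed

text \<open>The restriction to \<open>{..<n}\<close> makes every combination a point of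
  \<open>blockM n\<close>, whose space consists of extensional functions.\<close>

definition bcomb :: "nat \<Rightarrow> real \<Rightarrow> (nat \<Rightarrow> 'a) \<Rightarrow> (nat \<Rightarrow> 'a) \<Rightarrow> nat \<Rightarrow> 'a::real_vector" where
  "bcomb n t x y = (\<lambda>i\<in>{..<n}. t *\<^sub>R x i + (1 - t) *\<^sub>R y i)"

lemma bcomb_apply [simp]: "i < n \<Longrightarrow> bcomb n t x y i = t *\<^sub>R x i + (1 - t) *\<^sub>R y i"
  by (simp add: bcomb_def)

lemma space_blockM: "space (blockM n) = extensional {..<n}"
  by (simp add: blockM_def space_PiM PiE_def)

lemma bcomb_in_space [simp]: "bcomb n t x y \<in> space (blockM n)"
  by (simp add: bcomb_def space_blockM)

lemma sigma_finite_blockM: "sigma_finite_measure (blockM n :: (nat \<Rightarrow> 'a::euclidean_space) measure)"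
proof -
  interpret product_sigma_finite "\<lambda>_::nat. lborel :: 'a measure"
    by (simp add: product_sigma_finite_def sigma_finite_lborel)
  show ?thesis unfolding blockM_def by (rule sigma_finite) simp
qed

lemma prekopa_leindler_blockM:
  fixes t :: real
  assumes "0 < t" "t < 1"
  shows "prekopa_leindler t (blockM n :: (nat \<Rightarrow> 'a::euclidean_space) measure) (bcomb n t)"
  unfolding blockM_def bcomb_def
  using prekopa_leindler_lborel[OF assms]
  by (intro prekopa_leindler_PiM) (auto intro: sigma_finite_lborel)

subsection \<open>Entropy and strong convexity\<close>

text \<open>The term \<open>1 - r\<close> integrates to 0 for a probability density, and it makes
  the integrand nonnegative; all entropies can then be handled in \<open>ennreal\<close>, infinite
  values included.\<close>

definition ent :: "real \<Rightarrow> real" where "ent r = r * ln r - r + 1"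

lemma ent_nonneg: assumes "0 \<le> r" shows "0 \<le> ent r"
proof (cases "r = 0")
  case False
  with assms have r: "0 < r" by simp
  have "r * ln (1 / r) \<le> r * (1 / r - 1)"
    using ln_le_minus_one[of "1 / r"] r by (intro mult_left_mono) auto
  also have "r * (1 / r - 1) = 1 - r" using r by (simp add: field_simps)
  finally show ?thesis using r by (simp add: ent_def ln_div)
qed (simp add: ent_def)

lemma ent_measurable [measurable]: "ent \<in> borel_measurable borel"
  unfolding ent_def by measurable

text \<open>Jensen's inequality for \<open>exp\<close> under \<open>q p\<close> (on \<open>a\<close>) and under \<open>p\<close> (on \<open>- \<lambda> a\<close>), with the
  weights chosen so that \<open>a\<close> cancels before integrating: \<open>a\<close> need not be integrable.\<close>

lemma entropy_tilt:
  assumes "prob_space p" and [measurable]: "q \<in> borel_measurable p" "a \<in> borel_measurable p"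
    and q: "\<And>x. 0 \<le> q x" "(\<integral>\<^sup>+x. ennreal (q x) \<partial>p) = 1" and l: "0 < l"
    and \<alpha>: "(\<integral>\<^sup>+x. ennreal (q x * exp (a x)) \<partial>p) = ennreal \<alpha>" "0 < \<alpha>"
    and \<beta>: "(\<integral>\<^sup>+x. ennreal (exp (- l * a x)) \<partial>p) = ennreal \<beta>" "0 < \<beta>"
    and K: "(\<integral>\<^sup>+x. ennreal (ent (q x)) \<partial>p) = ennreal K" "0 \<le> K"
  shows "0 \<le> l * ln \<alpha> + ln \<beta> + K"
proof -
  interpret prob_space p by fact
  let ?L = "l * ln \<alpha> + ln \<beta>"
  \<comment> \<open>Sum of two bounds \<open>1 + u \<le> exp u\<close>: at
    \<open>u = a x - ln \<alpha>\<close> with weight \<open>l * q x\<close>, and at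
    \<open>u = - l * a x - ln \<beta> - ln (q x)\<close> with weight \<open>q x\<close>. Subtracting
    the logarithms makes the exponential terms integrate to \<open>l\<close> and 1.\<close>
  have pw: "q x * (l - ?L) + 1 \<le> l / \<alpha> * (q x * exp (a x)) + 1 / \<beta> * exp (- l * a x) + ent (q x)" for x
  proof (cases "q x = 0")
    case False
    then have q0: "0 < q x" using q(1)[of x] by simp
    have "l * q x * (1 + (a x - ln \<alpha>)) \<le> l * q x * exp (a x - ln \<alpha>)"
      using l q0 by (intro mult_left_mono exp_ge_add_one_self) auto
    also have "\<dots> = l / \<alpha> * (q x * exp (a x))"
      using \<alpha> by (simp add: exp_diff)
    finally have 1: "l * q x * (1 + (a x - ln \<alpha>)) \<le> l / \<alpha> * (q x * exp (a x))" .
    have "q x * (1 + (- l * a x - ln \<beta> - ln (q x))) \<le> q x * exp (- l * a x - ln \<beta> - ln (q x))"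
      using q0 by (intro mult_left_mono exp_ge_add_one_self) auto
    also have "\<dots> = 1 / \<beta> * exp (- l * a x)"
      using \<beta> q0 by (simp add: exp_diff exp_minus)
    finally have 2: "q x * (1 + (- l * a x - ln \<beta> - ln (q x))) \<le> 1 / \<beta> * exp (- l * a x)" .
    show ?thesis using 1 2 by (simp add: ent_def algebra_simps)
  qed (use \<beta> in \<open>simp add: ent_def\<close>)
  have bq: "has_bochner_integral p q 1"
    by (rule has_bochner_integral_nn_integral) (use q in auto)
  have b1: "has_bochner_integral p (\<lambda>x. q x * exp (a x)) \<alpha>"
    by (rule has_bochner_integral_nn_integral) (use q \<alpha> in auto)
  have b2: "has_bochner_integral p (\<lambda>x. exp (- l * a x)) \<beta>"
    by (rule has_bochner_integral_nn_integral) (use \<beta> in auto)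
  have b3: "has_bochner_integral p (\<lambda>x. ent (q x)) K"
    by (rule has_bochner_integral_nn_integral) (use q ent_nonneg K in auto)
  have c1: "has_bochner_integral p (\<lambda>x. q x * (l - ?L) + 1) (1 * (l - ?L) + 1)"
    using has_bochner_integral_add[OF has_bochner_integral_mult_left[OF bq, of "l - ?L"], of "\<lambda>_. 1" 1]
    by (simp add: has_bochner_integral_iff prob_space)
  have c2: "has_bochner_integral p (\<lambda>x. l / \<alpha> * (q x * exp (a x)) + 1 / \<beta> * exp (- l * a x) + ent (q x))
      (l / \<alpha> * \<alpha> + 1 / \<beta> * \<beta> + K)"
    by (intro has_bochner_integral_add has_bochner_integral_mult_right b1 b2 b3)
  have "1 * (l - ?L) + 1 \<le> l / \<alpha> * \<alpha> + 1 / \<beta> * \<beta> + K"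
    using c1 c2 pw by (metis (no_types, lifting) has_bochner_integral_integral_eq has_bochner_integral_iff integral_mono)
  then show ?thesis using \<alpha> \<beta> by simp
qed

text \<open>Lowering the coefficient \<open>h'\<close> to \<open>h\<close> enlarges the integrand.
  The remaining quadratic dominates \<open>A * B / (A + B)\<close> for two linear functions
  \<open>A\<close> and \<open>B\<close>, so its reciprocal is at most \<open>1 / A + 1 / B\<close>,
  whose primitive is a difference of logarithms.\<close>

lemma rate_integral_le:
  fixes h h' a b :: real
  assumes h: "0 < h" "h \<le> h'" and a: "0 < a" and b: "0 < b"
  shows "h * integral {0..1} (\<lambda>t. inverse (h' * t * (1 - t) + a * (1 - t)\<^sup>2 + b * t\<^sup>2))
      \<le> ln (1 + h / a) + ln (1 + h / b)"
proof -
  define Q where "Q t = h' * t * (1 - t) + a * (1 - t)\<^sup>2 + b * t\<^sup>2" for t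
  define F where "F t = ln (a + h * t) - ln (h + b - h * t)" for t
  have pos: "0 < a + h * t" "0 < h + b - h * t" if "t \<in> {0..1}" for t
  proof -
    show "0 < a + h * t" using that h a by (auto intro: add_pos_nonneg)
    have "h * t \<le> h" using that h mult_left_mono[of t 1 h] by simp
    then show "0 < h + b - h * t" using b by simp
  qed
  have Qh: "h * t * (1 - t) + a * (1 - t)\<^sup>2 + b * t\<^sup>2 \<le> Q t" if "t \<in> {0..1}" for t
    using that h by (auto simp: Q_def intro!: mult_right_mono)
  have Qh0: "0 < h * t * (1 - t) + a * (1 - t)\<^sup>2 + b * t\<^sup>2" if "t \<in> {0..1}" for t
  proof (cases "t = 0")
    case False
    then have "0 < b * t\<^sup>2" using b by simp
    moreover have "0 \<le> h * t * (1 - t)" "0 \<le> a * (1 - t)\<^sup>2" using that h a by auto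
    ultimately show ?thesis by linarith
  qed (use a in simp)
  have Qpos: "0 < Q t" if "t \<in> {0..1}" for t
    using Qh[OF that] Qh0[OF that] by linarith
  have bound: "h * inverse (Q t) \<le> h / (a + h * t) + h / (h + b - h * t)" if t: "t \<in> {0..1}" for t
  proof -
    let ?q = "h * t * (1 - t) + a * (1 - t)\<^sup>2 + b * t\<^sup>2"
    let ?A = "a + h * t" and ?B = "h + b - h * t"
    \<comment> \<open>The linear factors are chosen so that this difference is a perfect
      square.\<close>
    have "?q * (?A + ?B) - ?A * ?B = (a * (1 - t) - b * t)\<^sup>2"
      by (simp add: power2_eq_square algebra_simps)
    then have "?A * ?B \<le> ?q * (?A + ?B)"
      by (smt (verit) zero_le_power2)
    then have "1 / ?q \<le> (?A + ?B) / (?A * ?B)"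
      using pos[OF t] Qh0[OF t] by (simp add: divide_simps mult.commute)
    also have "\<dots> = 1 / ?A + 1 / ?B"
      using pos[OF t] by (simp add: field_simps)
    finally have "h * (1 / ?q) \<le> h * (1 / ?A + 1 / ?B)"
      using h by (intro mult_left_mono) auto
    moreover have "h * inverse (Q t) \<le> h * (1 / ?q)"
      using h Qh[OF t] Qh0[OF t] by (intro mult_left_mono) (auto simp: inverse_eq_divide intro!: divide_left_mono)
    ultimately show ?thesis by (simp add: distrib_left)
  qed
  have F: "((\<lambda>t. h / (a + h * t) + h / (h + b - h * t)) has_integral (F 1 - F 0)) {0..1}"
  proof (rule fundamental_theorem_of_calculus)
    fix t :: real assume "t \<in> {0..1}"
    note p = pos[OF this]
    show "(F has_vector_derivative h / (a + h * t) + h / (h + b - h * t)) (at t within {0..1})"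
      unfolding F_def has_real_derivative_iff_has_vector_derivative[symmetric]
      using p by (auto intro!: derivative_eq_intros simp: divide_simps)
  qed simp
  have "continuous_on {0..1} Q" unfolding Q_def by (intro continuous_intros)
  then have "(\<lambda>t. inverse (Q t)) integrable_on {0..1}"
    using Qpos by (intro integrable_continuous_real continuous_on_inverse) (auto simp: less_imp_neq[symmetric])
  then have "((\<lambda>t. h * inverse (Q t)) has_integral (h * integral {0..1} (\<lambda>t. inverse (Q t)))) {0..1}"
    by (intro has_integral_mult_right integrable_integral)
  then have "h * integral {0..1} (\<lambda>t. inverse (Q t)) \<le> F 1 - F 0"
    using F bound by (rule has_integral_le)
  moreover have "F 1 - F 0 = ln (1 + h / a) + ln (1 + h / b)"
  proof -
    have "ln (1 + h / a) = ln (a + h) - ln a" "ln (1 + h / b) = ln (h + b) - ln b"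
      using h a b ln_div[of "a + h" a] ln_div[of "h + b" b]
      by (simp_all add: add_divide_distrib add.commute)
    then show ?thesis using h a b by (simp add: F_def)
  qed
  ultimately show ?thesis by (simp add: Q_def)
qed

text \<open>The tangent inequality is used at the combined point. Weighting its instances at
  \<open>x\<close> and \<open>y\<close> by \<open>t\<close> and \<open>1 - t\<close> cancels the
  linear terms, and the quadratic ones add up to the factor \<open>t * (1 - t)\<close>.\<close>

lemma strongly_convex_comb:
  assumes f: "strongly_convex \<alpha> f" and t: "0 \<le> t" "t \<le> 1"
  shows "f (t *\<^sub>R x + (1 - t) *\<^sub>R y) \<le> t * f x + (1 - t) * f y - \<alpha> * t * (1 - t) / 2 * (norm (x - y))\<^sup>2"
proof -
  let ?z = "t *\<^sub>R x + (1 - t) *\<^sub>R y"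
  obtain D where D: "(f has_derivative D) (at ?z)"
    and le: "\<And>x. D (x - ?z) + \<alpha> / 2 * (norm (x - ?z))\<^sup>2 \<le> f x - f ?z"
    using f unfolding strongly_convex_def by blast
  interpret linear D using D by (rule has_derivative_linear)
  have x: "x - ?z = (1 - t) *\<^sub>R (x - y)" and y: "y - ?z = (- t) *\<^sub>R (x - y)"
    by (simp_all add: algebra_simps)
  have 1: "(1 - t) * D (x - y) + \<alpha> / 2 * ((1 - t)\<^sup>2 * (norm (x - y))\<^sup>2) \<le> f x - f ?z"
    using le[of x] t unfolding x by (simp add: scale power_mult_distrib)
  have 2: "- t * D (x - y) + \<alpha> / 2 * (t\<^sup>2 * (norm (x - y))\<^sup>2) \<le> f y - f ?z"
    using le[of y] t unfolding y by (simp only: scale) (simp add: power_mult_distrib)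
  have "t * ((1 - t) * D (x - y) + \<alpha> / 2 * ((1 - t)\<^sup>2 * (norm (x - y))\<^sup>2))
      + (1 - t) * (- t * D (x - y) + \<alpha> / 2 * (t\<^sup>2 * (norm (x - y))\<^sup>2))
      \<le> t * (f x - f ?z) + (1 - t) * (f y - f ?z)"
    using t 1 2 by (intro add_mono mult_left_mono) auto
  also have "t * ((1 - t) * D (x - y) + \<alpha> / 2 * ((1 - t)\<^sup>2 * (norm (x - y))\<^sup>2))
      + (1 - t) * (- t * D (x - y) + \<alpha> / 2 * (t\<^sup>2 * (norm (x - y))\<^sup>2))
      = \<alpha> * t * (1 - t) / 2 * (norm (x - y))\<^sup>2"
    by (simp add: field_simps power2_eq_square)
  also have "t * (f x - f ?z) + (1 - t) * (f y - f ?z) = t * f x + (1 - t) * f y - f ?z"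
    by (simp only: right_diff_distrib left_diff_distrib)
  finally show ?thesis by linarith
qed

lemma norm_sq_comb:
  fixes x y :: "'a::real_inner"
  shows "(norm (t *\<^sub>R x + (1 - t) *\<^sub>R y))\<^sup>2
      = t * (norm x)\<^sup>2 + (1 - t) * (norm y)\<^sup>2 - t * (1 - t) * (norm (x - y))\<^sup>2"
  by (simp add: power2_norm_eq_inner inner_simps inner_commute algebra_simps)

lemma inner_le_weighted_norms:
  fixes u v :: "'a::real_inner"
  assumes "0 < c" shows "2 * (u \<bullet> v) \<le> c * (norm u)\<^sup>2 + (norm v)\<^sup>2 / c"
proof -
  have "0 \<le> (norm (c *\<^sub>R u - v))\<^sup>2 / c" using assms by simp
  also have "\<dots> = c * (norm u)\<^sup>2 + (norm v)\<^sup>2 / c - 2 * (u \<bullet> v)"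
    using assms by (simp add: power2_norm_eq_inner inner_simps inner_commute field_simps)
  finally show ?thesis by simp
qed

lemma strongly_convex_measurable:
  assumes "strongly_convex \<alpha> f" shows "f \<in> borel_measurable borel"
proof -
  have "isCont f y" for y
    using assms unfolding strongly_convex_def by (meson has_derivative_continuous)
  then show ?thesis
    by (intro borel_measurable_continuous_onI continuous_at_imp_continuous_on) auto
qed

lemma nn_integral_gaussian_finite:
  assumes "0 < c"
  shows "(\<integral>\<^sup>+x. ennreal (exp (- c * (norm x)\<^sup>2)) \<partial>(lborel :: 'a::euclidean_space measure)) < \<top>"
proof -
  have 1: "(\<integral>\<^sup>+x. ennreal (exp (- c * x\<^sup>2)) \<partial>lborel) < \<top>"
  proof -
    \<comment> \<open>The centred normal density with this standard deviation is proportional to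
      \<open>exp (- c * x\<^sup>2)\<close>.\<close>
    define s where "s = sqrt (1 / (2 * c))"
    have s: "0 < s" "2 * s\<^sup>2 = 1 / c" using assms by (auto simp: s_def)
    have "exp (- c * x\<^sup>2) = sqrt (2 * pi * s\<^sup>2) * normal_density 0 s x" for x
      using s assms by (simp add: normal_density_def field_simps)
    moreover have "(\<integral>\<^sup>+x. ennreal (normal_density 0 s x) \<partial>lborel) = 1"
      using prob_space.emeasure_space_1[OF prob_space_normal_density[OF s(1), of 0]]
      by (simp add: emeasure_density)
    ultimately show ?thesis using s
      by (simp add: ennreal_mult nn_integral_cmult)
  qed
  interpret product_sigma_finite "\<lambda>_::'a. lborel :: real measure"
    by (simp add: product_sigma_finite_def sigma_finite_lborel)
  have "exp (- c * (norm x)\<^sup>2) = (\<Prod>b\<in>Basis. exp (- c * (x \<bullet> b)\<^sup>2))" for x :: 'a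
    unfolding power2_norm_eq_inner euclidean_inner[of x x]
    by (simp add: exp_sum[symmetric] power2_eq_square sum_distrib_left sum_negf)
  then have "(\<integral>\<^sup>+x. ennreal (exp (- c * (norm x)\<^sup>2)) \<partial>(lborel :: 'a measure))
      = (\<Prod>b\<in>(Basis :: 'a set). \<integral>\<^sup>+x. ennreal (exp (- c * x\<^sup>2)) \<partial>lborel)"
    using nn_integral_lborel_prod[of "\<lambda>_ x. ennreal (exp (- c * x\<^sup>2))"]
    by (simp add: prod_ennreal)
  also have "\<dots> < \<top>" using 1 by (simp add: ennreal_prod_eq_top power_less_top_ennreal)
  finally show ?thesis .
qed

text \<open>The tangent at 0 bounds \<open>f\<close> below by a quadratic plus a linear term. Half
  of the quadratic absorbs the linear term, and the other half leaves a Gaussian majorant.\<close>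

lemma strongly_convex_integrable:
  fixes f :: "'a::euclidean_space \<Rightarrow> real"
  assumes f: "strongly_convex \<alpha> f" and \<alpha>: "0 < \<alpha>"
  shows "(\<integral>\<^sup>+x. ennreal (exp (- f x)) \<partial>lborel) < \<top>"
proof -
  obtain D where D: "(f has_derivative D) (at 0)"
    and le: "\<And>x. D (x - 0) + \<alpha> / 2 * (norm (x - 0))\<^sup>2 \<le> f x - f 0"
    using f unfolding strongly_convex_def by blast
  obtain B where B: "\<And>x. \<bar>D x\<bar> \<le> norm x * B"
    using has_derivative_bounded_linear[OF D] bounded_linear.bounded by (metis real_norm_def)
  have "- f x \<le> (B\<^sup>2 / \<alpha> - f 0) + - (\<alpha> / 4) * (norm x)\<^sup>2" for x
  proof -
    have "0 \<le> (B - \<alpha> / 2 * norm x)\<^sup>2 / \<alpha>" using \<alpha> by simp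
    also have "\<dots> = B\<^sup>2 / \<alpha> - norm x * B + \<alpha> / 4 * (norm x)\<^sup>2"
      using \<alpha> by (simp add: power2_eq_square field_simps)
    finally show ?thesis using le[of x] B[of x] by (simp add: abs_le_iff)
  qed
  then have "exp (- f x) \<le> exp (B\<^sup>2 / \<alpha> - f 0) * exp (- (\<alpha> / 4) * (norm x)\<^sup>2)" for x
    by (simp flip: exp_add)
  then have "(\<integral>\<^sup>+x. ennreal (exp (- f x)) \<partial>lborel)
      \<le> (\<integral>\<^sup>+x. ennreal (exp (B\<^sup>2 / \<alpha> - f 0)) * ennreal (exp (- (\<alpha> / 4) * (norm x)\<^sup>2)) \<partial>(lborel :: 'a measure))"
    by (intro nn_integral_mono) (simp add: ennreal_leI flip: ennreal_mult)
  also have "\<dots> < \<top>"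
    using nn_integral_gaussian_finite[of "\<alpha> / 4", where 'a='a] \<alpha>
    by (simp add: nn_integral_cmult ennreal_mult_less_top)
  finally show ?thesis .
qed

text \<open>Chain rule for the entropy in one fibre: \<open>e\<close> is \<open>ent h\<close> plus
  \<open>h\<close> times the divergence of the density normalised to mass 1. It is used for
  \<open>p = condX y\<close>.\<close>

lemma nn_integral_ent_scaled:
  assumes "prob_space p" and [measurable]: "q \<in> borel_measurable p"
    and q: "\<And>x. 0 \<le> q x" "(\<integral>\<^sup>+x. ennreal (q x) \<partial>p) = ennreal h" "0 < h"
    and e: "(\<integral>\<^sup>+x. ennreal (ent (q x)) \<partial>p) = ennreal e" "0 \<le> e"
  shows "(\<integral>\<^sup>+x. ennreal (ent (q x / h)) \<partial>p) = ennreal ((e - ent h) / h)" and "0 \<le> (e - ent h) / h"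
proof -
  interpret prob_space p by fact
  have 1: "has_bochner_integral p q h"
    by (rule has_bochner_integral_nn_integral) (use q in auto)
  have 2: "has_bochner_integral p (\<lambda>x. ent (q x)) e"
    by (rule has_bochner_integral_nn_integral) (use q e ent_nonneg in auto)
  have 3: "has_bochner_integral p (\<lambda>_. h - 1) (h - 1)"
    by (simp add: has_bochner_integral_iff prob_space)
  have "has_bochner_integral p (\<lambda>x. (ent (q x) - q x * ln h + (h - 1)) / h) ((e - h * ln h + (h - 1)) / h)"
    by (intro has_bochner_integral_divide_zero has_bochner_integral_add has_bochner_integral_diff
        has_bochner_integral_mult_left 1 2 3)
  moreover have "(ent (q x) - q x * ln h + (h - 1)) / h = ent (q x / h)" for x
  proof (cases "q x = 0")
    case False
    then have "0 < q x" using q(1)[of x] by simp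
    then show ?thesis using q(3) by (simp add: ent_def ln_div field_simps)
  qed (use q(3) in \<open>simp add: ent_def\<close>)
  moreover have "e - h * ln h + (h - 1) = e - ent h" by (simp add: ent_def)
  ultimately have *: "has_bochner_integral p (\<lambda>x. ent (q x / h)) ((e - ent h) / h)" by simp
  have nn: "0 \<le> ent (q x / h)" for x using q by (intro ent_nonneg) auto
  show "(\<integral>\<^sup>+x. ennreal (ent (q x / h)) \<partial>p) = ennreal ((e - ent h) / h)"
    using * nn by (simp add: has_bochner_integral_iff nn_integral_eq_integral)
  show "0 \<le> (e - ent h) / h"
    using nn unfolding has_bochner_integral_integral_eq[OF *, symmetric] by (rule Bochner_Integration.integral_nonneg)
qed

section \<open>Lebesgue measure on blocks, and divergences of densities\<close>

lemma component_blockM_measurable: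
  "i < n \<Longrightarrow> (\<lambda>x. x i) \<in> borel_measurable (blockM n :: (nat \<Rightarrow> 'a::euclidean_space) measure)"
  unfolding blockM_def using measurable_component_singleton[of i "{..<n}" "\<lambda>_. lborel :: 'a measure"] by simp

lemma component_blockM_measurable':
  assumes "F \<in> measurable N (blockM n :: (nat \<Rightarrow> 'a::euclidean_space) measure)" "i < n"
  shows "(\<lambda>p. F p i) \<in> borel_measurable N"
  using measurable_compose[OF assms(1) component_blockM_measurable[OF assms(2)]] .

lemma emeasure_space_blockM_nonzero:
  "emeasure (blockM n :: (nat \<Rightarrow> 'a::euclidean_space) measure) (space (blockM n)) \<noteq> 0"
proof -
  interpret product_sigma_finite "\<lambda>_::nat. lborel :: 'a measure"
    by (simp add: product_sigma_finite_def sigma_finite_lborel)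
  show ?thesis
    using emeasure_PiM[of "{..<n}" "\<lambda>_. UNIV"]
    by (simp add: blockM_def space_PiM prod_zero_iff)
qed

lemma nn_integral_pos_blockM:
  assumes [measurable]: "F \<in> borel_measurable (blockM n :: (nat \<Rightarrow> 'a::euclidean_space) measure)"
    and "\<And>x. x \<in> space (blockM n) \<Longrightarrow> 0 < F x"
  shows "(\<integral>\<^sup>+x. F x \<partial>blockM n) > (0::ennreal)"
proof (rule ccontr)
  assume "\<not> ?thesis"
  then have "(\<integral>\<^sup>+x. F x \<partial>blockM n) = 0" by simp
  then have "AE x in blockM n. F x = 0" by (simp add: nn_integral_0_iff_AE)
  then have "AE x in (blockM n :: (nat \<Rightarrow> 'a) measure). False"
    by (rule AE_mp) (use assms(2) in \<open>force intro!: AE_I2\<close>)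
  then show False
    using emeasure_space_blockM_nonzero by (metis ae_filter_eq_bot_iff eventually_False)
qed

lemma nn_integral_prod_blockM:
  assumes "\<And>i. i < n \<Longrightarrow> F i \<in> borel_measurable borel"
  shows "(\<integral>\<^sup>+x. (\<Prod>i<n. F i (x i)) \<partial>blockM n) = (\<Prod>i<n. \<integral>\<^sup>+x. F i x \<partial>(lborel :: 'a::euclidean_space measure))"
proof -
  interpret product_sigma_finite "\<lambda>_::nat. lborel :: 'a measure"
    by (simp add: product_sigma_finite_def sigma_finite_lborel)
  show ?thesis unfolding blockM_def using assms by (intro product_nn_integral_prod) auto
qed

text \<open>The two parts of the integrand in \<open>KL\<close> differ from \<open>ent\<close> by
  \<open>1 - \<rho>\<close>, which has integral 0. The identity is proved with all terms on the side
  where they are positive and then subtracted once in \<open>ereal\<close>.\<close>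

lemma KL_density_ent:
  assumes "prob_space \<nu>" and [measurable]: "r \<in> borel_measurable \<nu>" and r: "(\<integral>\<^sup>+x. r x \<partial>\<nu>) = 1"
  shows "KL (density \<nu> r) \<nu> = enn2ereal (\<integral>\<^sup>+x. ennreal (ent (enn2real (r x))) \<partial>\<nu>)"
proof -
  interpret prob_space \<nu> by fact
  define \<rho> where "\<rho> x = enn2real (r x)" for x
  have [measurable]: "\<rho> \<in> borel_measurable \<nu>" unfolding \<rho>_def by measurable
  have \<rho>: "0 \<le> \<rho> x" for x by (simp add: \<rho>_def)
  have "AE x in \<nu>. r x \<noteq> \<infinity>" using r by (intro nn_integral_noteq_infinite) auto
  then have "AE x in \<nu>. ennreal (\<rho> x) = r x"
    by eventually_elim (simp add: \<rho>_def less_top)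
  then have \<rho>1: "(\<integral>\<^sup>+x. ennreal (\<rho> x) \<partial>\<nu>) = 1" using r by (simp cong: nn_integral_cong_AE)
  have ae: "AE x in \<nu>. enn2real (RN_deriv \<nu> (density \<nu> r) x) = \<rho> x"
    using RN_deriv_unique[of r "density \<nu> r"] by (auto simp: \<rho>_def elim: eventually_mono)
  let ?p = "\<integral>\<^sup>+x. ennreal (max 0 (\<rho> x * ln (\<rho> x))) \<partial>\<nu>"
  let ?n = "\<integral>\<^sup>+x. ennreal (max 0 (- (\<rho> x * ln (\<rho> x)))) \<partial>\<nu>"
  let ?H = "\<integral>\<^sup>+x. ennreal (ent (\<rho> x)) \<partial>\<nu>"
  have "?n \<le> (\<integral>\<^sup>+x. 1 \<partial>\<nu>)"
  \<comment> \<open>Nonnegativity of \<open>ent\<close> bounds the negative part by 1, so the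
    difference in \<open>KL\<close> is never infinity minus infinity.\<close>
  proof (rule nn_integral_mono)
    fix x
    show "ennreal (max 0 (- (\<rho> x * ln (\<rho> x)))) \<le> 1"
      using ent_nonneg[OF \<rho>[of x]] \<rho>[of x] by (simp add: ent_def)
  qed
  then have n: "?n \<le> 1" by (simp add: emeasure_space_1)
  have "?p + 1 = (\<integral>\<^sup>+x. ennreal (max 0 (\<rho> x * ln (\<rho> x))) + 1 \<partial>\<nu>)"
    by (simp add: nn_integral_add emeasure_space_1)
  also have "\<dots> = (\<integral>\<^sup>+x. ennreal (ent (\<rho> x)) + ennreal (max 0 (- (\<rho> x * ln (\<rho> x)))) + ennreal (\<rho> x) \<partial>\<nu>)"
  proof (rule nn_integral_cong)
    fix x
    have "ennreal (max 0 (\<rho> x * ln (\<rho> x))) + 1 = ennreal (max 0 (\<rho> x * ln (\<rho> x)) + 1)"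
      by (simp add: ennreal_plus)
    also have "\<dots> = ennreal (ent (\<rho> x) + max 0 (- (\<rho> x * ln (\<rho> x))) + \<rho> x)"
      by (rule arg_cong[where f = ennreal]) (simp add: ent_def max_def)
    also have "\<dots> = ennreal (ent (\<rho> x)) + ennreal (max 0 (- (\<rho> x * ln (\<rho> x)))) + ennreal (\<rho> x)"
      using ent_nonneg[OF \<rho>[of x]] \<rho>[of x] by (subst ennreal_plus ennreal_plus; simp)+
    finally show "ennreal (max 0 (\<rho> x * ln (\<rho> x))) + 1
        = ennreal (ent (\<rho> x)) + ennreal (max 0 (- (\<rho> x * ln (\<rho> x)))) + ennreal (\<rho> x)" .
  qed
  also have "\<dots> = (?H + ?n) + 1"
    by (simp add: nn_integral_add \<rho>1)
  finally have pn: "?p = ?H + ?n"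
    by (simp add: add.commute[of _ 1] ennreal_add_left_cancel)
  have "KL (density \<nu> r) \<nu> = enn2ereal ?p - enn2ereal ?n"
  proof -
    have "absolutely_continuous \<nu> (density \<nu> r)" by (rule absolutely_continuousI_density) simp
    moreover have "(\<integral>\<^sup>+x. ennreal (max 0 (enn2real (RN_deriv \<nu> (density \<nu> r) x) * ln (enn2real (RN_deriv \<nu> (density \<nu> r) x)))) \<partial>\<nu>) = ?p"
      using ae by (intro nn_integral_cong_AE) (auto elim!: eventually_mono)
    moreover have "(\<integral>\<^sup>+x. ennreal (max 0 (- (enn2real (RN_deriv \<nu> (density \<nu> r) x) * ln (enn2real (RN_deriv \<nu> (density \<nu> r) x))))) \<partial>\<nu>) = ?n"
      using ae by (intro nn_integral_cong_AE) (auto elim!: eventually_mono)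
    ultimately show ?thesis by (simp add: KL_def)
  qed
  also have "\<dots> = enn2ereal ?H"
  proof -
    have "?n \<noteq> \<top>" using n by (auto simp: top_unique)
    then obtain b where b: "?n = ennreal b" "0 \<le> b" by (metis ennreal_cases)
    show ?thesis unfolding pn b plus_ennreal.rep_eq using b
      by (cases "enn2ereal ?H") auto
  qed
  finally show ?thesis by (simp add: \<rho>_def)
qed

lemma PiM_density:
  assumes I: "finite I" and M: "\<And>i. sigma_finite_measure (M i)"
    and d [measurable]: "\<And>i. i \<in> I \<Longrightarrow> d i \<in> borel_measurable (M i)"
    and p: "\<And>i. i \<in> I \<Longrightarrow> sigma_finite_measure (density (M i) (d i))"
  shows "PiM I (\<lambda>i. density (M i) (d i)) = density (PiM I M) (\<lambda>x. \<Prod>i\<in>I. d i (x i))"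
proof -
  interpret M: product_sigma_finite M using M by (simp add: product_sigma_finite_def)
  \<comment> \<open>Outside \<open>I\<close> the original measures are kept, because the product
    locale asks for sigma-finiteness at every index.\<close>
  define N where "N i = (if i \<in> I then density (M i) (d i) else M i)" for i
  interpret N: product_sigma_finite N using M p by (simp add: product_sigma_finite_def N_def)
  have prod [measurable]: "(\<lambda>x. \<Prod>i\<in>I. d i (x i)) \<in> borel_measurable (PiM I M)"
  proof (rule borel_measurable_prod_ennreal)
    fix i assume i: "i \<in> I"
    show "(\<lambda>x. d i (x i)) \<in> borel_measurable (PiM I M)"
      by (rule measurable_compose[OF measurable_component_singleton[OF i, of M] d[OF i]])
  qed
  have "density (PiM I M) (\<lambda>x. \<Prod>i\<in>I. d i (x i)) = PiM I N"
  proof (rule N.PiM_eqI[OF I])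
    show "sets (density (PiM I M) (\<lambda>x. \<Prod>i\<in>I. d i (x i))) = sets (PiM I N)"
      by (simp add: N_def cong: sets_PiM_cong)
    fix A assume "\<And>i. i \<in> I \<Longrightarrow> A i \<in> sets (N i)"
    then have A: "A i \<in> sets (M i)" if "i \<in> I" for i using that by (simp add: N_def)
    then have "PiE I A \<in> sets (PiM I M)" using I by auto
    then have "emeasure (density (PiM I M) (\<lambda>x. \<Prod>i\<in>I. d i (x i))) (PiE I A)
        = (\<integral>\<^sup>+x. (\<Prod>i\<in>I. d i (x i)) * indicator (PiE I A) x \<partial>PiM I M)"
      by (simp add: emeasure_density)
    also have "\<dots> = (\<integral>\<^sup>+x. (\<Prod>i\<in>I. d i (x i) * indicator (A i) (x i)) \<partial>PiM I M)"
    proof (rule nn_integral_cong)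
      fix x assume "x \<in> space (PiM I M)"
      then have "x \<in> extensional I" by (auto simp: space_PiM PiE_def)
      then have "indicator (PiE I A) x = (\<Prod>i\<in>I. indicator (A i) (x i) :: ennreal)"
        using I by (auto simp: indicator_def PiE_def Pi_def prod_zero_iff split: if_splits intro!: prod.neutral[symmetric])
      then show "(\<Prod>i\<in>I. d i (x i)) * indicator (PiE I A) x = (\<Prod>i\<in>I. d i (x i) * indicator (A i) (x i))"
        by (simp add: prod.distrib)
    qed
    also have "\<dots> = (\<Prod>i\<in>I. \<integral>\<^sup>+x. d i x * indicator (A i) x \<partial>M i)"
      using A by (intro M.product_nn_integral_prod I) auto
    also have "\<dots> = (\<Prod>i\<in>I. emeasure (N i) (A i))"
      using A by (intro prod.cong) (auto simp: N_def emeasure_density)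
    finally show "emeasure (density (PiM I M) (\<lambda>x. \<Prod>i\<in>I. d i (x i))) (PiE I A) = (\<Prod>i\<in>I. emeasure (N i) (A i))" .
  qed
  moreover have "PiM I N = PiM I (\<lambda>i. density (M i) (d i))"
    by (rule PiM_cong) (auto simp: N_def)
  ultimately show ?thesis by simp
qed

subsection \<open>The joint potential\<close>

text \<open>The assumptions are symmetric under exchanging \<open>n\<close>, \<open>f\<close>,
  \<open>af\<close> with \<open>m\<close>, \<open>g\<close>, \<open>ag\<close> and transposing
  \<sigma>. As a locale they can be instantiated a second time, so one proof of the half step serves
  both directions.\<close>

locale gibbs_model =
  fixes n m :: nat and \<eta> :: real and \<sigma> :: "nat \<Rightarrow> nat \<Rightarrow> real"
    and f g :: "nat \<Rightarrow> 'a::euclidean_space \<Rightarrow> real" and af ag :: "nat \<Rightarrow> real"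
  assumes n: "n \<ge> 1" and m: "m \<ge> 1" and eta: "\<eta> > 0"
    and f: "\<And>i. i < n \<Longrightarrow> af i > 0 \<and> strongly_convex (af i) (f i)"
    and g: "\<And>j. j < m \<Longrightarrow> ag j > 0 \<and> strongly_convex (ag j) (g j)"
    and sig: "\<And>i j. i < n \<Longrightarrow> j < m \<Longrightarrow> 0 \<le> \<sigma> i j \<and> \<sigma> i j \<le> 1"
begin

definition U :: "(nat \<Rightarrow> 'a) \<Rightarrow> (nat \<Rightarrow> 'a) \<Rightarrow> real" where
  "U x y = (\<Sum>i<n. f i (x i)) + (\<Sum>j<m. g j (y j))
        + (\<Sum>i<n. \<Sum>j<m. \<sigma> i j / (2 * \<eta>) * (norm (x i - y j))\<^sup>2)"

text \<open>A row sum of \<sigma> is at most \<open>m\<close>, whence the division by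
  \<open>m\<close>: the convexity \<open>af i\<close> is at least \<open>kF - 1\<close> times the
  curvature that the coupling gives in \<open>x i\<close>. Likewise \<open>kG\<close> with column
  sums and \<open>n\<close>.\<close>

definition "kF = 1 + \<eta> * Min (af ` {..<n}) / real m"
definition "kG = 1 + \<eta> * Min (ag ` {..<m}) / real n"

text \<open>Column sums of \<sigma> are, up to \<eta>, the curvatures that the coupling gives in the
  \<open>y j\<close>; this form remains when estimates of the coupling are summed over
  \<open>i\<close>.\<close>

definition S :: "(nat \<Rightarrow> 'a) \<Rightarrow> (nat \<Rightarrow> 'a) \<Rightarrow> real" where
  "S y z = (\<Sum>j<m. (\<Sum>i<n. \<sigma> i j) * (norm (y j - z j))\<^sup>2)"

lemma f_measurable [measurable]: "i < n \<Longrightarrow> f i \<in> borel_measurable borel"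
  using f strongly_convex_measurable by blast

lemma g_measurable [measurable]: "j < m \<Longrightarrow> g j \<in> borel_measurable borel"
  using g strongly_convex_measurable by blast

lemma U_measurable [measurable (raw)]:
  assumes [measurable]: "F \<in> measurable N (blockM n)" "G \<in> measurable N (blockM m)"
  shows "(\<lambda>p. U (F p) (G p)) \<in> borel_measurable N"
proof -
  have [measurable]: "(\<lambda>p. F p i) \<in> borel_measurable N" if "i < n" for i
    using assms(1) that by (rule component_blockM_measurable')
  have [measurable]: "(\<lambda>p. G p j) \<in> borel_measurable N" if "j < m" for j
    using assms(2) that by (rule component_blockM_measurable')
  have [measurable]: "(\<lambda>p. f i (F p i)) \<in> borel_measurable N" if "i < n" for i
    using that by (intro measurable_compose[OF _ f_measurable]) auto
  have [measurable]: "(\<lambda>p. g j (G p j)) \<in> borel_measurable N" if "j < m" for j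
    using that by (intro measurable_compose[OF _ g_measurable]) auto
  show ?thesis unfolding U_def
    by (intro borel_measurable_add borel_measurable_sum borel_measurable_times borel_measurable_const
        borel_measurable_power borel_measurable_norm borel_measurable_diff) auto
qed

lemma Min_af: "0 < Min (af ` {..<n})" and Min_ag: "0 < Min (ag ` {..<m})"
  using f g n m by (auto simp: Min_gr_iff lessThan_empty_iff)

lemma kF: "1 < kF" and kG: "1 < kG"
  using Min_af Min_ag eta n m by (simp_all add: kF_def kG_def)

lemma kF_le: assumes i: "i < n" shows "(kF - 1) * (\<Sum>j<m. \<sigma> i j) / \<eta> \<le> af i"
proof -
  have a: "0 \<le> Min (af ` {..<n})" "Min (af ` {..<n}) \<le> af i"
    using Min_af i by (auto intro: Min_le)
  have "(\<Sum>j<m. \<sigma> i j) \<le> (\<Sum>j<m. 1)" using sig i by (intro sum_mono) auto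
  then have "Min (af ` {..<n}) * (\<Sum>j<m. \<sigma> i j) \<le> Min (af ` {..<n}) * real m"
    using a by (intro mult_left_mono) auto
  then have "(kF - 1) * (\<Sum>j<m. \<sigma> i j) / \<eta> \<le> Min (af ` {..<n})"
    using eta m by (simp add: kF_def field_simps)
  then show ?thesis using a by simp
qed

lemma kG_le: assumes j: "j < m" shows "(kG - 1) * (\<Sum>i<n. \<sigma> i j) / \<eta> \<le> ag j"
proof -
  have a: "0 \<le> Min (ag ` {..<m})" "Min (ag ` {..<m}) \<le> ag j"
    using Min_ag j by (auto intro: Min_le)
  have "(\<Sum>i<n. \<sigma> i j) \<le> (\<Sum>i<n. 1)" using sig j by (intro sum_mono) auto
  then have "Min (ag ` {..<m}) * (\<Sum>i<n. \<sigma> i j) \<le> Min (ag ` {..<m}) * real n"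
    using a by (intro mult_left_mono) auto
  then have "(kG - 1) * (\<Sum>i<n. \<sigma> i j) / \<eta> \<le> Min (ag ` {..<m})"
    using eta n by (simp add: kG_def field_simps)
  then show ?thesis using a by simp
qed

text \<open>The convexity defects of \<open>f\<close>, \<open>g\<close> and the coupling are kept
  apart, because they are traded against each other in one way when both arguments move and in
  another when \<open>y\<close> is frozen.\<close>

lemma U_convex:
  assumes t: "0 \<le> t" "t \<le> 1"
  shows "U (bcomb n t x x') (bcomb m t y y') \<le> t * U x y + (1 - t) * U x' y'
    - t * (1 - t) / 2 * ((\<Sum>i<n. af i * (norm (x i - x' i))\<^sup>2) + (\<Sum>j<m. ag j * (norm (y j - y' j))\<^sup>2)
        + (\<Sum>i<n. \<Sum>j<m. \<sigma> i j / \<eta> * (norm ((x i - x' i) - (y j - y' j)))\<^sup>2))"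
proof -
  have 1: "(\<Sum>i<n. f i (bcomb n t x x' i))
      \<le> (\<Sum>i<n. t * f i (x i) + (1 - t) * f i (x' i) - t * (1 - t) / 2 * (af i * (norm (x i - x' i))\<^sup>2))"
    using strongly_convex_comb[OF _ t] f by (intro sum_mono) (fastforce simp: mult_ac)
  have 2: "(\<Sum>j<m. g j (bcomb m t y y' j))
      \<le> (\<Sum>j<m. t * g j (y j) + (1 - t) * g j (y' j) - t * (1 - t) / 2 * (ag j * (norm (y j - y' j))\<^sup>2))"
    using strongly_convex_comb[OF _ t] g by (intro sum_mono) (fastforce simp: mult_ac)
  have 3: "(norm (bcomb n t x x' i - bcomb m t y y' j))\<^sup>2
      = t * (norm (x i - y j))\<^sup>2 + (1 - t) * (norm (x' i - y' j))\<^sup>2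
        - t * (1 - t) * (norm ((x i - x' i) - (y j - y' j)))\<^sup>2" if "i < n" "j < m" for i j
  proof -
    have "bcomb n t x x' i - bcomb m t y y' j = t *\<^sub>R (x i - y j) + (1 - t) *\<^sub>R (x' i - y' j)"
      using that by (simp add: algebra_simps)
    moreover have "(x i - y j) - (x' i - y' j) = (x i - x' i) - (y j - y' j)" by simp
    ultimately show ?thesis by (metis norm_sq_comb)
  qed
  have 4: "(\<Sum>i<n. \<Sum>j<m. \<sigma> i j / (2 * \<eta>) * (norm (bcomb n t x x' i - bcomb m t y y' j))\<^sup>2)
      = (\<Sum>i<n. \<Sum>j<m. t * (\<sigma> i j / (2 * \<eta>) * (norm (x i - y j))\<^sup>2)
          + (1 - t) * (\<sigma> i j / (2 * \<eta>) * (norm (x' i - y' j))\<^sup>2)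
          - t * (1 - t) / 2 * (\<sigma> i j / \<eta> * (norm ((x i - x' i) - (y j - y' j)))\<^sup>2))"
  proof (intro sum.cong refl)
    fix i j assume "i \<in> {..<n}" "j \<in> {..<m}"
    then have *: "i < n" "j < m" by auto
    have eq: "r * (t * a + (1 - t) * b - t * (1 - t) * c)
        = t * (r * a) + (1 - t) * (r * b) - t * (1 - t) / 2 * (2 * r * c)" for r a b c :: real
      by (simp add: field_simps)
    have "\<sigma> i j / \<eta> = 2 * (\<sigma> i j / (2 * \<eta>))" by simp
    then
    show "\<sigma> i j / (2 * \<eta>) * (norm (bcomb n t x x' i - bcomb m t y y' j))\<^sup>2
        = t * (\<sigma> i j / (2 * \<eta>) * (norm (x i - y j))\<^sup>2)
          + (1 - t) * (\<sigma> i j / (2 * \<eta>) * (norm (x' i - y' j))\<^sup>2)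
          - t * (1 - t) / 2 * (\<sigma> i j / \<eta> * (norm ((x i - x' i) - (y j - y' j)))\<^sup>2)"
      unfolding 3[OF *] by (simp only: eq)
  qed
  show ?thesis
    using 1[unfolded sum.distrib sum_subtractf sum_distrib_left[symmetric]]
      2[unfolded sum.distrib sum_subtractf sum_distrib_left[symmetric]]
      4[unfolded sum.distrib sum_subtractf sum_distrib_left[symmetric]]
    unfolding U_def distrib_left[of t] distrib_left[of "1 - t"] distrib_left[of "t * (1 - t) / 2"]
    by linarith
qed

text \<open>The cross term of the coupling is split by Young's inequality with weight
  \<open>kF\<close>. The resulting loss in \<open>x\<close> is paid by \<open>af\<close>; in
  \<open>y\<close> there remain \<open>1 - 1 / kF\<close> from the coupling and
  \<open>kG - 1\<close> from \<open>ag\<close>, together \<open>(kF * kG - 1) / kF\<close> times the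
  coupling curvature.\<close>

lemma U_convex_joint:
  assumes t: "0 \<le> t" "t \<le> 1"
  shows "U (bcomb n t x x') (bcomb m t y y') \<le> t * U x y + (1 - t) * U x' y'
    - t * (1 - t) / 2 * ((kF * kG - 1) * (S y y' / (\<eta> * kF)))"
proof -
  let ?dx = "\<lambda>i. (norm (x i - x' i))\<^sup>2" and ?dy = "\<lambda>j. (norm (y j - y' j))\<^sup>2"
  have "(\<Sum>i<n. \<Sum>j<m. \<sigma> i j / \<eta> * ((1 - kF) * ?dx i + (1 - 1 / kF) * ?dy j))
      \<le> (\<Sum>i<n. \<Sum>j<m. \<sigma> i j / \<eta> * (norm ((x i - x' i) - (y j - y' j)))\<^sup>2)"
  proof (intro sum_mono mult_left_mono)
    fix i j assume ij: "i \<in> {..<n}" "j \<in> {..<m}"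
    show "0 \<le> \<sigma> i j / \<eta>" using sig ij eta by simp
    show "(1 - kF) * ?dx i + (1 - 1 / kF) * ?dy j \<le> (norm ((x i - x' i) - (y j - y' j)))\<^sup>2"
      using inner_le_weighted_norms[of kF "x i - x' i" "y j - y' j"] kF
        dot_norm_neg[of "x i - x' i" "y j - y' j"]
      by (simp add: algebra_simps)
  qed
  also have "(\<Sum>i<n. \<Sum>j<m. \<sigma> i j / \<eta> * ((1 - kF) * ?dx i + (1 - 1 / kF) * ?dy j))
      = (\<Sum>i<n. \<Sum>j<m. (1 - kF) / \<eta> * ?dx i * \<sigma> i j) + (\<Sum>i<n. \<Sum>j<m. (1 - 1 / kF) / \<eta> * ?dy j * \<sigma> i j)"
    unfolding sum.distrib[symmetric] by (intro sum.cong refl) (simp add: divide_inverse algebra_simps)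
  also have "(\<Sum>i<n. \<Sum>j<m. (1 - 1 / kF) / \<eta> * ?dy j * \<sigma> i j) = (\<Sum>j<m. \<Sum>i<n. (1 - 1 / kF) / \<eta> * ?dy j * \<sigma> i j)"
    by (rule sum.swap)
  finally have A: "(\<Sum>i<n. (1 - kF) / \<eta> * ?dx i * (\<Sum>j<m. \<sigma> i j))
      + (\<Sum>j<m. (1 - 1 / kF) / \<eta> * ?dy j * (\<Sum>i<n. \<sigma> i j))
      \<le> (\<Sum>i<n. \<Sum>j<m. \<sigma> i j / \<eta> * (norm ((x i - x' i) - (y j - y' j)))\<^sup>2)"
    by (simp add: sum_distrib_left)
  have B: "(\<Sum>i<n. (kF - 1) * (\<Sum>j<m. \<sigma> i j) / \<eta> * ?dx i) \<le> (\<Sum>i<n. af i * ?dx i)"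
    using kF_le by (intro sum_mono mult_right_mono) auto
  have C: "(\<Sum>j<m. (kG - 1) * (\<Sum>i<n. \<sigma> i j) / \<eta> * ?dy j) \<le> (\<Sum>j<m. ag j * ?dy j)"
    using kG_le by (intro sum_mono mult_right_mono) auto
  have D: "(\<Sum>i<n. (1 - kF) / \<eta> * ?dx i * (\<Sum>j<m. \<sigma> i j)) + (\<Sum>i<n. (kF - 1) * (\<Sum>j<m. \<sigma> i j) / \<eta> * ?dx i) = 0"
    unfolding sum.distrib[symmetric] by (intro sum.neutral ballI) (simp add: divide_inverse algebra_simps)
  have "(kF * kG - 1) * (S y y' / (\<eta> * kF))
      = (\<Sum>j<m. (kF * kG - 1) / (\<eta> * kF) * ((\<Sum>i<n. \<sigma> i j) * ?dy j))"
    by (simp add: S_def sum_distrib_left sum_divide_distrib)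
  also have "\<dots> = (\<Sum>j<m. (1 - 1 / kF) / \<eta> * ?dy j * (\<Sum>i<n. \<sigma> i j) + (kG - 1) * (\<Sum>i<n. \<sigma> i j) / \<eta> * ?dy j)"
  proof (intro sum.cong refl)
    fix j
    have "(kF * kG - 1) / (\<eta> * kF) = (1 - 1 / kF) / \<eta> + (kG - 1) / \<eta>"
      using kF eta by (simp add: field_simps)
    then show "(kF * kG - 1) / (\<eta> * kF) * ((\<Sum>i<n. \<sigma> i j) * ?dy j)
        = (1 - 1 / kF) / \<eta> * ?dy j * (\<Sum>i<n. \<sigma> i j) + (kG - 1) * (\<Sum>i<n. \<sigma> i j) / \<eta> * ?dy j"
      by (simp only: distrib_right) (simp add: mult_ac)
  qed
  finally have "(kF * kG - 1) * (S y y' / (\<eta> * kF))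
      \<le> (\<Sum>i<n. af i * ?dx i) + (\<Sum>j<m. ag j * ?dy j)
        + (\<Sum>i<n. \<Sum>j<m. \<sigma> i j / \<eta> * (norm ((x i - x' i) - (y j - y' j)))\<^sup>2)"
    using A B C D by (simp add: sum.distrib)
  then have "t * (1 - t) / 2 * ((kF * kG - 1) * (S y y' / (\<eta> * kF)))
      \<le> t * (1 - t) / 2 * ((\<Sum>i<n. af i * ?dx i) + (\<Sum>j<m. ag j * ?dy j)
        + (\<Sum>i<n. \<Sum>j<m. \<sigma> i j / \<eta> * (norm ((x i - x' i) - (y j - y' j)))\<^sup>2))"
    using t by (intro mult_left_mono) auto
  then show ?thesis using U_convex[OF t, of x x' y y'] by linarith
qed

definition tilt :: "(nat \<Rightarrow> 'a) \<Rightarrow> (nat \<Rightarrow> 'a) \<Rightarrow> (nat \<Rightarrow> 'a) \<Rightarrow> real" where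
  "tilt y z x = (\<Sum>i<n. \<Sum>j<m. \<sigma> i j / \<eta> * (x i \<bullet> (z j - y j)))"

text \<open>The part of the coupling quadratic in \<open>x\<close> is the same for \<open>y\<close>
  and \<open>z\<close>, so only a linear form in \<open>x\<close> and a constant remain.\<close>

lemma U_tilt: "\<exists>c. \<forall>x. U x z = U x y + c - tilt y z x"
proof (intro exI allI)
  fix x
  have "\<sigma> i j / (2 * \<eta>) * (norm (x i - z j))\<^sup>2 = \<sigma> i j / (2 * \<eta>) * (norm (x i - y j))\<^sup>2
      + \<sigma> i j / (2 * \<eta>) * ((norm (z j))\<^sup>2 - (norm (y j))\<^sup>2) - \<sigma> i j / \<eta> * (x i \<bullet> (z j - y j))" for i j
    using eta by (simp add: power2_norm_eq_inner inner_simps inner_commute field_simps)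
  then have "(\<Sum>i<n. \<Sum>j<m. \<sigma> i j / (2 * \<eta>) * (norm (x i - z j))\<^sup>2)
      = (\<Sum>i<n. \<Sum>j<m. \<sigma> i j / (2 * \<eta>) * (norm (x i - y j))\<^sup>2)
        + (\<Sum>i<n. \<Sum>j<m. \<sigma> i j / (2 * \<eta>) * ((norm (z j))\<^sup>2 - (norm (y j))\<^sup>2)) - tilt y z x"
    by (simp add: tilt_def sum.distrib sum_subtractf)
  then show "U x z = U x y + ((\<Sum>j<m. g j (z j)) - (\<Sum>j<m. g j (y j))
        + (\<Sum>i<n. \<Sum>j<m. \<sigma> i j / (2 * \<eta>) * ((norm (z j))\<^sup>2 - (norm (y j))\<^sup>2))) - tilt y z x"
    by (simp add: U_def)
qed

text \<open>The weight satisfies \<open>(1 - t) * l = t\<close>, so the two tilts combine to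
  \<open>t\<close> times a linear form in \<open>x - x'\<close>, which strong convexity in the first
  argument absorbs. In exponentiated form this is the pointwise hypothesis of Prekopa-Leindler for
  the tilts by 1 and by \<open>- l\<close>.\<close>

lemma U_convex_tilt:
  assumes l: "0 < l" and t: "t = l / (1 + l)"
  shows "t * tilt y z x - (1 - t) * l * tilt y z x' - t * U x y - (1 - t) * U x' y
      \<le> l / 2 * (S y z / (\<eta> * kF)) - U (bcomb n t x x') y"
proof -
  have t01: "0 < t" "t < 1" using l by (auto simp: t)
  have tl: "(1 - t) * l = t" "t / (1 - t) = l" using l by (auto simp: t field_simps)
  let ?dx = "\<lambda>i. (norm (x i - x' i))\<^sup>2" and ?dy = "\<lambda>j. (norm (y j - z j))\<^sup>2"
  \<comment> \<open>With this Young weight the terms in \<open>x - x'\<close> consume the curvature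
    lower bound, \<open>kF\<close> times a row sum over \<eta>, exactly; the form in
    \<open>y - z\<close> is left with the factor \<open>t / (1 - t) = l\<close>.\<close>
  define c where "c = kF * (1 - t)"
  have c: "0 < c" using kF t01 by (simp add: c_def)
  \<comment> \<open>Checked below \<open>m\<close> only, at the indices that \<open>U\<close> reads;
    beyond them \<open>bcomb\<close> takes the default value of a restriction.\<close>
  have "bcomb m t y y j = y j" if "j < m" for j using that by (simp flip: scaleR_add_left)
  then have Uy: "U w (bcomb m t y y) = U w y" for w by (simp add: U_def)
  have "tilt y z x - tilt y z x' = (\<Sum>i<n. \<Sum>j<m. \<sigma> i j / \<eta> * ((x i - x' i) \<bullet> (z j - y j)))"
    by (simp add: tilt_def sum_subtractf[symmetric] inner_diff_left right_diff_distrib)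
  also have "\<dots> \<le> (\<Sum>i<n. \<Sum>j<m. \<sigma> i j / \<eta> * (c / 2 * ?dx i + ?dy j / (2 * c)))"
  proof (intro sum_mono mult_left_mono)
    fix i j assume ij: "i \<in> {..<n}" "j \<in> {..<m}"
    show "0 \<le> \<sigma> i j / \<eta>" using sig ij eta by simp
    show "(x i - x' i) \<bullet> (z j - y j) \<le> c / 2 * ?dx i + ?dy j / (2 * c)"
      using inner_le_weighted_norms[OF c, of "x i - x' i" "z j - y j"]
      by (simp add: norm_minus_commute[of "z j"] field_simps)
  qed
  also have "\<dots> = (\<Sum>i<n. \<Sum>j<m. c / (2 * \<eta>) * ?dx i * \<sigma> i j) + (\<Sum>i<n. \<Sum>j<m. ?dy j / (2 * c * \<eta>) * \<sigma> i j)"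
    by (simp add: sum.distrib[symmetric] distrib_left mult_ac)
  also have "(\<Sum>i<n. \<Sum>j<m. ?dy j / (2 * c * \<eta>) * \<sigma> i j) = (\<Sum>j<m. \<Sum>i<n. ?dy j / (2 * c * \<eta>) * \<sigma> i j)"
    by (rule sum.swap)
  also have "\<dots> = S y z / (2 * c * \<eta>)"
    by (simp add: S_def sum_divide_distrib sum_distrib_left sum_distrib_right mult_ac)
  also have "(\<Sum>i<n. \<Sum>j<m. c / (2 * \<eta>) * ?dx i * \<sigma> i j)
      \<le> (1 - t) / 2 * (\<Sum>i<n. (af i + (\<Sum>j<m. \<sigma> i j) / \<eta>) * ?dx i)"
    unfolding sum_distrib_left
  proof (rule sum_mono)
    fix i assume i: "i \<in> {..<n}"
    have "kF * (\<Sum>j<m. \<sigma> i j) / \<eta> \<le> af i + (\<Sum>j<m. \<sigma> i j) / \<eta>"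
      using kF_le[of i] i by (simp add: left_diff_distrib diff_divide_distrib)
    then have "(1 - t) / 2 * (kF * (\<Sum>j<m. \<sigma> i j) / \<eta> * ?dx i) \<le> (1 - t) / 2 * ((af i + (\<Sum>j<m. \<sigma> i j) / \<eta>) * ?dx i)"
      using t01 by (intro mult_left_mono mult_right_mono) auto
    also have "(1 - t) / 2 * (kF * (\<Sum>j<m. \<sigma> i j) / \<eta> * ?dx i) = (\<Sum>j<m. c / (2 * \<eta>) * ?dx i * \<sigma> i j)"
      unfolding sum_distrib_left[symmetric] by (simp add: c_def mult_ac)
    finally show "(\<Sum>j<m. c / (2 * \<eta>) * ?dx i * \<sigma> i j)
        \<le> (1 - t) / 2 * ((af i + (\<Sum>j<m. \<sigma> i j) / \<eta>) * ?dx i)" .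
  qed
  finally have tilt_le: "t * (tilt y z x - tilt y z x') \<le> t * ((1 - t) / 2 * (\<Sum>i<n. (af i + (\<Sum>j<m. \<sigma> i j) / \<eta>) * ?dx i) + S y z / (2 * c * \<eta>))"
    using t01 by (intro mult_left_mono) auto
  have S_eq: "t * (S y z / (2 * c * \<eta>)) = l / 2 * (S y z / (\<eta> * kF))"
    unfolding tl(2)[symmetric] c_def by simp
  have "(\<Sum>i<n. af i * ?dx i) + (\<Sum>j<m. ag j * (norm (y j - y j))\<^sup>2)
        + (\<Sum>i<n. \<Sum>j<m. \<sigma> i j / \<eta> * (norm ((x i - x' i) - (y j - y j)))\<^sup>2)
      = (\<Sum>i<n. (af i + (\<Sum>j<m. \<sigma> i j) / \<eta>) * ?dx i)"
    unfolding distrib_right sum.distrib sum_divide_distrib sum_distrib_right by simp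
  then have U_le: "U (bcomb n t x x') y \<le> t * U x y + (1 - t) * U x' y
      - t * ((1 - t) / 2 * (\<Sum>i<n. (af i + (\<Sum>j<m. \<sigma> i j) / \<eta>) * ?dx i))"
    using U_convex[of t x x' y y] t01 unfolding Uy by simp
  show ?thesis
    using tilt_le[unfolded distrib_left[of t] S_eq right_diff_distrib[of t]] U_le unfolding tl(1)
    by linarith
qed

subsection \<open>Conditional laws and tilting\<close>

abbreviation LX :: "(nat \<Rightarrow> 'a) measure" where "LX \<equiv> blockM n"
abbreviation LY :: "(nat \<Rightarrow> 'a) measure" where "LY \<equiv> blockM m"

sublocale X: sigma_finite_measure LX by (rule sigma_finite_blockM)
sublocale Y: sigma_finite_measure LY by (rule sigma_finite_blockM)
sublocale XY: pair_sigma_finite LX LY ..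

section \<open>Normalisation and the marginal of Y\<close>

definition Z :: real where
  "Z = enn2real (\<integral>\<^sup>+p. ennreal (exp (- U (fst p) (snd p))) \<partial>(LX \<Otimes>\<^sub>M LY))"

definition P :: "(nat \<Rightarrow> 'a) \<Rightarrow> (nat \<Rightarrow> 'a) \<Rightarrow> real" where
  "P x y = exp (- U x y) / Z"

text \<open>Dropping the nonnegative coupling leaves a product of integrable factors, which makes
  the integrals over both blocks and over \<open>x\<close> alone finite.\<close>

lemma exp_U_le:
  "ennreal (exp (- U x y)) \<le> (\<Prod>i<n. ennreal (exp (- f i (x i)))) * (\<Prod>j<m. ennreal (exp (- g j (y j))))"
proof -
  have "0 \<le> (\<Sum>i<n. \<Sum>j<m. \<sigma> i j / (2 * \<eta>) * (norm (x i - y j))\<^sup>2)"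
    using sig eta by (intro sum_nonneg mult_nonneg_nonneg) auto
  then have "exp (- U x y) \<le> exp (\<Sum>i<n. - f i (x i)) * exp (\<Sum>j<m. - g j (y j))"
    unfolding exp_add[symmetric] by (simp add: U_def sum_negf)
  then show ?thesis
    by (simp add: exp_sum prod_ennreal prod_nonneg ennreal_leI flip: ennreal_mult)
qed

lemma prod_f_finite: "(\<integral>\<^sup>+x. (\<Prod>i<n. ennreal (exp (- f i (x i)))) \<partial>LX) < \<top>"
proof -
  have "(\<integral>\<^sup>+x. ennreal (exp (- f i x)) \<partial>lborel) \<noteq> \<top>" if "i < n" for i
    using strongly_convex_integrable[of "af i" "f i"] f[OF that] by (simp add: less_top)
  then show ?thesis
    by (subst nn_integral_prod_blockM) (auto simp: less_top[symmetric] ennreal_prod_eq_top)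
qed

lemma prod_g_finite: "(\<integral>\<^sup>+y. (\<Prod>j<m. ennreal (exp (- g j (y j)))) \<partial>LY) < \<top>"
proof -
  have "(\<integral>\<^sup>+y. ennreal (exp (- g j y)) \<partial>lborel) \<noteq> \<top>" if "j < m" for j
    using strongly_convex_integrable[of "ag j" "g j"] g[OF that] by (simp add: less_top)
  then show ?thesis
    by (subst nn_integral_prod_blockM) (auto simp: less_top[symmetric] ennreal_prod_eq_top)
qed

lemma prod_f_measurable [measurable]: "(\<lambda>x. \<Prod>i<n. ennreal (exp (- f i (x i)))) \<in> borel_measurable LX"
proof (rule borel_measurable_prod_ennreal)
  fix i assume "i \<in> {..<n}"
  then have [measurable]: "(\<lambda>x. f i (x i)) \<in> borel_measurable LX"
    by (intro measurable_compose[OF component_blockM_measurable f_measurable]) auto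
  show "(\<lambda>x. ennreal (exp (- f i (x i)))) \<in> borel_measurable LX" by measurable
qed

lemma prod_g_measurable [measurable]: "(\<lambda>y. \<Prod>j<m. ennreal (exp (- g j (y j)))) \<in> borel_measurable LY"
proof (rule borel_measurable_prod_ennreal)
  fix j assume "j \<in> {..<m}"
  then have [measurable]: "(\<lambda>y. g j (y j)) \<in> borel_measurable LY"
    by (intro measurable_compose[OF component_blockM_measurable g_measurable]) auto
  show "(\<lambda>y. ennreal (exp (- g j (y j)))) \<in> borel_measurable LY" by measurable
qed

lemma nn_integral_exp_U: "(\<integral>\<^sup>+p. ennreal (exp (- U (fst p) (snd p))) \<partial>(LX \<Otimes>\<^sub>M LY)) = ennreal Z"
  and Z_pos: "0 < Z"
proof -
  let ?I = "\<integral>\<^sup>+p. ennreal (exp (- U (fst p) (snd p))) \<partial>(LX \<Otimes>\<^sub>M LY)"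
  have eq: "?I = (\<integral>\<^sup>+x. \<integral>\<^sup>+y. ennreal (exp (- U x y)) \<partial>LY \<partial>LX)"
    by (subst Y.nn_integral_fst[symmetric]) auto
  also have "\<dots> \<le> (\<integral>\<^sup>+x. \<integral>\<^sup>+y. (\<Prod>i<n. ennreal (exp (- f i (x i)))) * (\<Prod>j<m. ennreal (exp (- g j (y j)))) \<partial>LY \<partial>LX)"
    by (intro nn_integral_mono exp_U_le)
  also have "\<dots> = (\<integral>\<^sup>+x. (\<Prod>i<n. ennreal (exp (- f i (x i)))) \<partial>LX) * (\<integral>\<^sup>+y. (\<Prod>j<m. ennreal (exp (- g j (y j)))) \<partial>LY)"
    by (simp add: nn_integral_cmult nn_integral_multc)
  also have "\<dots> < \<top>" using prod_f_finite prod_g_finite by (simp add: ennreal_mult_less_top)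
  finally have fin: "?I < \<top>" .
  then show "?I = ennreal Z" by (simp add: Z_def)
  have "0 < ?I" unfolding eq
    by (intro nn_integral_pos_blockM) auto
  then show "0 < Z" using fin by (simp add: Z_def enn2real_positive_iff)
qed

lemma P_pos [simp]: "0 < P x y" and P_nonneg [simp]: "0 \<le> P x y"
  using Z_pos by (simp_all add: P_def)

lemma P_measurable [measurable (raw)]:
  assumes [measurable]: "F \<in> measurable N LX" "G \<in> measurable N LY"
  shows "(\<lambda>p. P (F p) (G p)) \<in> borel_measurable N"
  unfolding P_def by measurable

lemma P_total: "(\<integral>\<^sup>+p. ennreal (P (fst p) (snd p)) \<partial>(LX \<Otimes>\<^sub>M LY)) = 1"
proof -
  have "ennreal (P x y) = ennreal (1 / Z) * ennreal (exp (- U x y))" for x y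
    using Z_pos by (simp add: P_def flip: ennreal_mult)
  then have "(\<integral>\<^sup>+p. ennreal (P (fst p) (snd p)) \<partial>(LX \<Otimes>\<^sub>M LY))
      = ennreal (1 / Z) * (\<integral>\<^sup>+p. ennreal (exp (- U (fst p) (snd p))) \<partial>(LX \<Otimes>\<^sub>M LY))"
    by (simp only:) (rule nn_integral_cmult, measurable)
  also have "\<dots> = 1" using Z_pos by (simp add: nn_integral_exp_U flip: ennreal_mult)
  finally show ?thesis .
qed

definition pY :: "(nat \<Rightarrow> 'a) \<Rightarrow> real" where
  "pY y = enn2real (\<integral>\<^sup>+x. ennreal (P x y) \<partial>LX)"

text \<open>The product bound is pointwise in \<open>y\<close>, so these facts hold at every point
  and \<open>condX y\<close> is a probability measure without exceptional \<open>y\<close>.\<close>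

lemma nn_integral_P: "y \<in> space LY \<Longrightarrow> (\<integral>\<^sup>+x. ennreal (P x y) \<partial>LX) = ennreal (pY y)"
  and pY_pos: "y \<in> space LY \<Longrightarrow> 0 < pY y"
proof -
  assume y [measurable]: "y \<in> space LY"
  let ?I = "\<integral>\<^sup>+x. ennreal (P x y) \<partial>LX"
  let ?c = "(\<Prod>j<m. ennreal (exp (- g j (y j))))"
  have "ennreal (P x y) = ennreal (1 / Z) * ennreal (exp (- U x y))" for x
    using Z_pos by (simp add: P_def flip: ennreal_mult)
  then have "?I \<le> (\<integral>\<^sup>+x. ennreal (1 / Z) * ((\<Prod>i<n. ennreal (exp (- f i (x i)))) * ?c) \<partial>LX)"
    by (auto intro!: nn_integral_mono mult_left_mono exp_U_le)
  also have "\<dots> = ennreal (1 / Z) * ((\<integral>\<^sup>+x. (\<Prod>i<n. ennreal (exp (- f i (x i)))) \<partial>LX) * ?c)"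
    by (simp add: nn_integral_cmult nn_integral_multc)
  also have "\<dots> < \<top>" using prod_f_finite by (simp add: ennreal_mult_less_top prod_ennreal)
  finally have fin: "?I < \<top>" .
  then show "?I = ennreal (pY y)" by (simp add: pY_def)
  have "0 < ?I" by (intro nn_integral_pos_blockM) auto
  then show "0 < pY y" using fin by (simp add: pY_def enn2real_positive_iff)
qed

lemma pY_measurable [measurable]: "pY \<in> borel_measurable LY"
  unfolding pY_def by measurable

section \<open>The conditional law of X given y\<close>

definition condX :: "(nat \<Rightarrow> 'a) \<Rightarrow> (nat \<Rightarrow> 'a) measure" where
  "condX y = density LX (\<lambda>x. ennreal (P x y / pY y))"

lemma space_condX [simp]: "space (condX y) = space LX" and sets_condX [simp, measurable_cong]: "sets (condX y) = sets LX"
  by (simp_all add: condX_def)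

lemma nn_integral_condX:
  assumes [measurable]: "y \<in> space LY" "F \<in> borel_measurable LX"
  shows "(\<integral>\<^sup>+x. F x \<partial>condX y) = (\<integral>\<^sup>+x. ennreal (P x y / pY y) * F x \<partial>LX)"
  unfolding condX_def by (subst nn_integral_density) auto

lemma nn_integral_condX_mult:
  assumes y [measurable]: "y \<in> space LY" and F [measurable]: "F \<in> borel_measurable LX"
  shows "ennreal (pY y) * (\<integral>\<^sup>+x. F x \<partial>condX y) = (\<integral>\<^sup>+x. ennreal (P x y) * F x \<partial>LX)"
proof -
  have eq: "ennreal (pY y) * (ennreal (P x y / pY y) * F x) = ennreal (P x y) * F x" for x
    using pY_pos[OF y] by (simp add: mult.assoc[symmetric] flip: ennreal_mult)
  have "ennreal (pY y) * (\<integral>\<^sup>+x. F x \<partial>condX y) = (\<integral>\<^sup>+x. ennreal (pY y) * (ennreal (P x y / pY y) * F x) \<partial>LX)"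
    unfolding nn_integral_condX[OF y F] by (rule nn_integral_cmult[symmetric]) measurable
  then show ?thesis by (simp only: eq)
qed

lemma prob_space_condX: assumes y: "y \<in> space LY" shows "prob_space (condX y)"
proof
  have "ennreal (pY y) * (\<integral>\<^sup>+x. 1 \<partial>condX y) = ennreal (pY y) * 1"
    by (subst nn_integral_condX_mult[OF y]) (auto simp: nn_integral_P[OF y])
  then show "emeasure (condX y) (space (condX y)) = 1"
    using pY_pos[OF y] by (subst (asm) ennreal_mult_cancel_left) auto
qed

lemma nn_integral_condX_measurable [measurable (raw)]:
  assumes [measurable]: "F \<in> borel_measurable LX"
  shows "(\<lambda>y. \<integral>\<^sup>+x. F x \<partial>condX y) \<in> borel_measurable LY"
proof -
  have "(\<lambda>y. \<integral>\<^sup>+x. ennreal (P x y / pY y) * F x \<partial>LX) \<in> borel_measurable LY"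
    by measurable
  then show ?thesis
    by (rule measurable_cong[THEN iffD1, rotated]) (simp add: nn_integral_condX)
qed

lemma tilt_measurable [measurable]: "tilt y z \<in> borel_measurable LX"
proof -
  have [measurable]: "(\<lambda>x. x i) \<in> borel_measurable LX" if "i \<in> {..<n}" for i
    using that by (intro component_blockM_measurable) auto
  show ?thesis unfolding tilt_def by measurable
qed

text \<open>\<open>condX z\<close> is \<open>condX y\<close> reweighted by
  \<open>exp (tilt y z x)\<close> and renormalised. All constants are gathered in \<open>d\<close>,
  and the test function 1 identifies \<open>d\<close> as the inverse of the tilted mass.\<close>

lemma condX_tilt:
  assumes y [measurable]: "y \<in> space LY" and z [measurable]: "z \<in> space LY"
    and [measurable]: "F \<in> borel_measurable LX"
  shows "(\<integral>\<^sup>+x. F x * ennreal (exp (tilt y z x)) \<partial>condX y)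
      = (\<integral>\<^sup>+x. F x \<partial>condX z) * (\<integral>\<^sup>+x. ennreal (exp (tilt y z x)) \<partial>condX y)"
proof -
  obtain c where c: "\<And>x. U x z = U x y + c - tilt y z x" using U_tilt by blast
  have P: "P x z = exp (- c) * (P x y * exp (tilt y z x))" for x
    by (simp add: P_def c exp_add[symmetric] exp_diff[symmetric])
  define d where "d = exp (- c) * pY y / pY z"
  have d: "0 < d" using pY_pos[OF y] pY_pos[OF z] by (simp add: d_def)
  have *: "(\<integral>\<^sup>+x. G x \<partial>condX z) = ennreal d * (\<integral>\<^sup>+x. G x * ennreal (exp (tilt y z x)) \<partial>condX y)"
    if [measurable]: "G \<in> borel_measurable LX" for G
  proof -
    have eq: "ennreal (P x z / pY z) * G x = ennreal d * (ennreal (P x y / pY y) * (G x * ennreal (exp (tilt y z x))))" for x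
    proof -
      have "P x z / pY z = d * (P x y / pY y) * exp (tilt y z x)"
        using pY_pos[OF y] by (simp add: P d_def)
      then have "ennreal (P x z / pY z) = ennreal d * ennreal (P x y / pY y) * ennreal (exp (tilt y z x))"
        using d pY_pos[OF y] by (simp only: ennreal_mult' exp_ge_zero ennreal_mult'' less_imp_le)
      then show ?thesis by (simp only: mult_ac)
    qed
    have GT: "(\<lambda>x. G x * ennreal (exp (tilt y z x))) \<in> borel_measurable LX" by measurable
    show ?thesis
      unfolding nn_integral_condX[OF z that] nn_integral_condX[OF y GT] eq
      by (rule nn_integral_cmult) measurable
  qed
  have 1: "1 = ennreal d * (\<integral>\<^sup>+x. ennreal (exp (tilt y z x)) \<partial>condX y)"
    using *[of "\<lambda>_. 1"] prob_space.emeasure_space_1[OF prob_space_condX[OF z]] by simp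
  have "(\<integral>\<^sup>+x. F x \<partial>condX z) * (\<integral>\<^sup>+x. ennreal (exp (tilt y z x)) \<partial>condX y)
      = (ennreal d * (\<integral>\<^sup>+x. ennreal (exp (tilt y z x)) \<partial>condX y)) * (\<integral>\<^sup>+x. F x * ennreal (exp (tilt y z x)) \<partial>condX y)"
    by (simp add: * mult_ac)
  then show ?thesis unfolding 1[symmetric] by simp
qed

text \<open>Prekopa-Leindler for the density of \<open>condX y\<close> tilted by 1 and by
  \<open>- l\<close>, raised to the power \<open>1 + l\<close>. Adding a constant to the tilt does
  not change \<open>l * ln A + ln B\<close>, so the conditional mean never enters; this is the
  combination that occurs in \<open>entropy_tilt\<close>.\<close>

lemma tilt_subgaussian:
  assumes y [measurable]: "y \<in> space LY" and l: "0 < l"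
  obtains A B where "0 < A" "0 < B" "(\<integral>\<^sup>+x. ennreal (exp (tilt y z x)) \<partial>condX y) = ennreal A"
    "(\<integral>\<^sup>+x. ennreal (exp (- l * tilt y z x)) \<partial>condX y) = ennreal B"
    "l * ln A + ln B \<le> l * (1 + l) / 2 * (S y z / (\<eta> * kF))"
proof -
  define t where "t = l / (1 + l)"
  have t: "0 < t" "t < 1" "1 - t = 1 / (1 + l)" using l by (auto simp: t_def field_simps)
  let ?A = "\<integral>\<^sup>+x. ennreal (exp (tilt y z x)) \<partial>condX y"
  let ?B = "\<integral>\<^sup>+x. ennreal (exp (- l * tilt y z x)) \<partial>condX y"
  let ?d = "\<lambda>x. P x y / pY y"
  define K where "K = l / 2 * (S y z / (\<eta> * kF))"
  have dpos: "0 < ?d x" for x using pY_pos[OF y] by simp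
  have PL: "epow (\<integral>\<^sup>+x. ennreal (?d x * exp (tilt y z x)) \<partial>LX) t
      * epow (\<integral>\<^sup>+x. ennreal (?d x * exp (- l * tilt y z x)) \<partial>LX) (1 - t)
      \<le> (\<integral>\<^sup>+x. ennreal (exp K * ?d x) \<partial>LX)"
  proof (rule prekopa_leindlerD[OF prekopa_leindler_blockM[OF t(1,2)]])
    fix x x' :: "nat \<Rightarrow> 'a"
    define C where "C = ln (Z * pY y)"
    have d: "?d x = exp (- U x y - C)" for x
      using Z_pos pY_pos[OF y] by (simp add: P_def C_def exp_diff)
    have "(?d x * exp (tilt y z x)) powr t * (?d x' * exp (- l * tilt y z x')) powr (1 - t)
        = exp (t * (- U x y - C + tilt y z x) + (1 - t) * (- U x' y - C + (- l * tilt y z x')))"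
      unfolding d exp_add[symmetric] by (simp add: powr_def mult_exp_exp)
    also have "\<dots> = exp ((t * tilt y z x - (1 - t) * l * tilt y z x' - t * U x y - (1 - t) * U x' y) - C)"
      by (rule arg_cong[where f = exp]) (simp add: algebra_simps)
    also have "\<dots> \<le> exp ((K - U (bcomb n t x x') y) - C)"
      using U_convex_tilt[OF l t_def, of y z x x'] by (simp add: K_def)
    also have "\<dots> = exp K * ?d (bcomb n t x x')"
      unfolding d exp_add[symmetric] by simp
    finally show "epow (ennreal (?d x * exp (tilt y z x))) t * epow (ennreal (?d x' * exp (- l * tilt y z x'))) (1 - t)
        \<le> ennreal (exp K * ?d (bcomb n t x x'))"
      using pY_pos[OF y] by (simp add: epow_ennreal ennreal_leI flip: ennreal_mult)
  qed measurable
  have eqA: "(\<integral>\<^sup>+x. ennreal (?d x * exp (tilt y z x)) \<partial>LX) = ?A"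
    and eqB: "(\<integral>\<^sup>+x. ennreal (?d x * exp (- l * tilt y z x)) \<partial>LX) = ?B"
    using less_imp_le[OF dpos]
    by (subst nn_integral_condX[OF y]; (simp only: ennreal_mult')?; measurable?)+
  have "(\<integral>\<^sup>+x. ennreal (exp K * ?d x) \<partial>LX) = ennreal (exp K) * (\<integral>\<^sup>+x. ennreal (?d x) \<partial>LX)"
    by (simp only: ennreal_mult'[OF exp_ge_zero]) (rule nn_integral_cmult, measurable)
  also have "(\<integral>\<^sup>+x. ennreal (?d x) \<partial>LX) = 1"
    using prob_space.emeasure_space_1[OF prob_space_condX[OF y]] nn_integral_condX[OF y, of "\<lambda>_. 1"] by simp
  also have "ennreal (exp K) * 1 = ennreal (exp K)" by simp
  finally have le: "epow ?A t * epow ?B (1 - t) \<le> ennreal (exp K)"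
    using PL unfolding eqA eqB by simp
  have posA: "0 < ?A" unfolding eqA[symmetric] using pY_pos[OF y] by (intro nn_integral_pos_blockM) auto
  have posB: "0 < ?B" unfolding eqB[symmetric] using pY_pos[OF y] by (intro nn_integral_pos_blockM) auto
  have epos: "0 < epow a s" if "0 < a" for a s
    using that by (cases a) (auto simp: epow_ennreal)
  \<comment> \<open>Both integrals are positive, so a finite bound on the product of their powers
    excludes \<top> for either.\<close>
  have "?A \<noteq> \<top>" "?B \<noteq> \<top>"
    using le epos[OF posA, of t] epos[OF posB, of "1 - t"]
    by (auto simp: ennreal_mult_top ennreal_top_mult top_unique split: if_splits)
  then obtain A B where AB: "?A = ennreal A" "?B = ennreal B" "0 < A" "0 < B"
    using posA posB by (metis ennreal_cases ennreal_less_zero_iff)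
  have "A powr t * B powr (1 - t) \<le> exp K"
    using le AB by (simp add: epow_ennreal flip: ennreal_mult)
  then have "ln (A powr t * B powr (1 - t)) \<le> ln (exp K)"
    using AB by (subst ln_le_cancel_iff) auto
  then have "t * ln A + (1 - t) * ln B \<le> K"
    using AB by (simp add: ln_mult ln_powr)
  then have "(1 + l) * (t * ln A + (1 - t) * ln B) \<le> (1 + l) * K"
    using l by (intro mult_left_mono) auto
  moreover have "(1 + l) * (t * ln A + (1 - t) * ln B) = l * ln A + ln B"
  proof -
    have "(1 + l) * t = l" "(1 + l) * (1 - t) = 1" using l unfolding t(3) by (simp_all add: t_def)
    then show ?thesis by (simp only: distrib_left mult.assoc[symmetric] mult_1)
  qed
  ultimately have "l * ln A + ln B \<le> l * (1 + l) / 2 * (S y z / (\<eta> * kF))"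
    by (simp add: K_def mult_ac)
  then show ?thesis using that AB by blast
qed

text \<open>\<open>entropy_tilt\<close> is applied under \<open>condX y\<close> to the normalised
  density \<open>\<rho> / h\<close> and the tilt towards \<open>z\<close>. The tilted mean is then
  the value at \<open>z\<close> times \<open>A / h\<close>, and \<open>tilt_subgaussian\<close>
  eliminates \<open>A\<close> and \<open>B\<close>.\<close>

lemma tilt_bound:
  assumes y: "y \<in> space LY" and z: "z \<in> space LY" and l: "0 < l"
    and [measurable]: "\<rho> \<in> borel_measurable LX" and \<rho>: "\<And>x. 0 \<le> \<rho> x"
    and h: "(\<integral>\<^sup>+x. ennreal (\<rho> x) \<partial>condX y) = ennreal h" "0 < h"
    and K: "(\<integral>\<^sup>+x. ennreal (ent (\<rho> x / h)) \<partial>condX y) = ennreal K" "0 \<le> K"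
  shows "ennreal (h * exp (- K / l - (1 + l) / 2 * (S y z / (\<eta> * kF)))) \<le> (\<integral>\<^sup>+x. ennreal (\<rho> x) \<partial>condX z)"
proof (cases "(\<integral>\<^sup>+x. ennreal (\<rho> x) \<partial>condX z) = \<top>")
  case False
  interpret prob_space "condX y" using y by (rule prob_space_condX)
  obtain A B where AB: "0 < A" "0 < B" "(\<integral>\<^sup>+x. ennreal (exp (tilt y z x)) \<partial>condX y) = ennreal A"
    "(\<integral>\<^sup>+x. ennreal (exp (- l * tilt y z x)) \<partial>condX y) = ennreal B"
    "l * ln A + ln B \<le> l * (1 + l) / 2 * (S y z / (\<eta> * kF))"
    using tilt_subgaussian[OF y l] by blast
  obtain hz where hz: "(\<integral>\<^sup>+x. ennreal (\<rho> x) \<partial>condX z) = ennreal hz" "0 \<le> hz"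
    using False by (metis ennreal_cases)
  have tl: "(\<integral>\<^sup>+x. ennreal (\<rho> x) * ennreal (exp (tilt y z x)) \<partial>condX y) = ennreal (hz * A)"
    using condX_tilt[OF y z, of "\<lambda>x. ennreal (\<rho> x)"] AB hz by (simp add: ennreal_mult)
  have q1: "(\<integral>\<^sup>+x. ennreal (\<rho> x / h) \<partial>condX y) = 1"
  proof -
    have "(\<integral>\<^sup>+x. ennreal (\<rho> x / h) \<partial>condX y) = (\<integral>\<^sup>+x. ennreal (1 / h) * ennreal (\<rho> x) \<partial>condX y)"
      using h \<rho> by (intro nn_integral_cong) (simp flip: ennreal_mult)
    also have "\<dots> = 1" using h by (simp add: nn_integral_cmult flip: ennreal_mult)
    finally show ?thesis .
  qed
  have qa: "(\<integral>\<^sup>+x. ennreal (\<rho> x / h * exp (tilt y z x)) \<partial>condX y) = ennreal (hz * A / h)"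
  proof -
    have "(\<integral>\<^sup>+x. ennreal (\<rho> x / h * exp (tilt y z x)) \<partial>condX y)
        = (\<integral>\<^sup>+x. ennreal (1 / h) * (ennreal (\<rho> x) * ennreal (exp (tilt y z x))) \<partial>condX y)"
      using h \<rho> by (intro nn_integral_cong) (simp flip: ennreal_mult)
    also have "\<dots> = ennreal (hz * A / h)" using h AB hz by (simp add: nn_integral_cmult tl flip: ennreal_mult)
    finally show ?thesis .
  qed
  \<comment> \<open>The logarithm of \<open>hz\<close> is needed. Since the tilt factor never
    vanishes, \<open>hz = 0\<close> would force \<rho> to vanish almost everywhere under
    \<open>condX y\<close>, against \<open>0 < h\<close>.\<close>
  have "hz \<noteq> 0"
  proof
    assume "hz = 0"
    then have "AE x in condX y. ennreal (\<rho> x) * ennreal (exp (tilt y z x)) = 0"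
      using tl by (simp add: nn_integral_0_iff_AE)
    then have "AE x in condX y. ennreal (\<rho> x) = 0" by eventually_elim auto
    then have "(\<integral>\<^sup>+x. ennreal (\<rho> x) \<partial>condX y) = 0" by (simp add: nn_integral_0_iff_AE)
    then show False using h by simp
  qed
  then have hz0: "0 < hz" using hz by simp
  have "0 \<le> l * ln (hz * A / h) + ln B + K"
    using h AB hz0 l \<rho> by (intro entropy_tilt[OF prob_space_axioms _ _ _ q1 _ qa _ AB(4) _ K]) auto
  then have "l * (ln h - K / l - (1 + l) / 2 * (S y z / (\<eta> * kF))) \<le> l * ln hz"
    using AB h hz0 l by (simp add: ln_mult ln_div algebra_simps)
  then have "ln h - K / l - (1 + l) / 2 * (S y z / (\<eta> * kF)) \<le> ln hz"
    using l by simp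
  then have "exp (ln h - K / l - (1 + l) / 2 * (S y z / (\<eta> * kF))) \<le> exp (ln hz)" by simp
  then have "h * exp (- K / l - (1 + l) / 2 * (S y z / (\<eta> * kF))) \<le> hz"
    using h hz0 by (simp add: exp_diff exp_minus exp_add field_simps)
  then show ?thesis unfolding hz(1) by (rule ennreal_leI)
qed simp

subsection \<open>Entropy contraction of a half step\<close>

lemma nn_integral_XY:
  assumes [measurable]: "F \<in> borel_measurable (LX \<Otimes>\<^sub>M LY)"
  shows "(\<integral>\<^sup>+p. F p \<partial>(LX \<Otimes>\<^sub>M LY)) = (\<integral>\<^sup>+y. (\<integral>\<^sup>+x. F (x, y) \<partial>LX) \<partial>LY)"
  by (rule XY.nn_integral_snd[symmetric]) simp

lemma nn_integral_pY: "(\<integral>\<^sup>+y. ennreal (pY y) \<partial>LY) = 1"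
proof -
  have "(\<integral>\<^sup>+y. ennreal (pY y) \<partial>LY) = (\<integral>\<^sup>+y. (\<integral>\<^sup>+x. ennreal (P x y) \<partial>LX) \<partial>LY)"
    by (intro nn_integral_cong) (simp add: nn_integral_P)
  also have "\<dots> = 1"
    using P_total by (subst (asm) nn_integral_XY) auto
  finally show ?thesis .
qed

text \<open>Write \<open>H\<close> for the entropy of the averaged density and \<open>E\<close> for
  that of \<rho>. The argument yields \<open>s * H\<close> at most \<open>(E - H) / l\<close>, and
  \<open>l * s + 1\<close> equals \<open>(1 - s) * (kF * kG)\<close> by \<open>ls\<close>.\<close>

lemma half_step_aux:
  assumes \<rho>m [measurable]: "\<rho> \<in> borel_measurable LX" and \<rho>: "\<And>x. 0 \<le> \<rho> x"
    and total: "(\<integral>\<^sup>+y. ennreal (pY y) * (\<integral>\<^sup>+x. ennreal (\<rho> x) \<partial>condX y) \<partial>LY) = 1"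
    and fin: "(\<integral>\<^sup>+y. ennreal (pY y) * (\<integral>\<^sup>+x. ennreal (ent (\<rho> x)) \<partial>condX y) \<partial>LY) \<noteq> \<top>"
    and s: "0 < s" "s < 1" and l: "0 < l" and ls: "(1 + l) * s = (1 - s) * (kF * kG - 1)"
  shows "ennreal ((1 - s) * (kF * kG)) * (\<integral>\<^sup>+y. ennreal (pY y * ent (enn2real (\<integral>\<^sup>+x. ennreal (\<rho> x) \<partial>condX y))) \<partial>LY)
      \<le> (\<integral>\<^sup>+y. ennreal (pY y) * (\<integral>\<^sup>+x. ennreal (ent (\<rho> x)) \<partial>condX y) \<partial>LY)"
proof -
  define t where "t = 1 - s"
  have t: "0 < t" "t < 1" "1 - t = s" using s by (auto simp: t_def)
  define h where "h y = (\<integral>\<^sup>+x. ennreal (\<rho> x) \<partial>condX y)" for y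
  define e where "e y = (\<integral>\<^sup>+x. ennreal (ent (\<rho> x)) \<partial>condX y)" for y
  have [measurable]: "h \<in> borel_measurable LY" "e \<in> borel_measurable LY"
    unfolding h_def e_def by measurable
  define hr where "hr y = enn2real (h y)" for y
  define er where "er y = enn2real (e y)" for y
  \<comment> \<open>\<open>K y\<close> is the conditional divergence, by the chain rule in the fibre
    over \<open>y\<close>. The division by \<open>t\<close> in \<psi> undoes the power
    \<open>t\<close> that Prekopa-Leindler takes.\<close>
  define K where "K y = (er y - ent (hr y)) / hr y" for y
  define \<psi> where "\<psi> y = (ln (hr y) - K y / l) / t" for y
  have [measurable]: "hr \<in> borel_measurable LY" "er \<in> borel_measurable LY"
    unfolding hr_def er_def by measurable
  have [measurable]: "\<psi> \<in> borel_measurable LY" unfolding \<psi>_def K_def by measurable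
  \<comment> \<open>A zero of \<open>h\<close> at one point would make \<rho> vanish almost
    everywhere, as \<open>P\<close> is positive throughout, and the total mass would be 0 instead of
    1.\<close>
  have h_pos: "0 < h y" if y: "y \<in> space LY" for y
  proof (rule ccontr)
    assume "\<not> 0 < h y"
    then have "(\<integral>\<^sup>+x. ennreal (P x y) * ennreal (\<rho> x) \<partial>LX) = 0"
      using nn_integral_condX_mult[OF y, of "\<lambda>x. ennreal (\<rho> x)"] by (simp add: h_def)
    moreover have "(\<lambda>x. ennreal (P x y) * ennreal (\<rho> x)) \<in> borel_measurable LX"
      using y by measurable
    ultimately have "AE x in LX. ennreal (P x y) * ennreal (\<rho> x) = 0"
      by (simp add: nn_integral_0_iff_AE)
    then have ae: "AE x in LX. ennreal (\<rho> x) = 0"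
      by (rule AE_mp) (rule AE_I2, use P_pos[of _ y] in \<open>auto simp: ennreal_eq_0_iff not_le less_imp_le not_less[symmetric]\<close>)
    have "ennreal (pY y') * h y' = 0" if y': "y' \<in> space LY" for y'
    proof -
      have "AE x in LX. ennreal (P x y') * ennreal (\<rho> x) = 0" using ae by eventually_elim simp
      then have "(\<integral>\<^sup>+x. ennreal (P x y') * ennreal (\<rho> x) \<partial>LX) = 0"
        by (subst nn_integral_cong_AE[where v = "\<lambda>_. 0"]) auto
      then show ?thesis
        using nn_integral_condX_mult[OF y', of "\<lambda>x. ennreal (\<rho> x)"] by (simp add: h_def)
    qed
    then have "(\<integral>\<^sup>+y. ennreal (pY y) * h y \<partial>LY) = (\<integral>\<^sup>+y. 0 \<partial>LY)"
      by (intro nn_integral_cong) simp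
    then show False using total by (simp add: h_def)
  qed
  have good: "h y = ennreal (hr y)" "0 < hr y" "e y = ennreal (er y)" "0 \<le> er y"
      "(\<integral>\<^sup>+x. ennreal (ent (\<rho> x / hr y)) \<partial>condX y) = ennreal (K y)" "0 \<le> K y"
    if y: "y \<in> space LY" "h y < \<top>" "e y < \<top>" for y
  proof -
    show 1: "h y = ennreal (hr y)" "0 < hr y" "e y = ennreal (er y)" "0 \<le> er y"
      using y h_pos[OF y(1)] by (auto simp: hr_def er_def enn2real_positive_iff)
    have "\<rho> \<in> borel_measurable (condX y)" by measurable
    from nn_integral_ent_scaled[OF prob_space_condX[OF y(1)] this \<rho> 1(1)[unfolded h_def] 1(2) 1(3)[unfolded e_def] 1(4)]
    show "(\<integral>\<^sup>+x. ennreal (ent (\<rho> x / hr y)) \<partial>condX y) = ennreal (K y)" "0 \<le> K y"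
      by (simp_all add: K_def)
  qed
  \<comment> \<open>The value 0 where \<open>h\<close> or \<open>e\<close> is infinite makes the
    pointwise hypothesis trivial there; these \<open>y\<close> turn out to form a null set.\<close>
  define u where "u p = (if h (snd p) < \<top> \<and> e (snd p) < \<top> then ennreal (P (fst p) (snd p) * exp (\<psi> (snd p))) else 0)" for p
  have [measurable]: "u \<in> borel_measurable (LX \<Otimes>\<^sub>M LY)" unfolding u_def by measurable
  have "epow (\<integral>\<^sup>+p. u p \<partial>(LX \<Otimes>\<^sub>M LY)) t * epow (\<integral>\<^sup>+p. ennreal (P (fst p) (snd p)) \<partial>(LX \<Otimes>\<^sub>M LY)) (1 - t)
      \<le> (\<integral>\<^sup>+p. ennreal (P (fst p) (snd p)) * h (snd p) \<partial>(LX \<Otimes>\<^sub>M LY))"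
  proof (rule prekopa_leindlerD[OF prekopa_leindler_pair[OF prekopa_leindler_blockM[OF t(1,2)]
          prekopa_leindler_blockM[OF t(1,2)] Y.sigma_finite_measure_axioms bcomb_in_space]])
    fix p q assume "p \<in> space (LX \<Otimes>\<^sub>M LY)" "q \<in> space (LX \<Otimes>\<^sub>M LY)"
    then obtain x y x' y' where pq: "p = (x, y)" "q = (x', y')" and y: "y \<in> space LY" "y' \<in> space LY"
      by (auto simp: space_pair_measure)
    let ?x = "bcomb n t x x'" and ?z = "bcomb m t y y'"
    have "epow (u (x, y)) t * epow (ennreal (P x' y')) (1 - t) \<le> ennreal (P ?x ?z) * h ?z"
    proof (cases "h y < \<top> \<and> e y < \<top>")
      case True
      then have yg: "h y < \<top>" "e y < \<top>" by auto
      note g = good[OF y(1) yg]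
      define M where "M = S y y' / (\<eta> * kF)"
      \<comment> \<open>\<open>?z\<close> lies at the fraction \<open>s\<close> of the way from
        \<open>y\<close> to \<open>y'\<close>, so the price of the tilt is quadratic in
        \<open>s\<close>.\<close>
      have Sz: "S y ?z = s\<^sup>2 * S y y'"
      proof -
        have "(norm (y j - ?z j))\<^sup>2 = s\<^sup>2 * (norm (y j - y' j))\<^sup>2" if "j < m" for j
        proof -
          have "y j - ?z j = s *\<^sub>R (y j - y' j)" using that by (simp add: t_def algebra_simps)
          then show ?thesis by (simp add: power_mult_distrib)
        qed
        then show ?thesis by (simp add: S_def sum_distrib_left mult_ac)
      qed
      have 1: "ennreal (hr y * exp (- K y / l - (1 + l) / 2 * (s\<^sup>2 * M))) \<le> h ?z"
        using tilt_bound[OF y(1) bcomb_in_space l \<rho>m \<rho> g(1)[unfolded h_def] g(2) g(5,6), of t y y']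
        by (simp add: h_def Sz M_def)
      have 2: "(P x y * exp (\<psi> y)) powr t * P x' y' powr (1 - t)
          \<le> P ?x ?z * (hr y * exp (- K y / l - (1 + l) / 2 * (s\<^sup>2 * M)))"
      proof -
        have P: "P a b = exp (- U a b - ln Z)" for a b
          using Z_pos by (simp add: P_def exp_diff)
        have "(P x y * exp (\<psi> y)) powr t * P x' y' powr (1 - t)
            = exp (t * (- U x y - ln Z + \<psi> y) + (1 - t) * (- U x' y' - ln Z))"
          unfolding P by (simp add: powr_def mult_exp_exp)
        also have "\<dots> \<le> exp ((- U ?x ?z - ln Z) + (ln (hr y) + (- K y / l - (1 + l) / 2 * (s\<^sup>2 * M))))"
        proof -
          have U: "U ?x ?z \<le> t * U x y + (1 - t) * U x' y' - t * s / 2 * ((kF * kG - 1) * M)"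
            using U_convex_joint[of t x x' y y'] t(1,2) by (simp add: M_def t(3))
          \<comment> \<open>Here \<open>ls\<close> identifies the price of the tilt with the
            convexity gain of the joint potential.\<close>
          have "(1 + l) / 2 * (s\<^sup>2 * M) = s / 2 * ((1 + l) * s) * M"
            by (simp add: power2_eq_square)
          also have "\<dots> = t * s / 2 * ((kF * kG - 1) * M)"
            unfolding ls t_def by simp
          finally have q: "(1 + l) / 2 * (s\<^sup>2 * M) = t * s / 2 * ((kF * kG - 1) * M)" .
          have tpsi: "t * \<psi> y = ln (hr y) - K y / l" using t by (simp add: \<psi>_def)
          have "t * (- U x y - ln Z + \<psi> y) + (1 - t) * (- U x' y' - ln Z)
              = - (t * U x y + (1 - t) * U x' y') - ln Z + t * \<psi> y"
            by (simp add: algebra_simps)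
          then show ?thesis using U unfolding q tpsi by simp
        qed
        also have "\<dots> = P ?x ?z * (hr y * exp (- K y / l - (1 + l) / 2 * (s\<^sup>2 * M)))"
          unfolding exp_add P using g(2) by simp
        finally show ?thesis .
      qed
      have "epow (u (x, y)) t * epow (ennreal (P x' y')) (1 - t) = ennreal ((P x y * exp (\<psi> y)) powr t * P x' y' powr (1 - t))"
        using True by (simp add: u_def epow_ennreal flip: ennreal_mult)
      also have "\<dots> \<le> ennreal (P ?x ?z) * ennreal (hr y * exp (- K y / l - (1 + l) / 2 * (s\<^sup>2 * M)))"
        using ennreal_leI[OF 2] g(2) by (simp only: ennreal_mult' P_nonneg)
      also have "\<dots> \<le> ennreal (P ?x ?z) * h ?z" using 1 by (intro mult_left_mono) auto
      finally show ?thesis .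
    qed (auto simp: u_def)
    then show "epow (u p) t * epow (ennreal (P (fst q) (snd q))) (1 - t)
        \<le> ennreal (P (fst (bcomb n t (fst p) (fst q), bcomb m t (snd p) (snd q)))
            (snd (bcomb n t (fst p) (fst q), bcomb m t (snd p) (snd q))))
          * h (snd (bcomb n t (fst p) (fst q), bcomb m t (snd p) (snd q)))"
      by (simp add: pq)
  qed measurable
  also have "(\<integral>\<^sup>+p. ennreal (P (fst p) (snd p)) * h (snd p) \<partial>(LX \<Otimes>\<^sub>M LY))
      = (\<integral>\<^sup>+y. (\<integral>\<^sup>+x. ennreal (P x y) * h y \<partial>LX) \<partial>LY)"
    by (subst nn_integral_XY) auto
  also have "\<dots> = (\<integral>\<^sup>+y. ennreal (pY y) * h y \<partial>LY)"
    by (intro nn_integral_cong) (simp add: nn_integral_multc nn_integral_P)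
  also have "\<dots> = 1" using total by (simp add: h_def)
  finally have "epow (\<integral>\<^sup>+p. u p \<partial>(LX \<Otimes>\<^sub>M LY)) t \<le> 1" by (simp add: P_total)
  then have "epow (epow (\<integral>\<^sup>+p. u p \<partial>(LX \<Otimes>\<^sub>M LY)) t) (1 / t) \<le> epow 1 (1 / t)"
    using t by (intro epow_mono) auto
  then have "(\<integral>\<^sup>+p. u p \<partial>(LX \<Otimes>\<^sub>M LY)) \<le> 1" using t by (simp add: epow_epow)
  also have "(\<integral>\<^sup>+p. u p \<partial>(LX \<Otimes>\<^sub>M LY)) = (\<integral>\<^sup>+y. (\<integral>\<^sup>+x. u (x, y) \<partial>LX) \<partial>LY)"
    by (rule nn_integral_XY) measurable
  also have "\<dots> = (\<integral>\<^sup>+y. (if h y < \<top> \<and> e y < \<top> then ennreal (pY y * exp (\<psi> y)) else 0) \<partial>LY)"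
    by (intro nn_integral_cong) (auto simp: u_def ennreal_mult nn_integral_multc nn_integral_P pY_pos less_imp_le)
  finally have psi_le: "(\<integral>\<^sup>+y. (if h y < \<top> \<and> e y < \<top> then ennreal (pY y * exp (\<psi> y)) else 0) \<partial>LY) \<le> 1" .

  have ae: "AE y in LY. h y < \<top> \<and> e y < \<top>"
  proof -
    have "AE y in LY. ennreal (pY y) * h y \<noteq> \<infinity>"
      using total by (intro nn_integral_noteq_infinite) (auto simp: h_def)
    moreover have "AE y in LY. ennreal (pY y) * e y \<noteq> \<infinity>"
      using fin by (intro nn_integral_noteq_infinite) (auto simp: e_def)
    ultimately show ?thesis
      using AE_space
    proof eventually_elim
      case (elim y)
      then show ?case using pY_pos[of y] by (auto simp: less_top[symmetric] ennreal_mult_eq_top_iff)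
    qed
  qed
  let ?HY = "\<integral>\<^sup>+y. ennreal (pY y * ent (hr y)) \<partial>LY"
  let ?HX = "\<integral>\<^sup>+y. ennreal (pY y) * e y \<partial>LY"
  let ?E = "\<lambda>y. if h y < \<top> \<and> e y < \<top> then ennreal (pY y * exp (\<psi> y)) else 0"
  define c where "c = s + 1 / l"
  have cancel: "a \<le> b" if "a + 1 \<le> b + ennreal 1" for a b :: ennreal
    using that by (simp add: add.commute[of _ 1] ennreal_add_left_cancel_le)
  have [measurable]: "?E \<in> borel_measurable LY" by measurable
  \<comment> \<open>The mass 1 of \<open>h\<close> is added on the left; on the right it is matched
    by \<open>t + s = 1\<close>. All terms stay nonnegative and the 1 is cancelled at the
    end.\<close>
  have "ennreal c * ?HY + 1 = (\<integral>\<^sup>+y. ennreal c * ennreal (pY y * ent (hr y)) + ennreal (pY y) * h y \<partial>LY)"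
  proof -
    have "(\<integral>\<^sup>+y. ennreal c * ennreal (pY y * ent (hr y)) + ennreal (pY y) * h y \<partial>LY)
        = (\<integral>\<^sup>+y. ennreal c * ennreal (pY y * ent (hr y)) \<partial>LY) + (\<integral>\<^sup>+y. ennreal (pY y) * h y \<partial>LY)"
      by (rule nn_integral_add) measurable
    also have "(\<integral>\<^sup>+y. ennreal c * ennreal (pY y * ent (hr y)) \<partial>LY) = ennreal c * ?HY"
      by (rule nn_integral_cmult) measurable
    also have "(\<integral>\<^sup>+y. ennreal (pY y) * h y \<partial>LY) = 1" using total by (simp add: h_def)
    finally show ?thesis ..
  qed
  also have "\<dots> \<le> (\<integral>\<^sup>+y. ennreal t * ?E y + ennreal (1 / l) * (ennreal (pY y) * e y) + ennreal s * ennreal (pY y) \<partial>LY)"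
  proof (rule nn_integral_mono_AE)
    show "AE y in LY. ennreal c * ennreal (pY y * ent (hr y)) + ennreal (pY y) * h y
        \<le> ennreal t * ?E y + ennreal (1 / l) * (ennreal (pY y) * e y) + ennreal s * ennreal (pY y)"
      using ae AE_space
    proof eventually_elim
      case (elim y)
      then have yg: "h y < \<top>" "e y < \<top>" by auto
      note g = good[OF elim(2) yg]
      have p: "0 < pY y" using elim pY_pos by auto
      \<comment> \<open>Pointwise form of the Gibbs variational principle for \<open>hr y\<close>
        against \<open>exp (\<psi> y)\<close>. The tangent bound stands in for Jensen's inequality,
        so the signed function \<open>hr y * \<psi> y\<close> is never integrated.\<close>
      have "hr y * (1 + (\<psi> y - ln (hr y))) \<le> hr y * exp (\<psi> y - ln (hr y))"
        using g(2) by (intro mult_left_mono exp_ge_add_one_self) auto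
      also have "\<dots> = exp (\<psi> y)" using g(2) by (simp add: exp_diff)
      finally have "t * (hr y * (1 + (\<psi> y - ln (hr y)))) \<le> t * exp (\<psi> y)"
        using t by (intro mult_left_mono) auto
      also have "t * (hr y * (1 + (\<psi> y - ln (hr y)))) = t * hr y + hr y * (t * \<psi> y) - t * (hr y * ln (hr y))"
        by (simp add: algebra_simps)
      also have "hr y * (t * \<psi> y) = hr y * ln (hr y) - (er y / l - ent (hr y) / l)"
      proof -
        have "t * \<psi> y = ln (hr y) - K y / l" using t by (simp add: \<psi>_def)
        moreover have "hr y * K y = er y - ent (hr y)" using g(2) by (simp add: K_def)
        ultimately show ?thesis by (simp add: right_diff_distrib diff_divide_distrib)
      qed
      finally have a1: "t * hr y + (hr y * ln (hr y) - (er y / l - ent (hr y) / l)) - t * (hr y * ln (hr y))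
          \<le> t * exp (\<psi> y)" .
      have a2: "c * ent (hr y) = s * ent (hr y) + ent (hr y) / l"
        by (simp add: c_def distrib_right)
      have a3: "s * ent (hr y) = hr y * ln (hr y) - t * (hr y * ln (hr y)) - hr y + t * hr y + s"
        by (simp add: ent_def t_def algebra_simps)
      have "c * ent (hr y) + hr y \<le> t * exp (\<psi> y) + er y / l + s"
        using a1 unfolding a2 a3 by simp
      then have "pY y * (c * ent (hr y) + hr y) \<le> pY y * (t * exp (\<psi> y) + er y / l + s)"
        using p by (intro mult_left_mono) auto
      also have "\<dots> = t * (pY y * exp (\<psi> y)) + 1 / l * (pY y * er y) + s * pY y"
        by (simp add: algebra_simps)
      also have "pY y * (c * ent (hr y) + hr y) = c * (pY y * ent (hr y)) + pY y * hr y"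
        by (simp add: algebra_simps)
      finally have "ennreal (c * (pY y * ent (hr y)) + pY y * hr y)
          \<le> ennreal (t * (pY y * exp (\<psi> y)) + 1 / l * (pY y * er y) + s * pY y)"
        by (rule ennreal_leI)
      moreover have nn: "0 \<le> ent (hr y)" "0 \<le> pY y" "0 \<le> hr y" "0 \<le> c" "0 \<le> t" "0 \<le> s" "0 \<le> 1 / l"
        using g(2) p t s l by (auto simp: c_def intro: ent_nonneg)
      moreover have "ennreal (c * (pY y * ent (hr y)) + pY y * hr y)
          = ennreal c * ennreal (pY y * ent (hr y)) + ennreal (pY y) * h y"
        unfolding g(1) using nn by (simp only: ennreal_plus ennreal_mult mult_nonneg_nonneg)
      moreover have "ennreal (t * (pY y * exp (\<psi> y)) + 1 / l * (pY y * er y) + s * pY y)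
          = ennreal t * ?E y + ennreal (1 / l) * (ennreal (pY y) * e y) + ennreal s * ennreal (pY y)"
      proof -
        have E: "?E y = ennreal (pY y * exp (\<psi> y))" using yg by simp
        show ?thesis
          unfolding E unfolding g(3) using nn g(4)
          by (simp only: ennreal_plus ennreal_mult mult_nonneg_nonneg add_nonneg_nonneg exp_ge_zero)
      qed
      ultimately show ?case by (simp only:)
    qed
  qed
  also have "\<dots> = ennreal t * (\<integral>\<^sup>+y. ?E y \<partial>LY) + ennreal (1 / l) * ?HX + ennreal s"
  proof -
    have "(\<integral>\<^sup>+y. ennreal t * ?E y + ennreal (1 / l) * (ennreal (pY y) * e y) + ennreal s * ennreal (pY y) \<partial>LY)
        = (\<integral>\<^sup>+y. ennreal t * ?E y + ennreal (1 / l) * (ennreal (pY y) * e y) \<partial>LY) + (\<integral>\<^sup>+y. ennreal s * ennreal (pY y) \<partial>LY)"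
      by (rule nn_integral_add) measurable
    also have "(\<integral>\<^sup>+y. ennreal t * ?E y + ennreal (1 / l) * (ennreal (pY y) * e y) \<partial>LY)
        = (\<integral>\<^sup>+y. ennreal t * ?E y \<partial>LY) + (\<integral>\<^sup>+y. ennreal (1 / l) * (ennreal (pY y) * e y) \<partial>LY)"
      by (rule nn_integral_add) measurable
    also have "(\<integral>\<^sup>+y. ennreal t * ?E y \<partial>LY) = ennreal t * (\<integral>\<^sup>+y. ?E y \<partial>LY)"
      by (rule nn_integral_cmult) measurable
    also have "(\<integral>\<^sup>+y. ennreal (1 / l) * (ennreal (pY y) * e y) \<partial>LY) = ennreal (1 / l) * ?HX"
      by (rule nn_integral_cmult) measurable
    also have "(\<integral>\<^sup>+y. ennreal s * ennreal (pY y) \<partial>LY) = ennreal s * (\<integral>\<^sup>+y. ennreal (pY y) \<partial>LY)"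
      by (rule nn_integral_cmult) measurable
    finally show ?thesis by (simp only: nn_integral_pY mult_1_right)
  qed
  also have "\<dots> \<le> ennreal t * 1 + ennreal (1 / l) * ?HX + ennreal s"
    using psi_le by (intro add_mono mult_left_mono) auto
  also have "\<dots> = ennreal (1 / l) * ?HX + (ennreal t + ennreal s)"
    by (simp only: mult_1_right add.assoc add.commute[of "ennreal t"] add.left_commute[of "ennreal t"])
  also have "ennreal t + ennreal s = ennreal (t + s)"
    using t s by (intro ennreal_plus[symmetric]) auto
  also have "t + s = 1" by (simp add: t_def)
  finally have "ennreal c * ?HY \<le> ennreal (1 / l) * ?HX"
    by (rule cancel)
  then have "ennreal l * (ennreal c * ?HY) \<le> ennreal l * (ennreal (1 / l) * ?HX)"
    by (intro mult_left_mono) auto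
  moreover have "ennreal l * (ennreal (1 / l) * ?HX) = ?HX"
  proof -
    have "ennreal l * ennreal (1 / l) = 1" using l by (simp flip: ennreal_mult)
    then show ?thesis by (simp only: mult.assoc[symmetric] mult_1_left)
  qed
  moreover have "ennreal l * (ennreal c * ?HY) = ennreal ((1 - s) * (kF * kG)) * ?HY"
  proof -
    have "l * c = (1 + l) * s + (1 - s)" using l by (simp add: c_def field_simps)
    also have "\<dots> = (1 - s) * (kF * kG)" unfolding ls by (simp add: algebra_simps)
    finally have "ennreal l * ennreal c = ennreal ((1 - s) * (kF * kG))"
      using l s by (subst ennreal_mult[symmetric]) (auto simp: c_def)
    then show ?thesis by (simp only: mult.assoc[symmetric])
  qed
  ultimately show ?thesis by (simp only: hr_def h_def e_def)
qed

text \<open>Every \<open>t = 1 - s\<close> with \<open>t * k > 1\<close> is admissible, and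
  \<open>t\<close> may tend to 1. The limit is taken between real numbers, so one admissible
  \<open>t0\<close> is used beforehand to see that the left entropy is finite.\<close>

lemma half_step:
  assumes "\<rho> \<in> borel_measurable LX" "\<And>x. 0 \<le> \<rho> x"
    and "(\<integral>\<^sup>+y. ennreal (pY y) * (\<integral>\<^sup>+x. ennreal (\<rho> x) \<partial>condX y) \<partial>LY) = 1"
  shows "ennreal (kF * kG) * (\<integral>\<^sup>+y. ennreal (pY y * ent (enn2real (\<integral>\<^sup>+x. ennreal (\<rho> x) \<partial>condX y))) \<partial>LY)
      \<le> (\<integral>\<^sup>+y. ennreal (pY y) * (\<integral>\<^sup>+x. ennreal (ent (\<rho> x)) \<partial>condX y) \<partial>LY)"
    (is "_ * ?HY \<le> ?HX")
proof (cases "?HX = \<top>")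
  case False
  define k where "k = kF * kG"
  have k: "1 < k" using kF kG unfolding k_def by (simp add: less_1_mult)
  have step: "ennreal (t * k) * ?HY \<le> ?HX" if t: "1 / k < t" "t < 1" for t
  proof -
    define s where "s = 1 - t"
    have "0 < 1 / k" using k by simp
    then have s: "0 < s" "s < 1" using t unfolding s_def by linarith+
    have "1 < t * k" using t k by (simp add: divide_less_eq)
    then have "s < t * (k - 1)" unfolding s_def right_diff_distrib by linarith
    \<comment> \<open>Solution of the balance equation for \<open>l\<close>; it is positive because
      \<open>t * k > 1\<close>.\<close>
    define l where "l = t * (k - 1) / s - 1"
    have l: "0 < l" using s \<open>s < t * (k - 1)\<close> by (simp add: l_def)
    have "(1 + l) * s = t * (k - 1)" using s by (simp add: l_def)
    then have ls: "(1 + l) * s = (1 - s) * (kF * kG - 1)" unfolding k_def by (simp add: s_def)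
    have "(1 - s) * (kF * kG) = t * k" by (simp add: s_def k_def)
    with half_step_aux[OF assms False s l ls] show ?thesis by (simp only:)
  qed
  obtain t0 where t0: "1 / k < t0" "t0 < 1" using k dense[of "1 / k" 1] by auto
  then have "1 < t0 * k" using k by (simp add: divide_less_eq)
  then have "0 < t0 * k" by linarith
  have "x \<noteq> \<top>" if "ennreal c * x \<le> z" "z \<noteq> \<top>" "0 < c" for x z :: ennreal and c
    using that by (auto simp: ennreal_mult_top top_unique)
  from this[OF step[OF t0] False \<open>0 < t0 * k\<close>] have "?HY \<noteq> \<top>" .
  then obtain b where b: "?HY = ennreal b" "0 \<le> b" by (cases ?HY) auto
  obtain a where a: "?HX = ennreal a" "0 \<le> a" using False by (cases ?HX) auto
  note ab = a b
  have "k * b \<le> a"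
  proof (rule field_le_mult_one_interval)
    fix z :: real assume z: "0 < z" "z < 1"
    \<comment> \<open>The limit rule asks for every \<open>z\<close> in \<open>(0, 1)\<close>; small
      values are raised to the admissible \<open>t0\<close>.\<close>
    define t where "t = max z t0"
    have t: "1 / k < t" "t < 1" "z \<le> t" using z t0 by (auto simp: t_def)
    then have "0 < t" using z by simp
    have "ennreal (t * k * b) \<le> ennreal a"
      using step[OF t(1,2)] k \<open>0 < t\<close> b(2) unfolding a(1) b(1) by (subst ennreal_mult) auto
    then have "t * (k * b) \<le> a" using ab by (simp add: ennreal_le_iff mult.assoc)
    moreover have "z * (k * b) \<le> t * (k * b)" using t k ab by (intro mult_right_mono) auto
    ultimately show "z * (k * b) \<le> a" by simp
  qed
  then have "ennreal (k * b) \<le> ennreal a" by (rule ennreal_leI)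
  then show ?thesis using k b(2) unfolding k_def[symmetric] a(1) b(1) by (subst ennreal_mult[symmetric]) auto
qed simp

subsection \<open>The blocked Gibbs sampler\<close>

lemma target_eq: "target n m \<eta> \<sigma> f g = density (LX \<Otimes>\<^sub>M LY) (\<lambda>p. ennreal (P (fst p) (snd p)))"
proof -
  have "(\<lambda>(x, y). (\<Sum>i<n. f i (x i)) + (\<Sum>j<m. g j (y j))
        + (\<Sum>i<n. \<Sum>j<m. \<sigma> i j / (2 * \<eta>) * (norm (x i - y j))\<^sup>2)) = (\<lambda>p. U (fst p) (snd p))"
    by (auto simp: U_def)
  then show ?thesis
    using Z_pos by (simp add: target_def gibbs_def nn_integral_exp_U P_def divide_ennreal)
qed

text \<open>For fixed \<open>y\<close> the potential is a sum of functions of the single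
  \<open>x i\<close> plus a constant, so the conditional density factorises into the independent
  draws. The normalising constants agree by Fubini.\<close>

lemma kernelX_eq:
  assumes y: "y \<in> space LY"
  shows "kernelX n m \<eta> \<sigma> f y = condX y"
proof -
  define W where "W i xi = f i xi + (\<Sum>j<m. \<sigma> i j / (2 * \<eta>) * (norm (xi - y j))\<^sup>2)" for i xi
  have Wm: "W i \<in> borel_measurable borel" if "i < n" for i
    unfolding W_def using f_measurable[OF that] by measurable
  define C where "C i = enn2real (\<integral>\<^sup>+x. ennreal (exp (- W i x)) \<partial>lborel)" for i
  have C: "(\<integral>\<^sup>+x. ennreal (exp (- W i x)) \<partial>lborel) = ennreal (C i)" "0 < C i" if i: "i < n" for i
  proof -
    let ?I = "\<integral>\<^sup>+x. ennreal (exp (- W i x)) \<partial>lborel"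
    have "?I \<le> (\<integral>\<^sup>+x. ennreal (exp (- f i x)) \<partial>lborel)"
    proof (intro nn_integral_mono ennreal_leI)
      fix x
      have "0 \<le> (\<Sum>j<m. \<sigma> i j / (2 * \<eta>) * (norm (x - y j))\<^sup>2)"
        using sig eta i by (intro sum_nonneg mult_nonneg_nonneg) auto
      then show "exp (- W i x) \<le> exp (- f i x)" by (simp add: W_def)
    qed
    also have "\<dots> < \<top>" using f[OF i] strongly_convex_integrable by blast
    finally have fin: "?I < \<top>" .
    then show "?I = ennreal (C i)" by (simp add: C_def)
    have "?I \<noteq> 0"
    proof
      assume "?I = 0"
      then have "AE x in (lborel :: 'a measure). ennreal (exp (- W i x)) = 0"
        using Wm[OF i] by (subst (asm) nn_integral_0_iff_AE) auto
      then have "AE x in (lborel :: 'a measure). False" by eventually_elim simp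
      then have "emeasure (lborel :: 'a measure) (space lborel) = 0"
        by (metis ae_filter_eq_bot_iff eventually_False)
      then show False by simp
    qed
    then show "0 < C i" using fin by (simp add: C_def enn2real_positive_iff zero_less_iff_neq_zero)
  qed
  have gibbs: "gibbs lborel (W i) = density lborel (\<lambda>x. ennreal (exp (- W i x) / C i))" if "i < n" for i
    using C[OF that] by (simp add: gibbs_def divide_ennreal)
  have prob: "prob_space (density lborel (\<lambda>x. ennreal (exp (- W i x) / C i)))" if i: "i < n" for i
  proof
    have "ennreal (exp (- W i x) / C i) = ennreal (1 / C i) * ennreal (exp (- W i x))" for x
      using C[OF i] by (simp flip: ennreal_mult)
    then have "(\<integral>\<^sup>+x. ennreal (exp (- W i x) / C i) \<partial>lborel) = ennreal (1 / C i) * (\<integral>\<^sup>+x. ennreal (exp (- W i x)) \<partial>lborel)"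
      by (simp only:) (rule nn_integral_cmult, use Wm[OF i] in measurable)
    also have "\<dots> = 1" using C[OF i] by (simp flip: ennreal_mult)
    finally show "emeasure (density lborel (\<lambda>x. ennreal (exp (- W i x) / C i)))
        (space (density lborel (\<lambda>x. ennreal (exp (- W i x) / C i)))) = 1"
      using Wm[OF i] by (simp add: emeasure_density)
  qed
  have "kernelX n m \<eta> \<sigma> f y = PiM {..<n} (\<lambda>i. density lborel (\<lambda>x. ennreal (exp (- W i x) / C i)))"
    unfolding kernelX_def W_def[symmetric] using gibbs by (intro PiM_cong) auto
  also have "\<dots> = density LX (\<lambda>x. \<Prod>i<n. ennreal (exp (- W i (x i)) / C i))"
    unfolding blockM_def
    using Wm prob by (intro PiM_density) (auto intro: sigma_finite_lborel prob_space_imp_sigma_finite)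
  also have "\<dots> = condX y"
    unfolding condX_def
  proof (intro arg_cong[where f = "density LX"] ext)
    fix x
    have UW: "U x y = (\<Sum>i<n. W i (x i)) + (\<Sum>j<m. g j (y j))" for x
      by (simp add: U_def W_def sum.distrib)
    define c where "c = exp (- (\<Sum>j<m. g j (y j))) / Z"
    have c: "0 < c" using Z_pos by (simp add: c_def)
    have P: "P x y = c * (\<Prod>i<n. exp (- W i (x i)))" for x
      by (simp add: P_def UW exp_add exp_diff exp_minus exp_sum c_def field_simps prod_inversef prod_dividef)
    have C0: "0 < (\<Prod>i<n. C i)" using C by (intro prod_pos) auto
    have "ennreal (pY y) = (\<integral>\<^sup>+x. ennreal c * (\<Prod>i<n. ennreal (exp (- W i (x i)))) \<partial>LX)"
      unfolding nn_integral_P[OF y, symmetric] P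
      using c by (intro nn_integral_cong) (simp add: ennreal_mult prod_nonneg prod_ennreal)
    also have "\<dots> = ennreal c * (\<Prod>i<n. \<integral>\<^sup>+x. ennreal (exp (- W i x)) \<partial>lborel)"
    proof -
      have [measurable]: "(\<lambda>x. \<Prod>i<n. ennreal (exp (- W i (x i)))) \<in> borel_measurable LX"
        using Wm by (intro borel_measurable_prod_ennreal measurable_compose[OF component_blockM_measurable]) auto
      show ?thesis using Wm nn_integral_prod_blockM[of n "\<lambda>i x. ennreal (exp (- W i x))"]
        by (subst nn_integral_cmult) auto
    qed
    also have "(\<Prod>i<n. \<integral>\<^sup>+x. ennreal (exp (- W i x)) \<partial>lborel) = (\<Prod>i<n. ennreal (C i))"
      using C by (intro prod.cong) auto
    also have "\<dots> = ennreal (\<Prod>i<n. C i)" using C by (intro prod_ennreal) (auto intro: less_imp_le)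
    finally have "pY y = c * (\<Prod>i<n. C i)"
      using c C0 pY_pos[OF y] by (simp flip: ennreal_mult)
    then have "P x y / pY y = (\<Prod>i<n. exp (- W i (x i)) / C i)"
      using c by (simp add: P prod_dividef)
    then show "(\<Prod>i<n. ennreal (exp (- W i (x i)) / C i)) = ennreal (P x y / pY y)"
      using C(2) by (simp only:) (rule prod_ennreal, simp add: less_imp_le)
  qed
  finally show ?thesis .
qed

lemma condX_kernel [measurable]: "condX \<in> measurable LY (subprob_algebra LX)"
proof (rule measurable_subprob_algebra)
  show "subprob_space (condX y)" if "y \<in> space LY" for y
    using prob_space_condX[OF that] by (rule prob_space_imp_subprob_space)
  show "sets (condX y) = sets LX" for y by simp
  fix A assume [measurable]: "A \<in> sets LX"
  have "(\<lambda>y. \<integral>\<^sup>+x. indicator A x \<partial>condX y) \<in> borel_measurable LY" by measurable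
  then show "(\<lambda>y. emeasure (condX y) A) \<in> borel_measurable LY" by simp
qed

section \<open>Exchanging the roles of X and Y\<close>

lemma swap_model: "gibbs_model m n \<eta> (\<lambda>j i. \<sigma> i j) g f ag af"
  by unfold_locales (use n m eta f g sig in auto)

text \<open>In the swapped model \<open>SW.pY\<close> is the density of the
  \<open>X\<close>-marginal and \<open>SW.condX x\<close> the conditional law of \<open>Y\<close>
  given \<open>x\<close>.\<close>

interpretation SW: gibbs_model m n \<eta> "\<lambda>j i. \<sigma> i j" g f ag af
  by (rule swap_model)

lemma swap_U: "SW.U y x = U x y"
  unfolding SW.U_def U_def by (subst sum.swap) (simp add: norm_minus_commute)

lemma swap_Z: "SW.Z = Z"
proof -
  have "ennreal SW.Z = ennreal Z"
  proof -
    have "ennreal SW.Z = (\<integral>\<^sup>+x. \<integral>\<^sup>+y. ennreal (exp (- U x y)) \<partial>LY \<partial>LX)"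
      unfolding SW.nn_integral_exp_U[symmetric] swap_U by (subst SW.nn_integral_XY) auto
    also have "\<dots> = ennreal Z"
      unfolding nn_integral_exp_U[symmetric] by (subst Y.nn_integral_fst[symmetric]) auto
    finally show ?thesis .
  qed
  then show ?thesis using Z_pos SW.Z_pos by simp
qed

lemma swap_P: "SW.P y x = P x y"
  by (simp add: SW.P_def P_def swap_U swap_Z)

lemma swap_k: "SW.kF = kG" "SW.kG = kF"
  by (simp_all add: SW.kF_def SW.kG_def kF_def kG_def)

lemma disintegrate:
  assumes [measurable]: "F \<in> borel_measurable LX"
  shows "(\<integral>\<^sup>+y. ennreal (pY y) * (\<integral>\<^sup>+x. F x \<partial>condX y) \<partial>LY) = (\<integral>\<^sup>+x. ennreal (SW.pY x) * F x \<partial>LX)"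
proof -
  have "(\<integral>\<^sup>+y. ennreal (pY y) * (\<integral>\<^sup>+x. F x \<partial>condX y) \<partial>LY) = (\<integral>\<^sup>+y. (\<integral>\<^sup>+x. ennreal (P x y) * F x \<partial>LX) \<partial>LY)"
    by (intro nn_integral_cong) (simp add: nn_integral_condX_mult)
  also have "\<dots> = (\<integral>\<^sup>+x. (\<integral>\<^sup>+y. ennreal (P x y) * F x \<partial>LY) \<partial>LX)"
    by (rule XY.Fubini') measurable
  also have "\<dots> = (\<integral>\<^sup>+x. ennreal (SW.pY x) * F x \<partial>LX)"
  proof (rule nn_integral_cong)
    fix x assume [measurable]: "x \<in> space LX"
    then show "(\<integral>\<^sup>+y. ennreal (P x y) * F x \<partial>LY) = ennreal (SW.pY x) * F x"
      by (subst nn_integral_multc) (auto simp: SW.nn_integral_P[unfolded swap_P])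
  qed
  finally show ?thesis .
qed

text \<open>A Radon-Nikodym density may be infinite on a null set, whereas \<open>ent\<close> takes
  real arguments. Passing to real values keeps the averages at every single \<open>y\<close>, since
  each \<open>condX y\<close> has a density with respect to \<open>LX\<close>.\<close>

lemma half_step_ennreal:
  assumes [measurable]: "r \<in> borel_measurable LX" and r: "(\<integral>\<^sup>+x. ennreal (SW.pY x) * r x \<partial>LX) = 1"
  shows "(\<integral>\<^sup>+y. ennreal (pY y) * (\<integral>\<^sup>+x. r x \<partial>condX y) \<partial>LY) = 1"
    and "ennreal (kF * kG) * (\<integral>\<^sup>+y. ennreal (pY y) * ennreal (ent (enn2real (\<integral>\<^sup>+x. r x \<partial>condX y))) \<partial>LY)
      \<le> (\<integral>\<^sup>+x. ennreal (SW.pY x) * ennreal (ent (enn2real (r x))) \<partial>LX)"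
proof -
  show total: "(\<integral>\<^sup>+y. ennreal (pY y) * (\<integral>\<^sup>+x. r x \<partial>condX y) \<partial>LY) = 1"
    by (simp add: disintegrate r)
  define \<rho> where "\<rho> x = enn2real (r x)" for x
  have [measurable]: "\<rho> \<in> borel_measurable LX" unfolding \<rho>_def by measurable
  have "AE x in LX. ennreal (SW.pY x) * r x \<noteq> \<infinity>"
    using r by (intro nn_integral_noteq_infinite) auto
  then have ae: "AE x in LX. ennreal (\<rho> x) = r x"
    using AE_space
    by eventually_elim (use SW.pY_pos in \<open>fastforce simp: \<rho>_def less_top ennreal_mult_eq_top_iff\<close>)
  have eq: "(\<integral>\<^sup>+x. ennreal (\<rho> x) \<partial>condX y) = (\<integral>\<^sup>+x. r x \<partial>condX y)" if y: "y \<in> space LY" for y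
    unfolding nn_integral_condX[OF y] using ae y
    by (subst (1 2) nn_integral_condX) (auto intro!: nn_integral_cong_AE elim!: eventually_mono)
  have "(\<integral>\<^sup>+y. ennreal (pY y) * (\<integral>\<^sup>+x. ennreal (\<rho> x) \<partial>condX y) \<partial>LY) = 1"
    using total by (simp add: eq cong: nn_integral_cong)
  from half_step[OF _ _ this]
  have "ennreal (kF * kG) * (\<integral>\<^sup>+y. ennreal (pY y * ent (enn2real (\<integral>\<^sup>+x. ennreal (\<rho> x) \<partial>condX y))) \<partial>LY)
      \<le> (\<integral>\<^sup>+y. ennreal (pY y) * (\<integral>\<^sup>+x. ennreal (ent (\<rho> x)) \<partial>condX y) \<partial>LY)"
    by (simp add: \<rho>_def)
  also have "(\<integral>\<^sup>+y. ennreal (pY y * ent (enn2real (\<integral>\<^sup>+x. ennreal (\<rho> x) \<partial>condX y))) \<partial>LY)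
      = (\<integral>\<^sup>+y. ennreal (pY y) * ennreal (ent (enn2real (\<integral>\<^sup>+x. r x \<partial>condX y))) \<partial>LY)"
    by (intro nn_integral_cong) (simp add: eq ennreal_mult' pY_pos less_imp_le)
  also have "(\<integral>\<^sup>+y. ennreal (pY y) * (\<integral>\<^sup>+x. ennreal (ent (\<rho> x)) \<partial>condX y) \<partial>LY)
      = (\<integral>\<^sup>+x. ennreal (SW.pY x) * ennreal (ent (enn2real (r x))) \<partial>LX)"
    by (subst disintegrate) (auto simp: \<rho>_def)
  finally show "ennreal (kF * kG) * (\<integral>\<^sup>+y. ennreal (pY y) * ennreal (ent (enn2real (\<integral>\<^sup>+x. r x \<partial>condX y))) \<partial>LY)
      \<le> (\<integral>\<^sup>+x. ennreal (SW.pY x) * ennreal (ent (enn2real (r x))) \<partial>LX)" .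
qed

end

context gibbs_model
begin

text \<open>Interpreting again makes \<open>half_step_ennreal\<close> available for the swapped model as well.\<close>

interpretation SW: gibbs_model m n \<eta> "\<lambda>j i. \<sigma> i j" g f ag af
  by (rule swap_model)

section \<open>Laws along the chain\<close>

lemma target_marginal:
  "distr (target n m \<eta> \<sigma> f g) LX fst = density LX (\<lambda>x. ennreal (SW.pY x))"
proof (rule measure_eqI)
  fix A assume "A \<in> sets (distr (target n m \<eta> \<sigma> f g) LX fst)"
  then have A [measurable]: "A \<in> sets LX" by simp
  have "emeasure (distr (target n m \<eta> \<sigma> f g) LX fst) A = (\<integral>\<^sup>+x. indicator A x \<partial>distr (target n m \<eta> \<sigma> f g) LX fst)"
    by simp
  also have "\<dots> = (\<integral>\<^sup>+p. ennreal (P (fst p) (snd p)) * indicator A (fst p) \<partial>(LX \<Otimes>\<^sub>M LY))"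
    unfolding target_eq by (subst nn_integral_distr) (auto simp: nn_integral_density)
  also have "\<dots> = (\<integral>\<^sup>+x. (\<integral>\<^sup>+y. ennreal (P x y) * indicator A x \<partial>LY) \<partial>LX)"
    by (subst Y.nn_integral_fst[symmetric]) auto
  also have "\<dots> = (\<integral>\<^sup>+x. ennreal (SW.pY x) * indicator A x \<partial>LX)"
  proof (rule nn_integral_cong)
    fix x assume [measurable]: "x \<in> space LX"
    then show "(\<integral>\<^sup>+y. ennreal (P x y) * indicator A x \<partial>LY) = ennreal (SW.pY x) * indicator A x"
      by (subst nn_integral_multc) (auto simp: SW.nn_integral_P[unfolded swap_P])
  qed
  also have "\<dots> = emeasure (density LX (\<lambda>x. ennreal (SW.pY x))) A"
    by (rule emeasure_density[symmetric]) auto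
  finally show "emeasure (distr (target n m \<eta> \<sigma> f g) LX fst) A = emeasure (density LX (\<lambda>x. ennreal (SW.pY x))) A" .
qed simp

lemma kernelY_eq:
  assumes "x \<in> space LX" shows "kernelY n m \<eta> \<sigma> g x = SW.condX x"
  using SW.kernelX_eq[OF assms] by (simp add: kernelX_def kernelY_def norm_minus_commute)

lemma space_blockM_nonempty: "space LX \<noteq> {}" "space (LX \<Otimes>\<^sub>M LY) \<noteq> {}"
  by (auto simp: space_pair_measure space_blockM intro!: exI[of _ "\<lambda>_. undefined"])

text \<open>The exact conditional draw of \<open>Y\<close> multiplies the marginal density of
  \<open>X\<close> up to the joint density and leaves the relative density \<open>r\<close> a
  function of \<open>x\<close> alone.\<close>

lemma bind_kernelY:
  assumes [measurable]: "r \<in> borel_measurable LX"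
  shows "bind (density LX (\<lambda>x. ennreal (SW.pY x) * r x)) (\<lambda>x. distr (kernelY n m \<eta> \<sigma> g x) (LX \<Otimes>\<^sub>M LY) (\<lambda>y. (x, y)))
      = density (LX \<Otimes>\<^sub>M LY) (\<lambda>p. ennreal (P (fst p) (snd p)) * r (fst p))" (is "bind ?\<mu> ?k = ?R")
proof -
  \<comment> \<open>The sampler's kernel is replaced by one built from \<open>SW.condX\<close>, with
    which it agrees on the space of \<open>LX\<close>; in this form its measurability is
    known.\<close>
  define \<kappa> where "\<kappa> x = distr (SW.condX x) (LX \<Otimes>\<^sub>M LY) (\<lambda>y. (x, y))" for x
  have [measurable]: "\<kappa> \<in> measurable LX (subprob_algebra (LX \<Otimes>\<^sub>M LY))"
    unfolding \<kappa>_def by (rule measurable_distr2[where M = LY]) auto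
  have ne: "space ?\<mu> \<noteq> {}" using space_blockM_nonempty by simp
  have "bind ?\<mu> ?k = bind ?\<mu> \<kappa>"
    by (intro bind_cong refl) (simp add: \<kappa>_def kernelY_eq)
  also have "\<dots> = ?R"
  proof (rule measure_eqI)
    show sets: "sets (bind ?\<mu> \<kappa>) = sets ?R"
      using ne by (subst sets_bind[where N = "LX \<Otimes>\<^sub>M LY"]) (auto simp: \<kappa>_def)
    fix A assume "A \<in> sets (bind ?\<mu> \<kappa>)"
    then have A [measurable]: "A \<in> sets (LX \<Otimes>\<^sub>M LY)" by (simp add: sets)
    have "emeasure (bind ?\<mu> \<kappa>) A = (\<integral>\<^sup>+x. emeasure (\<kappa> x) A \<partial>?\<mu>)"
      using ne by (intro emeasure_bind[where N = "LX \<Otimes>\<^sub>M LY"]) auto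
    also have "\<dots> = (\<integral>\<^sup>+x. ennreal (SW.pY x) * r x * emeasure (\<kappa> x) A \<partial>LX)"
      by (rule nn_integral_density) auto
    also have "\<dots> = (\<integral>\<^sup>+x. (\<integral>\<^sup>+y. ennreal (P x y) * r x * indicator A (x, y) \<partial>LY) \<partial>LX)"
    proof (rule nn_integral_cong)
      fix x assume x [measurable]: "x \<in> space LX"
      have "emeasure (\<kappa> x) A = (\<integral>\<^sup>+p. indicator A p \<partial>\<kappa> x)"
        by (simp add: \<kappa>_def)
      also have "\<dots> = (\<integral>\<^sup>+y. indicator A (x, y) \<partial>SW.condX x)"
        unfolding \<kappa>_def by (rule nn_integral_distr) auto
      finally have "ennreal (SW.pY x) * r x * emeasure (\<kappa> x) A = r x * (\<integral>\<^sup>+y. ennreal (SW.P y x) * indicator A (x, y) \<partial>LY)"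
        using SW.nn_integral_condX_mult[OF x, of "\<lambda>y. indicator A (x, y)"] by (simp add: mult_ac)
      also have "\<dots> = (\<integral>\<^sup>+y. r x * (ennreal (P x y) * indicator A (x, y)) \<partial>LY)"
        unfolding swap_P by (rule nn_integral_cmult[symmetric]) measurable
      finally show "ennreal (SW.pY x) * r x * emeasure (\<kappa> x) A = (\<integral>\<^sup>+y. ennreal (P x y) * r x * indicator A (x, y) \<partial>LY)"
        by (simp add: mult_ac)
    qed
    also have "\<dots> = (\<integral>\<^sup>+p. ennreal (P (fst p) (snd p)) * r (fst p) * indicator A p \<partial>(LX \<Otimes>\<^sub>M LY))"
      by (subst Y.nn_integral_fst[symmetric]) auto
    also have "\<dots> = emeasure ?R A" by (rule emeasure_density[symmetric]) auto
    finally show "emeasure (bind ?\<mu> \<kappa>) A = emeasure ?R A" .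
  qed
  finally show ?thesis .
qed

text \<open>For fixed \<open>y\<close>, the weight \<open>r\<close> at the old point and the test
  set at the new one enter only through their \<open>condX y\<close> averages \<open>h\<close> and
  \<open>q\<close>, so the two can trade places. Fubini then turns \<open>h\<close> into an average
  over \<open>y\<close> given \<open>x\<close>.\<close>

lemma bind_kernelX:
  assumes [measurable]: "r \<in> borel_measurable LX"
  shows "bind (density (LX \<Otimes>\<^sub>M LY) (\<lambda>p. ennreal (P (fst p) (snd p)) * r (fst p))) (\<lambda>p. kernelX n m \<eta> \<sigma> f (snd p))
      = density LX (\<lambda>x. ennreal (SW.pY x) * (\<integral>\<^sup>+y. (\<integral>\<^sup>+x. r x \<partial>condX y) \<partial>SW.condX x))" (is "bind ?\<mu> ?k = ?R")
proof -
  define \<kappa> where "\<kappa> p = condX (snd p)" for p :: "(nat \<Rightarrow> 'a) \<times> (nat \<Rightarrow> 'a)"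
  have [measurable]: "\<kappa> \<in> measurable (LX \<Otimes>\<^sub>M LY) (subprob_algebra LX)"
    unfolding \<kappa>_def by measurable
  have ne: "space ?\<mu> \<noteq> {}" using space_blockM_nonempty by simp
  define h where "h y = (\<integral>\<^sup>+x. r x \<partial>condX y)" for y
  have [measurable]: "h \<in> borel_measurable LY" unfolding h_def by measurable
  have "bind ?\<mu> ?k = bind ?\<mu> \<kappa>"
    by (intro bind_cong refl) (auto simp: \<kappa>_def kernelX_eq space_pair_measure)
  also have "\<dots> = ?R"
  proof (rule measure_eqI)
    show sets: "sets (bind ?\<mu> \<kappa>) = sets ?R"
      using ne by (subst sets_bind[where N = LX]) (auto simp: \<kappa>_def)
    fix A assume "A \<in> sets (bind ?\<mu> \<kappa>)"
    then have A [measurable]: "A \<in> sets LX" by (simp add: sets)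
    define q where "q y = emeasure (condX y) A" for y
    have q: "q y = (\<integral>\<^sup>+x. indicator A x \<partial>condX y)" for y by (simp add: q_def)
    have [measurable]: "q \<in> borel_measurable LY" unfolding q by measurable
    have "emeasure (bind ?\<mu> \<kappa>) A = (\<integral>\<^sup>+p. emeasure (\<kappa> p) A \<partial>?\<mu>)"
      using ne by (intro emeasure_bind[where N = LX]) auto
    also have "\<dots> = (\<integral>\<^sup>+p. ennreal (P (fst p) (snd p)) * r (fst p) * q (snd p) \<partial>(LX \<Otimes>\<^sub>M LY))"
      unfolding \<kappa>_def q_def[symmetric] by (rule nn_integral_density) auto
    also have "\<dots> = (\<integral>\<^sup>+y. (\<integral>\<^sup>+x. ennreal (P x y) * r x * q y \<partial>LX) \<partial>LY)"
      by (subst nn_integral_XY) auto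
    also have "\<dots> = (\<integral>\<^sup>+y. (\<integral>\<^sup>+x. ennreal (P x y) * indicator A x * h y \<partial>LX) \<partial>LY)"
    proof (rule nn_integral_cong)
      fix y assume y [measurable]: "y \<in> space LY"
      have "(\<integral>\<^sup>+x. ennreal (P x y) * r x * q y \<partial>LX) = ennreal (pY y) * h y * q y"
        unfolding h_def nn_integral_condX_mult[OF y assms] by (rule nn_integral_multc) measurable
      also have "\<dots> = ennreal (pY y) * q y * h y" by (simp only: mult_ac)
      also have "\<dots> = (\<integral>\<^sup>+x. ennreal (P x y) * indicator A x * h y \<partial>LX)"
        unfolding q by (subst nn_integral_condX_mult[OF y]) (auto intro!: nn_integral_multc[symmetric])
      finally show "(\<integral>\<^sup>+x. ennreal (P x y) * r x * q y \<partial>LX) = (\<integral>\<^sup>+x. ennreal (P x y) * indicator A x * h y \<partial>LX)" .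
    qed
    also have "\<dots> = (\<integral>\<^sup>+x. (\<integral>\<^sup>+y. ennreal (P x y) * indicator A x * h y \<partial>LY) \<partial>LX)"
      by (rule XY.Fubini') measurable
    also have "\<dots> = (\<integral>\<^sup>+x. ennreal (SW.pY x) * (\<integral>\<^sup>+y. h y \<partial>SW.condX x) * indicator A x \<partial>LX)"
    proof (rule nn_integral_cong)
      fix x assume x [measurable]: "x \<in> space LX"
      have "(\<integral>\<^sup>+y. ennreal (P x y) * indicator A x * h y \<partial>LY) = (\<integral>\<^sup>+y. ennreal (P x y) * h y * indicator A x \<partial>LY)"
        by (simp only: mult_ac)
      also have "\<dots> = (\<integral>\<^sup>+y. ennreal (P x y) * h y \<partial>LY) * indicator A x"
        by (rule nn_integral_multc) measurable
      finally show "(\<integral>\<^sup>+y. ennreal (P x y) * indicator A x * h y \<partial>LY)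
          = ennreal (SW.pY x) * (\<integral>\<^sup>+y. h y \<partial>SW.condX x) * indicator A x"
        by (simp add: SW.nn_integral_condX_mult[OF x, unfolded swap_P])
    qed
    also have "\<dots> = emeasure ?R A" unfolding h_def by (rule emeasure_density[symmetric]) auto
    finally show "emeasure (bind ?\<mu> \<kappa>) A = emeasure ?R A" .
  qed
  finally show ?thesis .
qed

text \<open>Density of the law of the \<open>k\<close>-th \<open>X\<close> relative to the
  \<open>X\<close>-marginal of the target: a sweep acts on it by two conditional
  expectations.\<close>

primrec rel :: "((nat \<Rightarrow> 'a) \<Rightarrow> ennreal) \<Rightarrow> nat \<Rightarrow> (nat \<Rightarrow> 'a) \<Rightarrow> ennreal" where
  "rel r 0 = r"
| "rel r (Suc k) = (\<lambda>x. \<integral>\<^sup>+y. (\<integral>\<^sup>+x. rel r k x \<partial>condX y) \<partial>SW.condX x)"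

text \<open>A single induction, because the contraction at each stage uses measurability and mass 1
  of the same density. The exponent \<open>2 * k\<close> counts half steps.\<close>

lemma rel_properties:
  assumes r: "r \<in> borel_measurable LX" "(\<integral>\<^sup>+x. ennreal (SW.pY x) * r x \<partial>LX) = 1"
    and \<mu>0: "\<mu>0 = density LX (\<lambda>x. ennreal (SW.pY x) * r x)"
  shows "rel r k \<in> borel_measurable LX" (is "?M k")
    and "(\<integral>\<^sup>+x. ennreal (SW.pY x) * rel r k x \<partial>LX) = 1" (is "?T k")
    and "lawX n m \<eta> \<sigma> f g \<mu>0 k = density LX (\<lambda>x. ennreal (SW.pY x) * rel r k x)" (is "?L k")
    and "ennreal ((kF * kG) ^ (2 * k)) * (\<integral>\<^sup>+x. ennreal (SW.pY x) * ennreal (ent (enn2real (rel r k x))) \<partial>LX)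
        \<le> (\<integral>\<^sup>+x. ennreal (SW.pY x) * ennreal (ent (enn2real (r x))) \<partial>LX)" (is "?C k")
proof -
  have "?M k \<and> ?T k \<and> ?L k \<and> ?C k"
  proof (induction k)
    case (Suc k)
    then have M [measurable]: "?M k" and T: "?T k" and L: "?L k" and C: "?C k" by - (elim conjE, assumption)+
    define h where "h y = (\<integral>\<^sup>+x. rel r k x \<partial>condX y)" for y
    have h [measurable]: "h \<in> borel_measurable LY" unfolding h_def by measurable
    have rS: "rel r (Suc k) x = (\<integral>\<^sup>+y. h y \<partial>SW.condX x)" for x by (simp add: h_def)
    \<comment> \<open>\<open>s1\<close> averages over \<open>X\<close> given \<open>y\<close>;
      \<open>s2\<close> averages over \<open>Y\<close> given \<open>x\<close> in the swapped model,
      where \<open>kF\<close> and \<open>kG\<close> change places. Each contributes the factor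
      \<open>kF * kG\<close>.\<close>
    note s1 = half_step_ennreal[OF M T, folded h_def]
    note s2 = SW.half_step_ennreal[OF h s1(1), folded rS, unfolded swap_k]
    have "?M (Suc k)" unfolding rS by measurable
    moreover note s2(1)
    moreover have "?L (Suc k)"
    proof -
      have "lawXY n m \<eta> \<sigma> f g \<mu>0 k = density (LX \<Otimes>\<^sub>M LY) (\<lambda>p. ennreal (P (fst p) (snd p)) * rel r k (fst p))"
        unfolding lawXY.simps L by (rule bind_kernelY[OF M])
      then show ?thesis
        unfolding lawX.simps rel.simps by (simp only: bind_kernelX[OF M])
    qed
    moreover have "?C (Suc k)"
    proof -
      let ?k = "kF * kG"
      have k: "0 \<le> ?k" using kF kG by simp
      let ?H = "\<integral>\<^sup>+x. ennreal (SW.pY x) * ennreal (ent (enn2real (rel r (Suc k) x))) \<partial>LX"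
      have split: "ennreal (a * (b * c)) * H = ennreal a * (ennreal b * (ennreal c * H))"
        if "0 \<le> a" "0 \<le> b" "0 \<le> c" for a b c H
        using that by (simp add: ennreal_mult mult.assoc)
      have "?k ^ (2 * Suc k) = ?k ^ (2 * k) * (?k * (kG * kF))"
        by (simp add: mult_ac)
      then have "ennreal (?k ^ (2 * Suc k)) * ?H = ennreal (?k ^ (2 * k)) * (ennreal ?k * (ennreal (kG * kF) * ?H))"
        using k kF kG split[of "?k ^ (2 * k)" ?k "kG * kF" ?H] by (simp only: zero_le_power mult.commute[of kG kF])
      also have "\<dots> \<le> ennreal (?k ^ (2 * k)) * (ennreal ?k * (\<integral>\<^sup>+y. ennreal (pY y) * ennreal (ent (enn2real (h y))) \<partial>LY))"
        using s2(2) by (intro mult_left_mono) auto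
      also have "\<dots> \<le> ennreal (?k ^ (2 * k)) * (\<integral>\<^sup>+x. ennreal (SW.pY x) * ennreal (ent (enn2real (rel r k x))) \<partial>LX)"
        using s1(2) by (intro mult_left_mono) auto
      also note C
      finally show ?thesis .
    qed
    ultimately show ?case by (intro conjI)
  next
    case 0
    show ?case using r \<mu>0 by (intro conjI) simp_all
  qed
  then show "?M k" "?T k" "?L k" "?C k" by - (elim conjE, assumption)+
qed

text \<open>Column and row sums of \<sigma> are at most \<open>n\<close> and \<open>m\<close>, which
  supplies the comparison of coefficients in \<open>rate_integral_le\<close>. Each of the two
  integrals yields two logarithms: one is exactly \<open>ln kG\<close> or \<open>ln kF\<close>, the
  other at most the remaining one.\<close>

lemma rateC_le:
  assumes sY: "\<And>j. j < m \<Longrightarrow> (\<Sum>i<n. \<sigma> i j) > 0" and sX: "\<And>i. i < n \<Longrightarrow> (\<Sum>j<m. \<sigma> i j) > 0"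
  shows "rateC n m \<eta> \<sigma> af ag \<le> 2 * ln (kF * kG)"
proof -
  define SY where "SY = Min ((\<lambda>j. \<Sum>i<n. \<sigma> i j) ` {..<m})"
  define SX where "SX = Min ((\<lambda>i. \<Sum>j<m. \<sigma> i j) ` {..<n})"
  define aF where "aF = Min (af ` {..<n})"
  define aG where "aG = Min (ag ` {..<m})"
  have a: "0 < aF" "0 < aG" using Min_af Min_ag by (simp_all add: aF_def aG_def)
  have nm: "0 < real n" "0 < real m" "1 \<le> real n" "1 \<le> real m" using n m by auto
  have SY: "0 < SY" "SY \<le> real n"
  proof -
    show "0 < SY" using sY m unfolding SY_def by (subst Min_gr_iff) (auto simp: lessThan_empty_iff)
    have "SY \<le> (\<Sum>i<n. \<sigma> i 0)" unfolding SY_def using m by (intro Min_le) auto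
    also have "\<dots> \<le> (\<Sum>i<n. 1)" using sig m by (intro sum_mono) auto
    finally show "SY \<le> real n" by simp
  qed
  have SX: "0 < SX" "SX \<le> real m"
  proof -
    show "0 < SX" using sX n unfolding SX_def by (subst Min_gr_iff) (auto simp: lessThan_empty_iff)
    have "SX \<le> (\<Sum>j<m. \<sigma> 0 j)" unfolding SX_def using n by (intro Min_le) auto
    also have "\<dots> \<le> (\<Sum>j<m. 1)" using sig n by (intro sum_mono) auto
    finally show "SX \<le> real m" by simp
  qed
  have half: "\<eta> / N * integral {0..1} (\<lambda>t. inverse (\<eta> * t * (1 - t) / s + real m * real n * (1 - t)\<^sup>2 / a + t\<^sup>2 / b))
      \<le> ln (1 + \<eta> * a / (N * (real m * real n))) + ln (1 + \<eta> * b / N)"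
    if "0 < N" "0 < s" "s \<le> N" "0 < a" "0 < b" for N s a b :: real
  proof -
    have "\<eta> / N \<le> \<eta> / s" using that eta by (intro divide_left_mono) auto
    then have "\<eta> / N * integral {0..1} (\<lambda>t. inverse (\<eta> / s * t * (1 - t) + (real m * real n / a) * (1 - t)\<^sup>2 + 1 / b * t\<^sup>2))
        \<le> ln (1 + (\<eta> / N) / (real m * real n / a)) + ln (1 + (\<eta> / N) / (1 / b))"
      using that eta nm by (intro rate_integral_le) auto
    then show ?thesis by (simp add: mult_ac)
  qed
  \<comment> \<open>The logarithm from the coefficient \<open>m n\<close> has this smaller argument,
    whereas \<open>kF\<close> has denominator \<open>m\<close>.\<close>
  have "\<eta> * aF / (real n * (real m * real n)) \<le> \<eta> * aF / real m"
  proof (intro divide_left_mono)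
    have "real m * 1 \<le> real m * (real n * real n)"
      using nm mult_mono[of 1 "real n" 1 "real n"] by (intro mult_left_mono) auto
    then show "real m \<le> real n * (real m * real n)" by (simp add: mult_ac)
  qed (use eta a nm in auto)
  then have "ln (1 + \<eta> * aF / (real n * (real m * real n))) \<le> ln kF"
    using eta a nm unfolding kF_def aF_def[symmetric] by (subst ln_le_cancel_iff) (auto intro: add_pos_nonneg)
  moreover have "\<eta> * aG / (real m * (real m * real n)) \<le> \<eta> * aG / real n"
  proof (intro divide_left_mono)
    have "real n * 1 \<le> real n * (real m * real m)"
      using nm mult_mono[of 1 "real m" 1 "real m"] by (intro mult_left_mono) auto
    then show "real n \<le> real m * (real m * real n)" by (simp add: mult_ac)
  qed (use eta a nm in auto)
  then have "ln (1 + \<eta> * aG / (real m * (real m * real n))) \<le> ln kG"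
    using eta a nm unfolding kG_def aG_def[symmetric] by (subst ln_le_cancel_iff) (auto intro: add_pos_nonneg)
  moreover have "rateC n m \<eta> \<sigma> af ag
      \<le> (ln (1 + \<eta> * aF / (real n * (real m * real n))) + ln kG) + (ln (1 + \<eta> * aG / (real m * (real m * real n))) + ln kF)"
    unfolding rateC_def Let_def SY_def[symmetric] SX_def[symmetric] aF_def[symmetric] aG_def[symmetric]
    using half[OF nm(1) SY a] half[OF nm(2) SX a(2,1)]
    unfolding kF_def kG_def aF_def[symmetric] aG_def[symmetric] by (rule add_mono)
  moreover have "ln (kF * kG) = ln kF + ln kG" using kF kG by (simp add: ln_mult)
  ultimately show ?thesis by linarith
qed

text \<open>Without absolute continuity of the initial law the right side is infinite. Otherwise
  both divergences are integrals of \<open>ent\<close> against the \<open>X\<close>-marginal of the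
  target, for \<open>rel r k\<close> and \<open>r\<close>, and the contraction of \<open>rel\<close>
  applies.\<close>

lemma KL_lawXY_le:
  assumes sY: "\<And>j. j < m \<Longrightarrow> (\<Sum>i<n. \<sigma> i j) > 0" and sX: "\<And>i. i < n \<Longrightarrow> (\<Sum>j<m. \<sigma> i j) > 0"
    and "prob_space \<mu>0" and \<mu>0: "sets \<mu>0 = sets LX"
  shows "KL (lawXY n m \<eta> \<sigma> f g \<mu>0 k) (target n m \<eta> \<sigma> f g)
      \<le> ereal (exp (- real k * rateC n m \<eta> \<sigma> af ag)) * KL \<mu>0 (distr (target n m \<eta> \<sigma> f g) LX fst)"
proof (cases "absolutely_continuous (density LX (\<lambda>x. ennreal (SW.pY x))) \<mu>0")
  case False
  then show ?thesis unfolding target_marginal by (simp add: KL_def)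
next
  case True
  define \<nu> where "\<nu> = density LX (\<lambda>x. ennreal (SW.pY x))"
  have pX [measurable]: "SW.pY \<in> borel_measurable LX" by measurable
  have sets_\<nu> [simp, measurable_cong]: "sets \<nu> = sets LX" by (simp add: \<nu>_def)
  have "prob_space \<nu>"
  proof
    show "emeasure \<nu> (space \<nu>) = 1"
      using SW.nn_integral_pY by (simp add: \<nu>_def emeasure_density cong: nn_integral_cong)
  qed
  then interpret \<nu>: prob_space \<nu> .
  interpret \<mu>: prob_space \<mu>0 by fact
  define r where "r = RN_deriv \<nu> \<mu>0"
  have r\<nu>: "r \<in> borel_measurable \<nu>" unfolding r_def by simp
  then have r [measurable]: "r \<in> borel_measurable LX" by (simp cong: measurable_cong_sets)
  have dens: "density \<nu> r = \<mu>0"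
    unfolding r_def using True \<mu>0 by (intro \<nu>.density_RN_deriv) (simp_all add: \<nu>_def)
  then have \<mu>0_eq: "\<mu>0 = density LX (\<lambda>x. ennreal (SW.pY x) * r x)"
    by (simp add: \<nu>_def density_density_eq)
  have "emeasure (density \<nu> r) (space \<nu>) = 1"
    using \<mu>.emeasure_space_1 sets_eq_imp_space_eq[OF \<mu>0] unfolding dens by (simp add: \<nu>_def)
  moreover have "emeasure (density \<nu> r) (space \<nu>) = (\<integral>\<^sup>+x. r x * indicator (space \<nu>) x \<partial>\<nu>)"
    by (rule emeasure_density[OF r\<nu> sets.top])
  moreover have "\<dots> = (\<integral>\<^sup>+x. r x \<partial>\<nu>)" by (intro nn_integral_cong) simp
  ultimately have r1: "(\<integral>\<^sup>+x. r x \<partial>\<nu>) = 1" by simp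
  have int\<nu>: "(\<integral>\<^sup>+x. F x \<partial>\<nu>) = (\<integral>\<^sup>+x. ennreal (SW.pY x) * F x \<partial>LX)" if "F \<in> borel_measurable LX" for F
    unfolding \<nu>_def using that by (intro nn_integral_density) auto
  have r1': "(\<integral>\<^sup>+x. ennreal (SW.pY x) * r x \<partial>LX) = 1" using r1 int\<nu>[OF r] by simp
  note R = rel_properties[OF r r1' \<mu>0_eq, of k]
  note [measurable] = R(1)
  let ?E = "\<lambda>r. \<integral>\<^sup>+x. ennreal (SW.pY x) * ennreal (ent (enn2real (r x))) \<partial>LX"
  have KL0: "KL \<mu>0 (distr (target n m \<eta> \<sigma> f g) LX fst) = enn2ereal (?E r)"
    using KL_density_ent[OF \<open>prob_space \<nu>\<close> r\<nu> r1] unfolding dens target_marginal \<nu>_def[symmetric]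
    by (subst (asm) int\<nu>) auto
  define \<pi> where "\<pi> = target n m \<eta> \<sigma> f g"
  have \<pi>: "\<pi> = density (LX \<Otimes>\<^sub>M LY) (\<lambda>p. ennreal (P (fst p) (snd p)))" by (simp add: \<pi>_def target_eq)
  have sets_\<pi> [simp, measurable_cong]: "sets \<pi> = sets (LX \<Otimes>\<^sub>M LY)" by (simp add: \<pi>)
  have "prob_space \<pi>"
  proof
    show "emeasure \<pi> (space \<pi>) = 1"
      using P_total by (simp add: \<pi> emeasure_density cong: nn_integral_cong)
  qed
  have int\<pi>: "(\<integral>\<^sup>+p. F (fst p) \<partial>\<pi>) = (\<integral>\<^sup>+x. ennreal (SW.pY x) * F x \<partial>LX)" if [measurable]: "F \<in> borel_measurable LX" for F
  proof -
    have "(\<integral>\<^sup>+p. F (fst p) \<partial>\<pi>) = (\<integral>\<^sup>+x. F x \<partial>distr \<pi> LX fst)"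
      by (rule nn_integral_distr[symmetric]) auto
    also have "distr \<pi> LX fst = \<nu>" by (simp add: \<pi>_def \<nu>_def target_marginal)
    finally show ?thesis using int\<nu>[OF that] by simp
  qed
  have "lawXY n m \<eta> \<sigma> f g \<mu>0 k = density (LX \<Otimes>\<^sub>M LY) (\<lambda>p. ennreal (P (fst p) (snd p)) * rel r k (fst p))"
    unfolding lawXY.simps R(3) by (rule bind_kernelY[OF R(1)])
  also have "\<dots> = density \<pi> (\<lambda>p. rel r k (fst p))"
    unfolding \<pi> by (rule density_density_eq[symmetric]) auto
  finally have law: "lawXY n m \<eta> \<sigma> f g \<mu>0 k = density \<pi> (\<lambda>p. rel r k (fst p))" .
  have KLk: "KL (lawXY n m \<eta> \<sigma> f g \<mu>0 k) \<pi> = enn2ereal (?E (rel r k))"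
  proof -
    have "(\<integral>\<^sup>+p. rel r k (fst p) \<partial>\<pi>) = 1" using int\<pi>[OF R(1)] R(2) by simp
    then have "KL (lawXY n m \<eta> \<sigma> f g \<mu>0 k) \<pi> = enn2ereal (\<integral>\<^sup>+p. ennreal (ent (enn2real (rel r k (fst p)))) \<partial>\<pi>)"
      unfolding law by (intro KL_density_ent \<open>prob_space \<pi>\<close>) auto
    also have "(\<integral>\<^sup>+p. ennreal (ent (enn2real (rel r k (fst p)))) \<partial>\<pi>) = ?E (rel r k)"
      by (rule int\<pi>) measurable
    finally show ?thesis .
  qed
  define C where "C = rateC n m \<eta> \<sigma> af ag"
  have kk: "0 < kF * kG" using kF kG by simp
  have "exp (real k * C) \<le> exp (real k * (2 * ln (kF * kG)))"
    using rateC_le[OF sY sX] by (simp add: C_def mult_left_mono)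
  also have "\<dots> = exp (real (2 * k) * ln (kF * kG))" by (simp add: mult_ac)
  also have "\<dots> = (kF * kG) ^ (2 * k)"
    using kk by (simp only: exp_of_nat_mult exp_ln)
  finally have "ennreal (exp (real k * C)) * ?E (rel r k) \<le> ennreal ((kF * kG) ^ (2 * k)) * ?E (rel r k)"
    by (intro mult_right_mono ennreal_leI) auto
  also note R(4)
  \<comment> \<open>Multiplying by the inverse exponential in \<open>ennreal\<close> also covers an
    infinite initial divergence.\<close>
  finally have "ennreal (exp (- real k * C)) * (ennreal (exp (real k * C)) * ?E (rel r k)) \<le> ennreal (exp (- real k * C)) * ?E r"
    by (intro mult_left_mono) auto
  moreover have "ennreal (exp (- real k * C)) * ennreal (exp (real k * C)) = 1"
    by (simp add: mult_exp_exp flip: ennreal_mult)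
  ultimately have "?E (rel r k) \<le> ennreal (exp (- real k * C)) * ?E r"
    by (simp only: mult.assoc[symmetric] mult_1_left)
  then have "enn2ereal (?E (rel r k)) \<le> enn2ereal (ennreal (exp (- real k * C)) * ?E r)"
    by (simp only: less_eq_ennreal.rep_eq)
  also have "\<dots> = ereal (exp (- real k * C)) * enn2ereal (?E r)"
    by (simp only: times_ennreal.rep_eq enn2ereal_ennreal exp_ge_zero)
  finally show ?thesis
    unfolding KL0 KLk[unfolded \<pi>_def] C_def .
qed

end

theorem mainTheorem7:
  fixes n m :: nat and \<eta> :: real and \<sigma> :: "nat \<Rightarrow> nat \<Rightarrow> real"
    and f g :: "nat \<Rightarrow> 'a::euclidean_space \<Rightarrow> real" and af ag :: "nat \<Rightarrow> real"
    and \<mu>0 :: "(nat \<Rightarrow> 'a) measure" and k :: nat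
  assumes "n \<ge> 1" and "m \<ge> 1" and "\<eta> > 0"
    and "\<And>i. i < n \<Longrightarrow> af i > 0 \<and> strongly_convex (af i) (f i)"
    and "\<And>j. j < m \<Longrightarrow> ag j > 0 \<and> strongly_convex (ag j) (g j)"
    and "\<And>i j. i < n \<Longrightarrow> j < m \<Longrightarrow> 0 \<le> \<sigma> i j \<and> \<sigma> i j \<le> 1"
    and "\<And>j. j < m \<Longrightarrow> (\<Sum>i<n. \<sigma> i j) > 0"
    and "\<And>i. i < n \<Longrightarrow> (\<Sum>j<m. \<sigma> i j) > 0"
    and "prob_space \<mu>0" and "sets \<mu>0 = sets (blockM n)"
  shows "KL (lawXY n m \<eta> \<sigma> f g \<mu>0 k) (target n m \<eta> \<sigma> f g)
         \<le> ereal (exp (- real k * rateC n m \<eta> \<sigma> af ag))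
           * KL \<mu>0 (distr (target n m \<eta> \<sigma> f g) (blockM n) fst)"
proof -
  interpret gibbs_model n m \<eta> \<sigma> f g af ag
    using assms(1-6) by unfold_locales auto
  show ?thesis using assms(7-10) by (rule KL_lawXY_le)
qed

end
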